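(* Let $A$ and $Q$ be finitely generated abelian groups. Then the wreath product $A\wr Q$ is LERF.
   Context: The wreath product is the restricted one: $A\wr Q = A^{Q}\rtimes Q$, where $A^{Q}=\bigoplus_{q\in Q}A$ is the direct sum of copies of $A$ indexed by $Q$ and $Q$ acts by permuting the coordinates via translation. The profinite topology on a group $\Gamma$ is the topology having the cosets of finite-index subgroups as a basis. A subgroup $S$ of $\Gamma$ is called separable if it is closed in the profinite topology of $\Gamma$. A finitely generated group is LERF if all of its finitely generated subgroups are separable. *)

theory Defs
  imports "HOL-Analysis.Abstract_Topology" "HOL-Algebra.Product_Groups"
begin

definition finitely_generated :: "('a, 'm) monoid_scheme \<Rightarrow> bool"
  where "finitely_generated G \<longleftrightarrow> (\<exists>X \<subseteq> carrier G. finite X \<and> generate G X = carrier G)"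

definition finite_index_subgroup :: "'a set \<Rightarrow> ('a, 'm) monoid_scheme \<Rightarrow> bool"
  where "finite_index_subgroup H G \<longleftrightarrow> subgroup H G \<and> finite (rcosets\<^bsub>G\<^esub> H)"

text \<open>
  Left cosets are used; since \<open>H #> g = g <# (inv g <# H #> g)\<close>, the right cosets of the
  finite-index subgroups are the same sets.
\<close>
definition finite_index_coset :: "('a, 'm) monoid_scheme \<Rightarrow> 'a set \<Rightarrow> bool"
  where "finite_index_coset G U \<longleftrightarrow>
    (\<exists>g H. g \<in> carrier G \<and> finite_index_subgroup H G \<and> U = g <#\<^bsub>G\<^esub> H)"

text \<open>
  The operator \<open>topology\<close> is only meaningful on predicates satisfying \<open>istopology\<close>;
  for groups this is established in \<open>openin_profinite_topology\<close> below.
\<close>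
definition profinite_topology :: "('a, 'm) monoid_scheme \<Rightarrow> 'a topology"
  where "profinite_topology G = topology (arbitrary union_of finite_index_coset G)"

definition separable_subgroup :: "'a set \<Rightarrow> ('a, 'm) monoid_scheme \<Rightarrow> bool"
  where "separable_subgroup S G \<longleftrightarrow> subgroup S G \<and> closedin (profinite_topology G) S"

definition LERF :: "('a, 'm) monoid_scheme \<Rightarrow> bool"
  where "LERF G \<longleftrightarrow> group G \<and> finitely_generated G \<and>
    (\<forall>S. subgroup S G \<and> finitely_generated (G\<lparr>carrier := S\<rparr>) \<longrightarrow> separable_subgroup S G)"

text \<open>\<open>\<phi> h n\<close> is the result of acting with \<open>h\<close> on \<open>n\<close>.\<close>
definition semidirect_product ::
    "('a, 'm) monoid_scheme \<Rightarrow> ('b, 'n) monoid_scheme \<Rightarrow> ('b \<Rightarrow> 'a \<Rightarrow> 'a) \<Rightarrow> ('a \<times> 'b) monoid"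
  where "semidirect_product N H \<phi> =
    \<lparr>carrier = carrier N \<times> carrier H,
     monoid.mult = (\<lambda>(n, h) (n', h'). (n \<otimes>\<^bsub>N\<^esub> \<phi> h n', h \<otimes>\<^bsub>H\<^esub> h')),
     one = (\<one>\<^bsub>N\<^esub>, \<one>\<^bsub>H\<^esub>)\<rparr>"

text \<open>
  Left translation by \<open>q\<close> moves the coordinate at \<open>p\<close> to \<open>q \<otimes> p\<close>. The elements of
  \<open>sum_group\<close> are extensional functions, hence the restriction to \<open>carrier Q\<close>.
\<close>
definition translate :: "('b, 'n) monoid_scheme \<Rightarrow> 'b \<Rightarrow> ('b \<Rightarrow> 'a) \<Rightarrow> 'b \<Rightarrow> 'a"
  where "translate Q q f = (\<lambda>p \<in> carrier Q. f (inv\<^bsub>Q\<^esub> q \<otimes>\<^bsub>Q\<^esub> p))"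

definition wreath_product ::
    "('a, 'm) monoid_scheme \<Rightarrow> ('b, 'n) monoid_scheme \<Rightarrow> (('b \<Rightarrow> 'a) \<times> 'b) monoid"
  where "wreath_product A Q =
    semidirect_product (sum_group (carrier Q) (\<lambda>_. A)) Q (translate Q)"


lemma (in group) finite_index_subgroup_Int:
  assumes "finite_index_subgroup H G" "finite_index_subgroup K G"
  shows "finite_index_subgroup (H \<inter> K) G"
proof -
  have H: "subgroup H G" "finite (rcosets H)" and K: "subgroup K G" "finite (rcosets K)"
    using assms by (auto simp: finite_index_subgroup_def)
  have eq: "(H \<inter> K) #> x = (H #> x) \<inter> (K #> x)" if "x \<in> carrier G" for x
  proof
    show "(H #> x) \<inter> (K #> x) \<subseteq> (H \<inter> K) #> x"
    proof
      fix y assume "y \<in> (H #> x) \<inter> (K #> x)"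
      then obtain h k where y: "h \<in> H" "k \<in> K" "y = h \<otimes> x" "y = k \<otimes> x"
        by (auto simp: r_coset_def)
      then have "h = k"
        using that H(1) K(1) right_cancel subgroup.mem_carrier by metis
      then show "y \<in> (H \<inter> K) #> x"
        using y by (auto simp: r_coset_def)
    qed
  qed (auto simp: r_coset_def)
  have "rcosets (H \<inter> K) \<subseteq> (\<lambda>(U, V). U \<inter> V) ` ((rcosets H) \<times> (rcosets K))"
    unfolding RCOSETS_def using eq by auto
  then have "finite (rcosets (H \<inter> K))"
    using H K by (meson finite_SigmaI finite_imageI finite_subset)
  then show ?thesis
    using H K subgroups_Inter_pair by (auto simp: finite_index_subgroup_def)
qed

lemma (in group) l_coset_eq_of_mem:
  assumes "subgroup H G" "g \<in> carrier G" "x \<in> g <# H"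
  shows "x \<in> carrier G" "g <# H = x <# H"
  using assms l_repr_independence l_coset_carrier subgroup.subset by blast+

lemma (in group) finite_index_coset_Int:
  assumes "finite_index_coset G U" "finite_index_coset G V" "x \<in> U \<inter> V"
  shows "\<exists>W. finite_index_coset G W \<and> x \<in> W \<and> W \<subseteq> U \<inter> V"
proof -
  obtain g H h K where gH: "g \<in> carrier G" "finite_index_subgroup H G" "U = g <# H"
    and hK: "h \<in> carrier G" "finite_index_subgroup K G" "V = h <# K"
    using assms by (auto simp: finite_index_coset_def)
  have sub: "subgroup H G" "subgroup K G"
    using gH hK by (auto simp: finite_index_subgroup_def)
  have x: "x \<in> carrier G" "U = x <# H" "V = x <# K"
    using l_coset_eq_of_mem[OF sub(1) gH(1)] l_coset_eq_of_mem[OF sub(2) hK(1)] assms(3) gH hK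
    by auto
  have "x \<in> x <# (H \<inter> K)"
    using x(1) sub subgroup.one_closed[of _ G] by (force simp: l_coset_def)
  moreover have "x <# (H \<inter> K) \<subseteq> U \<inter> V"
    unfolding x(2,3) by (auto simp: l_coset_def)
  moreover have "finite_index_coset G (x <# (H \<inter> K))"
    using x(1) finite_index_subgroup_Int[OF gH(2) hK(2)] by (auto simp: finite_index_coset_def)
  ultimately show ?thesis by blast
qed

lemma (in group) openin_profinite_topology:
  "openin (profinite_topology G) = arbitrary union_of finite_index_coset G"
proof -
  have "istopology (arbitrary union_of finite_index_coset G)"
    unfolding istopology_base_eq arbitrary_union_of_alt
    using finite_index_coset_Int by blast
  then show ?thesis
    by (simp add: profinite_topology_def topology_inverse')
qed

lemma (in group) topspace_profinite_topology: "topspace (profinite_topology G) = carrier G"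
proof
  have "U \<subseteq> carrier G" if "finite_index_coset G U" for U
    using that l_coset_subset_G[OF subgroup.subset]
    by (auto simp: finite_index_coset_def finite_index_subgroup_def)
  then show "topspace (profinite_topology G) \<subseteq> carrier G"
    unfolding topspace_def openin_profinite_topology arbitrary_union_of_alt by blast
  have "rcosets (carrier G) \<subseteq> {carrier G}"
    using coset_join2 subgroup_self by (auto simp: RCOSETS_def)
  then have "finite_index_subgroup (carrier G) G"
    using subgroup_self finite_subset by (auto simp: finite_index_subgroup_def)
  then have "finite_index_coset G (\<one> <# carrier G)"
    by (auto simp: finite_index_coset_def)
  moreover have "\<one> <# carrier G = carrier G"
    by (simp add: lcos_mult_one)
  ultimately have "openin (profinite_topology G) (carrier G)"
    by (simp add: openin_profinite_topology arbitrary_union_of_inc)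
  then show "carrier G \<subseteq> topspace (profinite_topology G)"
    by (rule openin_subset)
qed

lemma (in group) separable_subgroup_iff:
  "separable_subgroup S G \<longleftrightarrow> subgroup S G \<and>
     (\<forall>x \<in> carrier G - S. \<exists>U. finite_index_coset G U \<and> x \<in> U \<and> U \<inter> S = {})"
proof (cases "subgroup S G")
  case True
  then have S: "S \<subseteq> carrier G" by (rule subgroup.subset)
  have sub: "U \<subseteq> carrier G" if "finite_index_coset G U" for U
    using that openin_subset[of "profinite_topology G" U]
    by (simp add: openin_profinite_topology arbitrary_union_of_inc topspace_profinite_topology)
  show ?thesis
    unfolding separable_subgroup_def closedin_def topspace_profinite_topology
      openin_profinite_topology arbitrary_union_of_alt
    using True S sub by blast
qed (simp add: separable_subgroup_def)

lemma group_semidirect_product: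
  assumes "group N" "group H"
    and hom: "\<And>h. h \<in> carrier H \<Longrightarrow> \<phi> h \<in> hom N N"
    and one: "\<And>n. n \<in> carrier N \<Longrightarrow> \<phi> \<one>\<^bsub>H\<^esub> n = n"
    and mult: "\<And>h k n. \<lbrakk>h \<in> carrier H; k \<in> carrier H; n \<in> carrier N\<rbrakk>
      \<Longrightarrow> \<phi> (h \<otimes>\<^bsub>H\<^esub> k) n = \<phi> h (\<phi> k n)"
  shows "group (semidirect_product N H \<phi>)"
proof -
  interpret N: group N by fact
  interpret H: group H by fact
  have cl: "\<phi> h n \<in> carrier N" if "h \<in> carrier H" "n \<in> carrier N" for h n
    using hom that by (auto simp: hom_def)
  have dist: "\<phi> h (m \<otimes>\<^bsub>N\<^esub> n) = \<phi> h m \<otimes>\<^bsub>N\<^esub> \<phi> h n"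
    if "h \<in> carrier H" "m \<in> carrier N" "n \<in> carrier N" for h m n
    using hom that by (auto simp: hom_def)
  show ?thesis
  proof (rule groupI)
    fix x assume "x \<in> carrier (semidirect_product N H \<phi>)"
    then obtain n h where x: "x = (n, h)" "n \<in> carrier N" "h \<in> carrier H"
      by (auto simp: semidirect_product_def)
    let ?y = "(\<phi> (inv\<^bsub>H\<^esub> h) (inv\<^bsub>N\<^esub> n), inv\<^bsub>H\<^esub> h)"
    have "\<phi> (inv\<^bsub>H\<^esub> h) (inv\<^bsub>N\<^esub> n) \<otimes>\<^bsub>N\<^esub> \<phi> (inv\<^bsub>H\<^esub> h) n = \<phi> (inv\<^bsub>H\<^esub> h) \<one>\<^bsub>N\<^esub>"
      using x by (simp flip: dist)
    also have "\<dots> = \<one>\<^bsub>N\<^esub>"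
      using hom_one[OF hom N.is_group N.is_group] x by simp
    finally show "\<exists>y \<in> carrier (semidirect_product N H \<phi>).
        y \<otimes>\<^bsub>semidirect_product N H \<phi>\<^esub> x = \<one>\<^bsub>semidirect_product N H \<phi>\<^esub>"
      using x cl by (intro bexI[of _ ?y]) (auto simp: semidirect_product_def)
  qed (auto simp: semidirect_product_def cl one dist mult N.m_assoc H.m_assoc)
qed

lemma carrier_sum_group_iff:
  assumes "group A"
  shows "f \<in> carrier (sum_group I (\<lambda>_. A)) \<longleftrightarrow>
    f \<in> I \<rightarrow>\<^sub>E carrier A \<and> finite {i \<in> I. f i \<noteq> \<one>\<^bsub>A\<^esub>}"
  using assms by (simp add: carrier_sum_group)

lemma group_wreath_product:
  assumes A: "group A" and Q: "group Q"
  shows "group (wreath_product A Q)"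
  unfolding wreath_product_def
proof (rule group_semidirect_product)
  interpret A: group A by fact
  interpret Q: group Q by fact
  let ?B = "sum_group (carrier Q) (\<lambda>_. A)"
  show "group ?B" by (simp add: A)
  show "group Q" by fact
  have cl: "translate Q q f \<in> carrier ?B" if q: "q \<in> carrier Q" and f: "f \<in> carrier ?B" for q f
  proof -
    have "p \<in> (\<lambda>r. q \<otimes>\<^bsub>Q\<^esub> r) ` {r \<in> carrier Q. f r \<noteq> \<one>\<^bsub>A\<^esub>}"
      if "p \<in> carrier Q" "f (inv\<^bsub>Q\<^esub> q \<otimes>\<^bsub>Q\<^esub> p) \<noteq> \<one>\<^bsub>A\<^esub>" for p
      using that q by (intro image_eqI[of _ _ "inv\<^bsub>Q\<^esub> q \<otimes>\<^bsub>Q\<^esub> p"]) (auto simp flip: Q.m_assoc)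
    then have "{p \<in> carrier Q. translate Q q f p \<noteq> \<one>\<^bsub>A\<^esub>}
        \<subseteq> (\<lambda>r. q \<otimes>\<^bsub>Q\<^esub> r) ` {r \<in> carrier Q. f r \<noteq> \<one>\<^bsub>A\<^esub>}"
      by (auto simp: translate_def)
    then have "finite {p \<in> carrier Q. translate Q q f p \<noteq> \<one>\<^bsub>A\<^esub>}"
      using f finite_subset by (auto simp: carrier_sum_group_iff[OF A])
    moreover have "translate Q q f \<in> carrier Q \<rightarrow>\<^sub>E carrier A"
      using f q by (auto simp: carrier_sum_group_iff[OF A] translate_def)
    ultimately show ?thesis
      by (simp add: carrier_sum_group_iff[OF A])
  qed
  show "translate Q q \<in> hom ?B ?B" if "q \<in> carrier Q" for q
    using that cl by (auto simp: hom_def translate_def restrict_def fun_eq_iff)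
  show "translate Q \<one>\<^bsub>Q\<^esub> f = f" if "f \<in> carrier ?B" for f
    using that
    by (auto simp: carrier_sum_group_iff[OF A] translate_def restrict_def fun_eq_iff
        PiE_iff extensional_def)
  show "translate Q (q \<otimes>\<^bsub>Q\<^esub> r) f = translate Q q (translate Q r f)"
    if "q \<in> carrier Q" "r \<in> carrier Q" "f \<in> carrier ?B" for q r f
    using that by (auto simp: translate_def restrict_def fun_eq_iff Q.inv_mult_group Q.m_assoc)
qed

end

theory Submission
  imports Defs "HOL-Algebra.Free_Abelian_Groups" "HOL-Computational_Algebra.Polynomial"
    "HOL-Library.Multiset" "HOL-Library.Product_Plus"
begin

text \<open>
  Let \<open>B\<close> be the base group of the wreath product, let \<open>S\<close> be a finitely generated subgroup with
  image \<open>P\<close> in \<open>Q\<close>, and let \<open>x\<close> be an element outside \<open>S\<close>. If the image of \<open>x\<close> lies outside \<open>P\<close>, then a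
  subgroup of finite index of the abelian group \<open>Q\<close> separates it from \<open>P\<close>. Otherwise \<open>x\<close> may be
  taken to be some \<open>b\<close> in \<open>B\<close>, outside \<open>N = S \<inter> B\<close>. As \<open>S\<close> is finitely generated, \<open>b\<close> and the
  elements of \<open>S\<close> only involve coordinates from finitely many cosets of \<open>P\<close>. Some subgroup \<open>L\<close> of
  finite index in \<open>Q\<close> contains \<open>P\<close>, has a retraction onto \<open>P\<close>, and separates these cosets; the
  retraction induces a homomorphism from \<open>B \<rtimes> L\<close> to \<open>B \<rtimes> P\<close> that fixes \<open>S\<close> and \<open>b\<close> and whose image
  has its coordinates in finitely many cosets of \<open>P\<close>. On these coordinates \<open>B\<close> is a finitely generated
  \<open>\<int>[P]\<close>-module with \<open>N\<close> as a submodule, and by a theorem of P. Hall a submodule \<open>N'\<close> of finite index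
  contains \<open>N\<close> but not \<open>b\<close>. The preimage of \<open>N' S\<close> is the required subgroup of finite index.

  For Hall's theorem, take \<open>N'\<close> maximal among the submodules that contain \<open>N\<close> but not \<open>b\<close>. Then \<open>b\<close>
  spans a simple module modulo \<open>N'\<close>, whose annihilator is a maximal ideal; its residue field is
  finite by the Nullstellensatz over \<open>\<int>\<close>, and by Fitting's lemma every element of the
  annihilator is nilpotent on the quotient by \<open>N'\<close>.
\<close>

section \<open>Submodules over finitely generated subrings\<close>

text \<open>The module theory takes place inside one ambient commutative ring: modules, ideals and
  subrings are subsets of it, and quotients appear only as congruences modulo a subset. Thus
  generators can be peeled off one at a time without a change of type. The price is that degrees
  have to be compared modulo a prime ideal, and that translations must be turned into
  multiplications in a ring type although \<open>Q\<close> lives on a carrier; multisets over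
  \<open>Q\<close> serve for this. The collapse onto finitely many cosets is forced: if
  \<open>P\<close> has infinite index, \<open>B\<close> is in general not finitely generated over
  \<int>[P], and Hall's theorem does not apply. It must not merge distinct cosets of
  \<open>P\<close> that are met by \<open>b\<close> or by the generators of \<open>S\<close>, which
  is why \<open>L\<close> has to avoid a finite set of differences. In Hall's theorem the
  annihilator of \<open>b\<close> controls only \<open>b\<close>; nilpotency is what spreads this
  control over the quotient. An integer in the annihilator gives finite exponent, integrality of the
  operators modulo the annihilator bounds degrees, and both together give finiteness.\<close>

inductive_set mspan :: "'r::comm_ring_1 set \<Rightarrow> 'r set \<Rightarrow> 'r set" for X F where
  zero: "0 \<in> mspan X F"
| base: "f \<in> F \<Longrightarrow> f \<in> mspan X F"
| diff: "a \<in> mspan X F \<Longrightarrow> b \<in> mspan X F \<Longrightarrow> a - b \<in> mspan X F"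
| mult: "x \<in> X \<Longrightarrow> a \<in> mspan X F \<Longrightarrow> x * a \<in> mspan X F"

text \<open>Operators and modules share one ring, so a single notion serves several purposes: for
  \<open>X = {}\<close> it describes additive subgroups, \<open>submod D D\<close> with
  \<open>1 \<in> D\<close> describes subrings, and inside \<open>mspan X {1}\<close> it describes
  the ideals of that ring.\<close>

definition submod :: "'r::comm_ring_1 set \<Rightarrow> 'r set \<Rightarrow> bool" where
  "submod X N \<longleftrightarrow> 0 \<in> N \<and> (\<forall>a\<in>N. \<forall>b\<in>N. a - b \<in> N) \<and> (\<forall>x\<in>X. \<forall>a\<in>N. x * a \<in> N)"

lemma submodI:
  assumes "0 \<in> N" "\<And>a b. a \<in> N \<Longrightarrow> b \<in> N \<Longrightarrow> a - b \<in> N"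
    "\<And>x a. x \<in> X \<Longrightarrow> a \<in> N \<Longrightarrow> x * a \<in> N"
  shows "submod X N"
  using assms by (auto simp: submod_def)

context
  fixes X N :: "'r::comm_ring_1 set"
  assumes N: "submod X N"
begin

lemma submod_zero: "0 \<in> N"
  and submod_diff: "\<And>a b. a \<in> N \<Longrightarrow> b \<in> N \<Longrightarrow> a - b \<in> N"
  and submod_mult: "\<And>x a. x \<in> X \<Longrightarrow> a \<in> N \<Longrightarrow> x * a \<in> N"
  using N by (auto simp: submod_def)

lemma submod_uminus: "a \<in> N \<Longrightarrow> - a \<in> N"
  using submod_diff[OF submod_zero, of a] by simp

lemma submod_add: "a \<in> N \<Longrightarrow> b \<in> N \<Longrightarrow> a + b \<in> N"
  using submod_diff[of a "- b"] submod_uminus[of b] by simp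

lemma submod_sum: "(\<And>i. i \<in> I \<Longrightarrow> g i \<in> N) \<Longrightarrow> sum g I \<in> N"
  by (induction I rule: infinite_finite_induct) (auto intro: submod_zero submod_add)

lemma submod_of_nat: "a \<in> N \<Longrightarrow> of_nat n * a \<in> N"
  by (induction n) (auto simp: algebra_simps intro: submod_zero submod_add)

lemma submod_of_int: "a \<in> N \<Longrightarrow> of_int n * a \<in> N"
proof (cases n)
  case (neg k)
  assume "a \<in> N"
  then have "of_nat (Suc k) * a \<in> N" by (rule submod_of_nat)
  from submod_uminus[OF this] show ?thesis
    by (simp only: neg of_int_minus of_int_of_nat_eq mult_minus_left)
qed (simp add: submod_of_nat)

lemma mspan_least: "F \<subseteq> N \<Longrightarrow> mspan X F \<subseteq> N"
proof
  fix a assume "F \<subseteq> N" "a \<in> mspan X F"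
  show "a \<in> N"
    using \<open>a \<in> mspan X F\<close> \<open>F \<subseteq> N\<close>
    by (induction rule: mspan.induct) (auto intro: submod_zero submod_diff submod_mult)
qed

lemma submod_ring_mult: "r \<in> mspan X {1} \<Longrightarrow> a \<in> N \<Longrightarrow> r * a \<in> N"
  by (induction rule: mspan.induct)
     (auto simp: left_diff_distrib mult.assoc intro: submod_zero submod_diff submod_mult)

end

lemma submod_mspan: "submod X (mspan X F)"
  by (auto simp: submod_def intro: mspan.intros)

lemma submod_subset: "submod X N \<Longrightarrow> Y \<subseteq> X \<Longrightarrow> submod Y N"
  by (auto simp: submod_def)

lemma mspan_mono: "X \<subseteq> Y \<Longrightarrow> F \<subseteq> G \<Longrightarrow> mspan X F \<subseteq> mspan Y G"
  by (rule mspan_least) (auto intro: submod_subset submod_mspan mspan.base)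

abbreviation coeffs_in :: "'r::comm_ring_1 poly \<Rightarrow> 'r set \<Rightarrow> bool" where
  "coeffs_in f W \<equiv> \<forall>i. coeff f i \<in> W"

text \<open>For a subring \<open>W\<close> this is the subring W[y]. The polynomial representing an
  element is not unique, since \<open>y\<close> may satisfy relations.\<close>

definition adjoin :: "'r::comm_ring_1 set \<Rightarrow> 'r \<Rightarrow> 'r set" where
  "adjoin W y = {poly f y | f. coeffs_in f W}"

lemma coeffs_in_diff:
  "submod X W \<Longrightarrow> coeffs_in f W \<Longrightarrow> coeffs_in g W \<Longrightarrow> coeffs_in (f - g) W"
  by (simp add: submod_diff)

lemma coeffs_in_pCons: "a \<in> W \<Longrightarrow> coeffs_in f W \<Longrightarrow> coeffs_in (pCons a f) W"
  by (auto simp: coeff_pCons split: nat.split)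

text \<open>A new operator \<open>y\<close> amounts to passing to polynomials in \<open>y\<close>.
  Hilbert's basis theorem and the Nullstellensatz both take their induction steps through this
  equality.\<close>

lemma mspan_insert:
  fixes y :: "'r::comm_ring_1"
  shows "mspan (insert y X) F = adjoin (mspan X F) y"
proof
  have "submod (insert y X) (adjoin (mspan X F) y)"
  proof (rule submodI)
    show "0 \<in> adjoin (mspan X F) y"
      by (auto simp: adjoin_def intro!: exI[of _ 0] mspan.zero)
  next
    fix a b assume "a \<in> adjoin (mspan X F) y" "b \<in> adjoin (mspan X F) y"
    then obtain f g where "a = poly f y" "b = poly g y" "coeffs_in f (mspan X F)"
      "coeffs_in g (mspan X F)"
      by (auto simp: adjoin_def)
    then show "a - b \<in> adjoin (mspan X F) y"
      by (auto simp: adjoin_def intro!: exI[of _ "f - g"] mspan.diff)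
  next
    fix x a assume x: "x \<in> insert y X" and "a \<in> adjoin (mspan X F) y"
    then obtain f where f: "a = poly f y" "coeffs_in f (mspan X F)"
      by (auto simp: adjoin_def)
    show "x * a \<in> adjoin (mspan X F) y"
    proof (cases "x = y")
      case True
      then show ?thesis
        using f coeffs_in_pCons[OF mspan.zero f(2)]
        by (auto simp: adjoin_def intro!: exI[of _ "pCons 0 f"])
    next
      case False
      then show ?thesis
        using f x by (auto simp: adjoin_def intro!: exI[of _ "smult x f"] mspan.mult)
    qed
  qed
  moreover have "F \<subseteq> adjoin (mspan X F) y"
  proof
    fix a assume "a \<in> F"
    then show "a \<in> adjoin (mspan X F) y"
      using coeffs_in_pCons[OF mspan.base, where f = 0]
      by (auto simp: adjoin_def mspan.zero intro!: exI[of _ "[:a:]"])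
  qed
  ultimately show "mspan (insert y X) F \<subseteq> adjoin (mspan X F) y"
    by (rule mspan_least)
next
  have "poly f y \<in> mspan (insert y X) F" if "coeffs_in f (mspan X F)" for f
    using that
  proof (induction f)
    case (pCons a f)
    have "a \<in> mspan X F"
      using pCons.prems[rule_format, of 0] by simp
    then have "a \<in> mspan (insert y X) F"
      using mspan_mono[of X "insert y X" F F] by auto
    moreover have "coeffs_in f (mspan X F)"
      using pCons.prems by (metis coeff_pCons_Suc)
    ultimately show ?case
      using pCons.IH by (auto intro!: submod_add[OF submod_mspan] mspan.mult)
  qed (simp add: mspan.zero)
  then show "adjoin (mspan X F) y \<subseteq> mspan (insert y X) F"
    by (auto simp: adjoin_def)
qed

lemma mspan_int_insert:
  assumes "v \<in> mspan {} (insert f F)"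
  obtains w n where "w \<in> mspan {} F" "v = w + of_int n * f"
proof -
  let ?U = "{w + of_int n * f | w n. w \<in> mspan {} F}"
  have "submod {} ?U"
  proof (rule submodI)
    show "0 \<in> ?U" using mspan.zero by (auto intro!: exI[of _ 0])
  next
    fix a b assume "a \<in> ?U" "b \<in> ?U"
    then obtain w n w' n' where "a = w + of_int n * f" "b = w' + of_int n' * f"
      "w \<in> mspan {} F" "w' \<in> mspan {} F" by auto
    then show "a - b \<in> ?U"
      by (auto intro!: exI[of _ "w - w'"] exI[of _ "n - n'"] mspan.diff simp: algebra_simps)
  qed simp
  moreover have "insert f F \<subseteq> ?U"
  proof
    fix a assume "a \<in> insert f F"
    moreover have "f = 0 + of_int 1 * f" "a = a + of_int 0 * f" by auto
    ultimately show "a \<in> ?U" using mspan.zero mspan.base by (cases "a = f") blast+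
  qed
  ultimately have "mspan {} (insert f F) \<subseteq> ?U"
    by (rule mspan_least)
  with assms have "v \<in> ?U" ..
  then show ?thesis using that by blast
qed

section \<open>Noetherian property and Hilbert's basis theorem\<close>

lemma int_subgroup_generator:
  fixes I :: "int set"
  assumes "0 \<in> I" "\<And>a b. a \<in> I \<Longrightarrow> b \<in> I \<Longrightarrow> a - b \<in> I"
  obtains d where "d \<in> I" "\<And>n. n \<in> I \<Longrightarrow> d dvd n"
proof (cases "I = {0}")
  case False
  have neg: "- a \<in> I" if "a \<in> I" for a using assms(2)[OF assms(1) that] by simp
  have add: "a + b \<in> I" if "a \<in> I" "b \<in> I" for a b using assms(2)[OF that(1) neg[OF that(2)]] by simp
  from False assms(1) obtain a where "a \<in> I" "a \<noteq> 0" by auto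
  then have "\<bar>a\<bar> \<in> I" "0 < \<bar>a\<bar>" using neg by (auto simp: abs_if)
  then have ex: "\<exists>n::nat. int n \<in> I \<and> 0 < n"
    by (intro exI[of _ "nat \<bar>a\<bar>"]) auto
  define d where "d = (LEAST n::nat. int n \<in> I \<and> 0 < n)"
  have d: "int d \<in> I" "0 < d"
    using LeastI_ex[OF ex] by (auto simp: d_def)
  have mul: "int k * int d \<in> I" for k
    using d(1) assms(1) add by (induction k) (auto simp: algebra_simps)
  have mulz: "k * int d \<in> I" for k
    using mul[of "nat k"] neg[OF mul[of "nat (-k)"]] by (cases "k \<ge> 0") auto
  have "int d dvd n" if "n \<in> I" for n
  proof -
    have "n mod int d \<in> I"
      using assms(2)[OF that mulz[of "n div int d"]] by (simp add: minus_div_mult_eq_mod)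
    moreover have "0 \<le> n mod int d" "n mod int d < int d" using d by auto
    ultimately have "\<not> 0 < nat (n mod int d)"
      using not_less_Least[of "nat (n mod int d)" "\<lambda>n. int n \<in> I \<and> 0 < n"]
      by (auto simp: d_def)
    then show ?thesis using \<open>0 \<le> n mod int d\<close> by (auto simp: dvd_eq_mod_eq_0)
  qed
  with d that show ?thesis by blast
qed (use that in auto)

text \<open>Induction on the generators: \<open>N\<close> is generated by its part inside
  \<open>mspan {} F\<close> and one further element, whose coefficient at the new generator divides
  all such coefficients. This starts the induction on operators in Hilbert's basis theorem.\<close>

lemma int_submod_finitely_generated:
  fixes F :: "'r::comm_ring_1 set"
  assumes "finite F" "submod {} N" "N \<subseteq> mspan {} F"
  shows "\<exists>G. finite G \<and> N = mspan {} G"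
  using assms
proof (induction F arbitrary: N)
  case empty
  have "mspan {} {} \<subseteq> {0::'r}"
    by (rule mspan_least) (auto simp: submod_def)
  then have "N = mspan {} {}"
    using empty mspan.zero[of "{}" "{}::'r set"] submod_zero[OF empty(1)] by blast
  then show ?case by blast
next
  case (insert f F)
  have "submod {} (N \<inter> mspan {} F)"
    using insert.prems submod_mspan[of "{}" F] by (auto simp: submod_def)
  then obtain G where G: "finite G" "N \<inter> mspan {} F = mspan {} G"
    using insert.IH by blast
  \<comment> \<open>The coefficient of \<open>f\<close> in an element need not be determined, since
    \<open>f\<close> may be torsion or dependent on \<open>F\<close>; \<open>I\<close> collects
    every coefficient that occurs and is still a subgroup of the integers.\<close>
  define I where "I = {n. \<exists>w \<in> mspan {} F. w + of_int n * f \<in> N}"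
  obtain d where d: "d \<in> I" "\<And>n. n \<in> I \<Longrightarrow> d dvd n"
  proof (rule int_subgroup_generator[of I])
    show "0 \<in> I" using mspan.zero submod_zero[OF insert.prems(1)] by (auto simp: I_def)
    fix a b assume "a \<in> I" "b \<in> I"
    then obtain v w where vw: "v \<in> mspan {} F" "w \<in> mspan {} F" "v + of_int a * f \<in> N"
      "w + of_int b * f \<in> N" by (auto simp: I_def)
    have "(v - w) + of_int (a - b) * f \<in> N"
      using submod_diff[OF insert.prems(1) vw(3,4)] by (simp add: algebra_simps)
    then show "a - b \<in> I" using mspan.diff[OF vw(1,2)] unfolding I_def by blast
  qed blast
  then obtain w where w: "w \<in> mspan {} F" "w + of_int d * f \<in> N" by (auto simp: I_def)
  let ?G = "insert (w + of_int d * f) G"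
  have "mspan {} ?G \<subseteq> N"
    using G w(2) mspan.base[of _ G "{}"] by (intro mspan_least insert.prems(1)) blast
  moreover have "n \<in> mspan {} ?G" if n: "n \<in> N" for n
  proof -
    have "n \<in> mspan {} (insert f F)" using n insert.prems(2) ..
    then obtain v k where v: "v \<in> mspan {} F" "n = v + of_int k * f"
      by (rule mspan_int_insert)
    then have "k \<in> I" using n by (auto simp: I_def)
    then obtain e where e: "k = d * e" using d by blast
    have g: "of_int e * (w + of_int d * f) \<in> mspan {} ?G"
      by (intro submod_of_int[OF submod_mspan] mspan.base) simp
    have "n - of_int e * (w + of_int d * f) \<in> N"
      by (intro submod_diff[OF insert.prems(1)] submod_of_int[OF insert.prems(1)] n w)
    moreover have "n - of_int e * (w + of_int d * f) = v - of_int e * w"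
      by (simp add: v e algebra_simps)
    moreover have "v - of_int e * w \<in> mspan {} F"
      by (intro mspan.diff v submod_of_int[OF submod_mspan] w)
    ultimately have "n - of_int e * (w + of_int d * f) \<in> mspan {} G"
      using G by auto
    then have "n - of_int e * (w + of_int d * f) \<in> mspan {} ?G"
      using mspan_mono[of "{}" "{}" G ?G] by (meson empty_subsetI subsetD subset_insertI)
    from submod_add[OF submod_mspan this g] show ?thesis by simp
  qed
  ultimately have "N = mspan {} ?G" by blast
  then show ?case using G(1) by blast
qed

text \<open>The union is a submodule, hence finitely generated, and a finite subset of the union of
  a chain lies in one member. It serves for the leading coefficients below and again for Fitting's
  lemma.\<close>

lemma chain_of_submods_stabilises:
  assumes noeth: "\<And>N. submod X N \<Longrightarrow> N \<subseteq> V \<Longrightarrow> \<exists>G. finite G \<and> N = mspan X G"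
    and K: "\<And>i::nat. submod X (K i)" "\<And>i. K i \<subseteq> V" "\<And>i. K i \<subseteq> K (Suc i)"
  shows "\<exists>m. \<forall>i. K i \<subseteq> K m"
proof -
  have mono: "K i \<subseteq> K j" if "i \<le> j" for i j
    using that K(3) by (rule lift_Suc_mono_le[rotated])
  have "submod X (\<Union>i. K i)"
  proof (rule submodI)
    fix a b assume "a \<in> (\<Union>i. K i)" "b \<in> (\<Union>i. K i)"
    then obtain i j where "a \<in> K i" "b \<in> K j" by auto
    then have "a \<in> K (max i j)" "b \<in> K (max i j)"
      using mono[of i "max i j"] mono[of j "max i j"] by auto
    then show "a - b \<in> (\<Union>i. K i)" using submod_diff[OF K(1)] by blast
  qed (auto intro: submod_zero[OF K(1)] submod_mult[OF K(1)])
  then obtain G where G: "finite G" "(\<Union>i. K i) = mspan X G"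
    using noeth[of "\<Union>i. K i"] K(2) by auto
  have "\<exists>m. G' \<subseteq> K m" if "finite G'" "G' \<subseteq> (\<Union>i. K i)" for G'
    using that
  proof (induction)
    case (insert g G')
    obtain j where "G' \<subseteq> K j" using insert.IH insert.prems by (meson insert_subset)
    moreover obtain i where "g \<in> K i" using insert.prems by auto
    ultimately have "insert g G' \<subseteq> K (max i j)"
      using mono[of i "max i j"] mono[of j "max i j"] by auto
    then show ?case ..
  qed simp
  moreover have "G \<subseteq> (\<Union>i. K i)"
    unfolding G(2) by (auto intro: mspan.base)
  ultimately obtain m where "G \<subseteq> K m" using G(1) by blast
  then have "(\<Union>i. K i) \<subseteq> K m"
    using G(2) mspan_least[OF K(1)] by auto
  then show ?thesis by blast
qed

text \<open>The ideals of leading coefficients in Hilbert's basis theorem, for the preimage of \<open>N\<close>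
  under evaluation at \<open>y\<close>.\<close>
definition leading_coeffs :: "'r::comm_ring_1 set \<Rightarrow> 'r \<Rightarrow> 'r set \<Rightarrow> nat \<Rightarrow> 'r set" where
  "leading_coeffs W y N i = {coeff f i | f. coeffs_in f W \<and> degree f \<le> i \<and> poly f y \<in> N}"

lemma submod_leading_coeffs:
  assumes W: "submod X W" and N: "submod X N"
  shows "submod X (leading_coeffs W y N i)"
proof (rule submodI)
  show "0 \<in> leading_coeffs W y N i"
    using submod_zero[OF W] submod_zero[OF N] by (auto simp: leading_coeffs_def intro!: exI[of _ 0])
next
  fix a b assume "a \<in> leading_coeffs W y N i" "b \<in> leading_coeffs W y N i"
  then obtain f g where "a = coeff f i" "b = coeff g i" "coeffs_in f W" "coeffs_in g W"
    "degree f \<le> i" "degree g \<le> i" "poly f y \<in> N" "poly g y \<in> N"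
    by (auto simp: leading_coeffs_def)
  then show "a - b \<in> leading_coeffs W y N i"
    using submod_diff[OF W] submod_diff[OF N]
    by (auto simp: leading_coeffs_def intro!: exI[of _ "f - g"] degree_diff_le)
next
  fix x a assume "x \<in> X" "a \<in> leading_coeffs W y N i"
  then obtain f where "x \<in> X" "a = coeff f i" "coeffs_in f W" "degree f \<le> i" "poly f y \<in> N"
    by (auto simp: leading_coeffs_def)
  then show "x * a \<in> leading_coeffs W y N i"
    using submod_mult[OF W] submod_mult[OF N] order_trans[OF degree_smult_le]
    by (auto simp: leading_coeffs_def intro!: exI[of _ "smult x f"])
qed

text \<open>Multiplying a polynomial by the variable shifts its coefficients by one and multiplies
  its value by \<open>y\<close>.\<close>

lemma leading_coeffs_Suc:
  assumes W: "submod X W" and N: "\<And>a. a \<in> N \<Longrightarrow> y * a \<in> N"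
  shows "leading_coeffs W y N i \<subseteq> leading_coeffs W y N (Suc i)"
proof
  fix a assume "a \<in> leading_coeffs W y N i"
  then obtain f where f: "a = coeff f i" "coeffs_in f W" "degree f \<le> i" "poly f y \<in> N"
    by (auto simp: leading_coeffs_def)
  have "coeffs_in (pCons 0 f) W"
    by (rule coeffs_in_pCons[OF submod_zero[OF W] f(2)])
  then show "a \<in> leading_coeffs W y N (Suc i)"
    using f N by (auto simp: leading_coeffs_def degree_pCons_eq_if intro!: exI[of _ "pCons 0 f"])
qed

text \<open>Hilbert's basis theorem for modules, by induction on the operators. The chain of leading
  coefficients stabilises at some \<open>m\<close>, and polynomials lifting finite generating sets
  for the degrees up to \<open>m\<close> generate \<open>N\<close>. Membership is tested only after
  evaluation at \<open>y\<close>, so relations satisfied by \<open>y\<close> do no harm.\<close>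

theorem submod_finitely_generated:
  fixes X F :: "'r::comm_ring_1 set"
  assumes "finite X" "finite F" "submod X N" "N \<subseteq> mspan X F"
  shows "\<exists>G. finite G \<and> N = mspan X G"
  using assms(1,3,4)
proof (induction X arbitrary: N)
  case empty
  then show ?case using int_submod_finitely_generated[OF \<open>finite F\<close>] by blast
next
  case (insert y X)
  let ?W = "mspan X F"
  let ?L = "leading_coeffs ?W y N"
  have NX: "submod X N" using insert.prems(1) by (rule submod_subset) blast
  have L: "submod X (?L i)" for i by (rule submod_leading_coeffs[OF submod_mspan NX])
  have LW: "?L i \<subseteq> ?W" for i by (auto simp: leading_coeffs_def)
  have "?L i \<subseteq> ?L (Suc i)" for i
    using submod_mult[OF insert.prems(1)] by (intro leading_coeffs_Suc[OF submod_mspan]) auto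
  from insert.IH L LW this have "\<exists>m. \<forall>i. ?L i \<subseteq> ?L m"
    by (rule chain_of_submods_stabilises)
  then obtain m where "\<forall>i. ?L i \<subseteq> ?L m" ..
  note m = this[rule_format]
  have "\<forall>i. \<exists>G. finite G \<and> ?L i = mspan X G"
    using insert.IH[OF L LW] by blast
  then obtain G where G: "\<And>i. finite (G i)" "\<And>i. ?L i = mspan X (G i)"
    by (auto dest!: choice)
  have "\<exists>f. coeffs_in f ?W \<and> degree f \<le> i \<and> poly f y \<in> N \<and> coeff f i = g" if "g \<in> G i" for g i
  proof -
    have "g \<in> ?L i" unfolding G(2) using that by (rule mspan.base)
    then show ?thesis by (auto simp: leading_coeffs_def)
  qed
  then have "\<forall>i g. \<exists>f. g \<in> G i \<longrightarrow> coeffs_in f ?W \<and> degree f \<le> i \<and> poly f y \<in> N \<and> coeff f i = g"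
    by blast
  then obtain lift where lift: "\<And>i g. g \<in> G i \<Longrightarrow> coeffs_in (lift i g) ?W \<and> degree (lift i g) \<le> i
      \<and> poly (lift i g) y \<in> N \<and> coeff (lift i g) i = g"
    by metis
  define H where "H = (\<Union>i\<in>{..m}. (\<lambda>g. poly (lift i g) y) ` G i)"
  let ?T = "mspan (insert y X) H"
  have "finite H" using G(1) by (auto simp: H_def)
  have TN: "?T \<subseteq> N"
    using lift by (intro mspan_least[OF insert.prems(1)]) (auto simp: H_def)
  have TX: "submod X ?T"
    using submod_mspan by (rule submod_subset) blast
  let ?L' = "leading_coeffs ?W y ?T"
  have "G i \<subseteq> ?L' i" if "i \<le> m" for i
  proof
    fix g assume g: "g \<in> G i"
    then have "poly (lift i g) y \<in> ?T"
      using that by (intro mspan.base) (auto simp: H_def)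
    then show "g \<in> ?L' i"
      using lift[OF g] unfolding leading_coeffs_def by (auto intro!: exI[of _ "lift i g"])
  qed
  then have LL: "?L i \<subseteq> ?L' i" if "i \<le> m" for i
    using G(2) mspan_least[OF submod_leading_coeffs[OF submod_mspan TX]] that by auto
  have "?L' i \<subseteq> ?L' (Suc i)" for i
    by (rule leading_coeffs_Suc[OF submod_mspan]) (simp add: mspan.mult)
  then have L'mono: "?L' i \<subseteq> ?L' j" if "i \<le> j" for i j
    using that by (rule lift_Suc_mono_le)
  \<comment> \<open>Beyond \<open>m\<close> no lifts were chosen: \<open>?L i\<close> lies in
    \<open>?L m\<close>, and multiplication by \<open>y\<close> carries the lifts of degree
    \<open>m\<close> upwards.\<close>
  have LL: "?L i \<subseteq> ?L' i" for i
  proof (cases "i \<le> m")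
    case False
    then have "?L' m \<subseteq> ?L' i" by (intro L'mono) simp
    then show ?thesis using LL[of m] m[of i] by blast
  qed (rule LL)
  have main: "poly f y \<in> ?T" if "coeffs_in f ?W" "poly f y \<in> N" "degree f < k" for f k
    using that
  proof (induction k arbitrary: f)
    case (Suc k)
    then have "coeff f k \<in> ?L k" by (auto simp: leading_coeffs_def)
    then obtain g where g: "coeffs_in g ?W" "degree g \<le> k" "poly g y \<in> ?T" "coeff g k = coeff f k"
      using LL[of k] unfolding leading_coeffs_def[of _ _ ?T] by (auto dest!: subsetD)
    have "poly (f - g) y \<in> ?T"
    \<comment> \<open>The coefficients at \<open>k\<close> cancel, so a nonzero difference has
      degree below \<open>k\<close>. The zero polynomial is treated apart because its degree 0 is
      not below \<open>k = 0\<close>.\<close>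
    proof (cases "f - g = 0")
      case True
      then show ?thesis using mspan.zero by (metis poly_0)
    next
      case False
      have "degree (f - g) \<le> k" using Suc.prems g by (intro degree_diff_le) auto
      moreover have "degree (f - g) \<noteq> k"
        using False g by (metis coeff_diff diff_self leading_coeff_neq_0)
      ultimately show ?thesis
        using Suc.prems g TN
        by (intro Suc.IH coeffs_in_diff[OF submod_mspan]) (auto intro: submod_diff[OF NX])
    qed
    then show ?case
      using submod_add[OF submod_mspan, of _ "insert y X" H "poly g y"] g by force
  qed simp
  have "N \<subseteq> ?T"
  proof
    fix a assume "a \<in> N"
    then have "a \<in> adjoin ?W y" using insert.prems mspan_insert by blast
    then obtain f where "a = poly f y" "coeffs_in f ?W" by (auto simp: adjoin_def)
    then show "a \<in> ?T" using main \<open>a \<in> N\<close> by blast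
  qed
  then show ?case using TN \<open>finite H\<close> by blast
qed

text \<open>The monic \<open>g\<close> lets every polynomial in \<open>y\<close> be reduced modulo
  \<open>N\<close> to degree below \<open>degree g\<close>; reducing the remaining coefficients to
  \<open>T\<close> leaves finitely many values. Integer coefficients of \<open>g\<close> keep the
  reductions inside \<open>W\<close>.\<close>

lemma finite_transversal_adjoin:
  fixes y :: "'r::comm_ring_1"
  assumes N: "submod X N" "submod {y} N" and W: "submod X W" "W \<subseteq> V"
    and T: "finite T" "\<And>w. w \<in> W \<Longrightarrow> \<exists>t\<in>T. w - t \<in> N"
    and g: "coeffs_in g \<int>" "lead_coeff g = 1" "0 < degree g"
    and gN: "\<And>v. v \<in> V \<Longrightarrow> poly g y * v \<in> N"
    and yV: "F \<subseteq> W"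
  shows "\<exists>T. finite T \<and> (\<forall>v \<in> mspan (insert y X) F. \<exists>t\<in>T. v - t \<in> N)"
proof -
  let ?m = "degree g"
  let ?S = "{v. \<exists>f. coeffs_in f W \<and> degree f < ?m \<and> v - poly f y \<in> N}"
  have Ny: "y * a \<in> N" if "a \<in> N" for a using submod_mult[OF N(2)] that by simp
  have "submod (insert y X) ?S"
  proof (rule submodI)
    show "0 \<in> ?S" using g(3) submod_zero[OF W(1)] submod_zero[OF N(1)] by (auto intro!: exI[of _ 0])
  next
    fix a b assume "a \<in> ?S" "b \<in> ?S"
    then obtain f h where f: "coeffs_in f W" "degree f < ?m" "a - poly f y \<in> N"
      and h: "coeffs_in h W" "degree h < ?m" "b - poly h y \<in> N" by auto
    have "(a - b) - poly (f - h) y \<in> N"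
      using submod_diff[OF N(1) f(3) h(3)] by (simp add: algebra_simps)
    then show "a - b \<in> ?S"
      using coeffs_in_diff[OF W(1) f(1) h(1)] degree_diff_less[OF f(2) h(2)] by blast
  next
    fix x a assume x: "x \<in> insert y X" and "a \<in> ?S"
    then obtain f where f: "coeffs_in f W" "degree f < ?m" "a - poly f y \<in> N" by auto
    have xa: "x * a - x * poly f y \<in> N"
      using x Ny[OF f(3)] submod_mult[OF N(1) _ f(3)] by (auto simp: right_diff_distrib)
    show "x * a \<in> ?S"
    proof (cases "x \<in> X")
      case True
      then have "coeffs_in (smult x f) W" using f(1) submod_mult[OF W(1)] by simp
      moreover have "degree (smult x f) < ?m" using f(2) degree_smult_le le_less_trans by blast
      ultimately show ?thesis using xa by (auto intro!: exI[of _ "smult x f"])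
    next
      case False
      then have "x = y" using x by simp
      let ?c = "coeff f (?m - 1)"
      \<comment> \<open>Multiplying by \<open>y\<close> may raise the degree to \<open>?m\<close>;
        the subtracted multiple of the monic \<open>g\<close> cancels the coefficient there and
        changes the value only by an element of \<open>N\<close>.\<close>
      let ?h = "pCons 0 f - smult ?c g"
      have "?c * coeff g i \<in> W" for i
      proof -
        obtain k where "coeff g i = of_int k" using g(1) by (auto elim: Ints_cases)
        then show ?thesis using submod_of_int[OF W(1), of ?c k] f(1) by (simp add: mult.commute)
      qed
      then have "coeffs_in ?h W"
        using coeffs_in_pCons[OF submod_zero[OF W(1)] f(1)] submod_diff[OF W(1)] by simp
      moreover have "degree ?h < ?m"
      proof (rule degree_lessI)
        show "\<forall>k\<ge>?m. coeff ?h k = 0"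
        proof (intro allI impI)
          fix k assume k: "?m \<le> k"
          show "coeff ?h k = 0"
          proof (cases "k = ?m")
            case True
            then show ?thesis using g by (simp add: coeff_pCons split: nat.split)
          next
            case False
            then have "degree g < k" "degree f < k - 1" using k f(2) g(3) by auto
            then show ?thesis by (auto simp: coeff_pCons coeff_eq_0 split: nat.split)
          qed
        qed
      qed (use g(3) in simp)
      moreover have "x * a - poly ?h y \<in> N"
      proof -
        have "poly g y * ?c \<in> N" using gN f(1) W(2) by blast
        then have "(x * a - x * poly f y) + poly g y * ?c \<in> N"
          by (rule submod_add[OF N(1) xa])
        then show ?thesis by (simp add: \<open>x = y\<close> algebra_simps)
      qed
      ultimately show ?thesis by blast
    qed
  qed
  moreover have "F \<subseteq> ?S"
  proof
    fix a assume "a \<in> F"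
    then have "coeffs_in [:a:] W"
      using yV coeffs_in_pCons[of a W 0] submod_zero[OF W(1)] by auto
    then show "a \<in> ?S" using g(3) submod_zero[OF N(1)] by (auto intro!: exI[of _ "[:a:]"])
  qed
  ultimately have S: "mspan (insert y X) F \<subseteq> ?S"
    by (rule mspan_least)
  let ?T = "(\<lambda>t. \<Sum>j<?m. t j * y ^ j) ` ({..<?m} \<rightarrow>\<^sub>E T)"
  have "\<exists>t\<in>?T. v - t \<in> N" if "v \<in> mspan (insert y X) F" for v
  proof -
    have "v \<in> ?S" using S that ..
    then obtain f where f: "coeffs_in f W" "degree f < ?m" "v - poly f y \<in> N" by auto
    have "\<forall>j. \<exists>t. t \<in> T \<and> coeff f j - t \<in> N" using T(2) f(1) by blast
    from choice[OF this] obtain t where t: "\<And>j. t j \<in> T" "\<And>j. coeff f j - t j \<in> N" by blast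
    have "poly f y = (\<Sum>j<?m. coeff f j * y ^ j)"
      unfolding poly_altdef using f(2) coeff_eq_0[of f]
      by (intro sum.mono_neutral_left) (auto simp: not_le)
    then have "poly f y - (\<Sum>j<?m. t j * y ^ j) = (\<Sum>j<?m. (coeff f j - t j) * y ^ j)"
      by (simp add: sum_subtractf left_diff_distrib)
    also have "\<dots> \<in> N"
    proof (rule submod_sum[OF N(1)])
      fix j
      have "y ^ k * (coeff f j - t j) \<in> N" for k
        by (induction k) (auto simp: t(2) Ny mult.assoc)
      then show "(coeff f j - t j) * y ^ j \<in> N" by (simp add: mult.commute)
    qed
    finally have "(v - poly f y) + (poly f y - (\<Sum>j<?m. t j * y ^ j)) \<in> N"
      by (rule submod_add[OF N(1) f(3)])
    then have "v - (\<Sum>j<?m. t j * y ^ j) \<in> N" by simp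
    moreover have "(\<Sum>j<?m. restrict t {..<?m} j * y ^ j) = (\<Sum>j<?m. t j * y ^ j)"
      by (intro sum.cong) auto
    ultimately have "v - (\<Sum>j<?m. restrict t {..<?m} j * y ^ j) \<in> N" by simp
    moreover have "restrict t {..<?m} \<in> {..<?m} \<rightarrow>\<^sub>E T" using t(1) by auto
    ultimately show ?thesis by (meson imageI)
  qed
  moreover have "finite ?T" by (intro finite_imageI finite_PiE) (auto simp: T(1))
  ultimately show ?thesis by blast
qed

text \<open>The case without operators: the coefficient of each generator is reduced modulo
  \<open>q\<close>, and the multiples of \<open>q\<close> are absorbed by \<open>N\<close>.\<close>

lemma finite_transversal_int:
  fixes F :: "'r::comm_ring_1 set"
  assumes N: "submod {} N" and q: "0 < q" and "finite F"
    and qN: "\<And>v. v \<in> F \<Longrightarrow> of_int q * v \<in> N"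
  shows "\<exists>T. finite T \<and> (\<forall>v \<in> mspan {} F. \<exists>t\<in>T. v - t \<in> N)"
  using assms(3,4)
proof (induction F)
  case empty
  have "mspan {} {} \<subseteq> {0::'r}"
    by (rule mspan_least) (auto simp: submod_def)
  then show ?case using submod_zero[OF N] by (intro exI[of _ "{0}"]) auto
next
  case (insert f F)
  then obtain T where T: "finite T" "\<And>v. v \<in> mspan {} F \<Longrightarrow> \<exists>t\<in>T. v - t \<in> N" by blast
  let ?T = "(\<lambda>(t, i). t + of_int i * f) ` (T \<times> {0..<q})"
  have "\<exists>t\<in>?T. v - t \<in> N" if v: "v \<in> mspan {} (insert f F)" for v
  proof -
    obtain w n where w: "w \<in> mspan {} F" "v = w + of_int n * f"
      using v by (rule mspan_int_insert)
    obtain t where t: "t \<in> T" "w - t \<in> N" using T w by blast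
    have "of_int (n div q) * (of_int q * f) \<in> N"
      by (intro submod_of_int[OF N] insert.prems) simp
    from submod_add[OF N t(2) this]
    have "(w - t) + of_int (n div q * q) * f \<in> N" by (simp add: mult.assoc)
    also have "(w - t) + of_int (n div q * q) * f = v - (t + of_int (n mod q) * f)"
      by (simp add: w flip: minus_mod_eq_div_mult) (simp add: algebra_simps)
    finally show ?thesis using t(1) q by (intro bexI[of _ "t + of_int (n mod q) * f"]) auto
  qed
  then show ?case using T(1) by (intro exI[of _ ?T]) auto
qed

text \<open>Finite exponent settles the additive group spanned by \<open>F\<close>; integrality then
  keeps the quotient finite as the operators are adjoined one at a time.\<close>

lemma finite_transversal_integral:
  fixes X F :: "'r::comm_ring_1 set"
  assumes "finite X" "finite F" "submod X N" "0 < q"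
    and V: "V = mspan X F" and qN: "\<And>v. v \<in> V \<Longrightarrow> of_int q * v \<in> N"
    and int: "\<And>x. x \<in> X \<Longrightarrow> \<exists>g. coeffs_in g \<int> \<and> lead_coeff g = 1 \<and> 0 < degree g
                \<and> (\<forall>v\<in>V. poly g x * v \<in> N)"
  shows "\<exists>T. finite T \<and> (\<forall>v \<in> V. \<exists>t\<in>T. v - t \<in> N)"
proof -
  have "\<exists>T. finite T \<and> (\<forall>v \<in> mspan Y F. \<exists>t\<in>T. v - t \<in> N)" if "finite Y" "Y \<subseteq> X" for Y
    using that
  proof (induction Y)
    case empty
    show ?case
      using qN V mspan.base[of _ F X] \<open>finite F\<close> \<open>0 < q\<close> submod_subset[OF \<open>submod X N\<close>, of "{}"]
      by (intro finite_transversal_int[of N q F]) auto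
  next
    case (insert y Y)
    from insert.IH insert.prems obtain T
      where T: "finite T" "\<And>v. v \<in> mspan Y F \<Longrightarrow> \<exists>t\<in>T. v - t \<in> N" by (meson insert_subset)
    have "y \<in> X" using insert.prems by simp
    from int[OF this] obtain g where g: "coeffs_in g \<int>" "lead_coeff g = 1" "0 < degree g" "\<And>v. v \<in> V \<Longrightarrow> poly g y * v \<in> N"
      by (elim exE conjE) simp
    have NY: "submod Y N" "submod {y} N"
      using insert.prems by (auto intro: submod_subset[OF \<open>submod X N\<close>])
    have "mspan Y F \<subseteq> V" unfolding V using insert.prems by (intro mspan_mono) auto
    have FY: "F \<subseteq> mspan Y F" by (auto intro: mspan.base)
    show ?case
      by (rule finite_transversal_adjoin[OF NY submod_mspan \<open>mspan Y F \<subseteq> V\<close> T g FY])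
  qed
  from this[OF \<open>finite X\<close>] show ?thesis using V by simp
qed

section \<open>The Nullstellensatz over the integers\<close>

lemma subring_power: "submod D D \<Longrightarrow> 1 \<in> D \<Longrightarrow> a \<in> D \<Longrightarrow> a ^ n \<in> D"
  by (induction n) (auto intro: submod_mult)

lemma coeffs_in_mult:
  assumes "submod D W" "coeffs_in f D" "coeffs_in g W"
  shows "coeffs_in (f * g) W"
  using assms by (auto simp: coeff_mult intro!: submod_sum[OF assms(1)] submod_mult[OF assms(1)])

lemma poly_in_submod:
  assumes "submod D W" "coeffs_in f W" "y \<in> D"
  shows "poly f y \<in> W"
  using assms(2)
proof (induction f)
  case 0
  then show ?case using submod_zero[OF assms(1)] by simp
next
  case (pCons a f)
  have "coeffs_in f W" using pCons.prems by (metis coeff_pCons_Suc)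
  moreover have "a \<in> W" using pCons.prems by (metis coeff_pCons_0)
  ultimately show ?case
    using pCons.IH assms(3) by (auto intro!: submod_add[OF assms(1)] submod_mult[OF assms(1)])
qed

lemma submod_adjoin:
  assumes D: "submod D D" "1 \<in> D"
  shows "submod (adjoin D y) (adjoin D y)" "D \<subseteq> adjoin D y" "y \<in> adjoin D y"
proof -
  have 0: "0 \<in> D" using submod_zero[OF D(1)] .
  show "submod (adjoin D y) (adjoin D y)"
  proof (rule submodI)
    show "0 \<in> adjoin D y" using 0 by (auto simp: adjoin_def intro!: exI[of _ 0])
  next
    fix a b assume "a \<in> adjoin D y" "b \<in> adjoin D y"
    then obtain f g where "a = poly f y" "b = poly g y" "coeffs_in f D" "coeffs_in g D"
      by (auto simp: adjoin_def)
    then show "a - b \<in> adjoin D y"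
      using coeffs_in_diff[OF D(1)] by (auto simp: adjoin_def intro!: exI[of _ "f - g"] submod_diff[OF D(1)])
  next
    fix a b assume "a \<in> adjoin D y" "b \<in> adjoin D y"
    then obtain f g where "a = poly f y" "b = poly g y" "coeffs_in f D" "coeffs_in g D"
      by (auto simp: adjoin_def)
    then show "a * b \<in> adjoin D y"
      using coeffs_in_mult[OF D(1), of f g] by (auto simp: adjoin_def intro!: exI[of _ "f * g"])
  qed
  show "D \<subseteq> adjoin D y"
  proof
    fix a assume "a \<in> D"
    then have "coeffs_in [:a:] D" using coeffs_in_pCons[of a D 0] 0 by simp
    then show "a \<in> adjoin D y" unfolding adjoin_def by (auto intro!: exI[of _ "[:a:]"])
  qed
  have "coeffs_in [:0, 1:] D" using coeffs_in_pCons[OF 0 coeffs_in_pCons[of 1 D 0]] 0 D(2) by simp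
  then show "y \<in> adjoin D y" unfolding adjoin_def by (auto intro!: exI[of _ "[:0, 1:]"])
qed

text \<open>Leading coefficients need not be invertible, so \<open>f\<close> is multiplied by the
  leading coefficient of \<open>g\<close> before each subtraction. The bound on
  \<open>degree q\<close> later brings the quotient below the degree of a minimal
  polynomial.\<close>

lemma pseudo_division_in:
  fixes g :: "'r::comm_ring_1 poly"
  assumes D: "submod D D" "1 \<in> D" and g: "coeffs_in g D" "0 < degree g" and "coeffs_in f D"
  shows "\<exists>k q r. coeffs_in q D \<and> coeffs_in r D \<and> smult (lead_coeff g ^ k) f = q * g + r
    \<and> degree r < degree g \<and> degree q \<le> degree f - degree g"
  using assms(5)
proof (induction "degree f" arbitrary: f rule: less_induct)
  case less
  show ?case
  proof (cases "degree f < degree g")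
    case True
    then show ?thesis using less.prems submod_zero[OF D(1)]
      by (intro exI[of _ 0] exI[of _ f]) auto
  next
    case False
    let ?s = "degree g" and ?l = "lead_coeff g"
    let ?h = "monom (lead_coeff f) (degree f - ?s)"
    let ?f = "smult ?l f - ?h * g"
    have h: "coeffs_in ?h D" using less.prems submod_zero[OF D(1)] by simp
    have f': "coeffs_in ?f D"
      using g(1) less.prems submod_mult[OF D(1)] coeffs_in_mult[OF D(1) h g(1)]
      by (intro coeffs_in_diff[OF D(1)]) auto
    have "degree ?f < degree f"
    proof (rule degree_lessI)
      show "\<forall>k\<ge>degree f. coeff ?f k = 0"
      proof (intro allI impI)
        fix k assume k: "degree f \<le> k"
        show "coeff ?f k = 0"
        proof (cases "k = degree f")
          case True
          then show ?thesis using False by (simp add: coeff_monom_mult)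
        next
          case neq: False
          then have "degree f < k" "degree g < k - (degree f - ?s)" using k False by auto
          then show ?thesis by (simp add: coeff_monom_mult coeff_eq_0)
        qed
      qed
    qed (use False g(2) in auto)
    from less.hyps[OF this f'] obtain k q r where
      q: "coeffs_in q D" "coeffs_in r D" "smult (?l ^ k) ?f = q * g + r" "degree r < ?s"
        "degree q \<le> degree ?f - ?s" by auto
    let ?q = "q + smult (?l ^ k) ?h"
    have "coeffs_in ?q D"
      using q(1) h subring_power[OF D] g(1) submod_mult[OF D(1)] submod_add[OF D(1)]
      by (simp del: coeff_monom)
    moreover have "smult (?l ^ Suc k) f = ?q * g + r"
      using q(3) by (simp add: smult_diff_right algebra_simps)
    moreover have "degree ?q \<le> degree f - ?s"
    proof (rule degree_add_le)
      show "degree q \<le> degree f - ?s" using q(5) \<open>degree ?f < degree f\<close> by simp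
      show "degree (smult (?l ^ k) ?h) \<le> degree f - ?s"
        using degree_smult_le degree_monom_le order_trans by blast
    qed
    ultimately show ?thesis using q by blast
  qed
qed

text \<open>The domain R/M is not formed: its elements stay in the ambient ring, and equality
  becomes congruence modulo \<open>M\<close>. A subring \<open>D\<close> of \<open>R\<close> stands
  for its image in R/M.\<close>

locale prime_in_subring =
  fixes R M :: "'r::comm_ring_1 set"
  assumes R: "submod R R" "1 \<in> R"
    and M: "submod R M" "M \<subseteq> R" "1 \<notin> M"
    and prime: "\<And>r s. r \<in> R \<Longrightarrow> s \<in> R \<Longrightarrow> r * s \<in> M \<Longrightarrow> r \<in> M \<or> s \<in> M"
begin

lemma power_notin: "a \<in> R \<Longrightarrow> a \<notin> M \<Longrightarrow> a ^ n \<notin> M"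
  using M(3) prime subring_power[OF R] by (induction n) auto

text \<open>Coefficients that vanish modulo \<open>M\<close> become zero, so that
  \<open>degree\<close> and \<open>lead_coeff\<close> of the result are those of the polynomial over
  R/M.\<close>

definition trim :: "'r poly \<Rightarrow> 'r poly" where
  "trim f = map_poly (\<lambda>c. if c \<in> M then 0 else c) f"

lemma coeff_trim: "coeff (trim f) i = (if coeff f i \<in> M then 0 else coeff f i)"
  by (simp add: trim_def coeff_map_poly)

lemma coeffs_in_trim: "submod D D \<Longrightarrow> coeffs_in f D \<Longrightarrow> coeffs_in (trim f) D"
  using submod_zero by (auto simp: coeff_trim)

lemma degree_trim: "degree (trim f) \<le> degree f"
  by (rule degree_le) (simp add: coeff_trim coeff_eq_0)

lemma poly_trim: "y \<in> R \<Longrightarrow> poly f y - poly (trim f) y \<in> M"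
  using poly_in_submod[OF M(1), of "f - trim f" y] submod_zero[OF M(1)]
  by (simp add: coeff_trim)

lemma lead_coeff_trim: "trim f \<noteq> 0 \<Longrightarrow> lead_coeff (trim f) \<notin> M"
  using coeff_trim[of f "degree (trim f)"] by (auto split: if_splits)

text \<open>Algebraicity over the fraction field of the image of \<open>D\<close> in R/M, with
  denominators cleared. A constant \<open>f\<close> cannot occur, because its value is its leading
  coefficient.\<close>

definition algebraic_mod :: "'r set \<Rightarrow> 'r \<Rightarrow> bool" where
  "algebraic_mod D y \<longleftrightarrow> (\<exists>f. coeffs_in f D \<and> poly f y \<in> M \<and> lead_coeff f \<notin> M)"

lemma algebraic_modI:
  assumes "submod D D" "y \<in> R" "coeffs_in f D" "poly f y \<in> M" "coeff f i \<notin> M"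
  obtains g where "coeffs_in g D" "poly g y \<in> M" "lead_coeff g \<notin> M" "degree g \<le> degree f"
proof
  show "coeffs_in (trim f) D" using assms coeffs_in_trim by blast
  have "coeff (trim f) i \<noteq> 0" using assms(5) submod_zero[OF M(1)] by (auto simp: coeff_trim)
  then show "lead_coeff (trim f) \<notin> M" by (intro lead_coeff_trim) auto
  show "poly (trim f) y \<in> M"
    using submod_diff[OF M(1) assms(4) poly_trim[OF assms(2), of f]] by simp
qed (rule degree_trim)

text \<open>\<open>D[1/d]\<close> is a field modulo \<open>M\<close> for some \<open>d\<close>.\<close>
definition loc_field :: "'r set \<Rightarrow> bool" where
  "loc_field D \<longleftrightarrow> (\<exists>d \<in> D - M. \<forall>p \<in> D - M. \<exists>k. \<exists>u \<in> D. p * u - d ^ k \<in> M)"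

text \<open>If \<open>y\<close> were transcendental and \<open>D[y][1/c]\<close> a field, then \<open>1 + y c\<close> would divide a power of \<open>c\<close> and
  hence \<open>1\<close>, contradicting degrees.\<close>
lemma loc_field_adjoin_imp_algebraic:
  assumes D: "submod D D" "1 \<in> D" "D \<subseteq> R" and y: "y \<in> R" and loc: "loc_field (adjoin D y)"
  shows "algebraic_mod D y"
proof (rule ccontr)
  assume "\<not> algebraic_mod D y"
  then have nonalg: "coeffs_in f M" if "coeffs_in f D" "poly f y \<in> M" for f
    using that algebraic_modI[OF D(1) y] unfolding algebraic_mod_def by metis
  let ?E = "adjoin D y"
  note E = submod_adjoin[OF D(1,2), of y]
  have ER: "?E \<subseteq> R"
  proof
    fix a assume "a \<in> ?E"
    then obtain f where "a = poly f y" "coeffs_in f D" by (auto simp: adjoin_def)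
    then show "a \<in> R" using poly_in_submod[OF R(1), of f y] D(3) y by blast
  qed
  obtain c where c: "c \<in> ?E" "c \<notin> M" "\<And>p. p \<in> ?E \<Longrightarrow> p \<notin> M \<Longrightarrow> \<exists>k. \<exists>u \<in> ?E. p * u - c ^ k \<in> M"
    using loc by (auto simp: loc_field_def)
  obtain \<gamma> where \<gamma>: "coeffs_in \<gamma> D" "c = poly \<gamma> y" using c(1) by (auto simp: adjoin_def)
  let ?q = "1 + y * c"
  have q': "?q = poly (pCons 1 \<gamma>) y" "coeffs_in (pCons 1 \<gamma>) D"
    using coeffs_in_pCons[OF D(2) \<gamma>(1)] \<gamma>(2) by auto
  then have qE: "?q \<in> ?E" unfolding adjoin_def by blast
  have "?q \<notin> M" using nonalg[OF q'(2)] q'(1) M(3) by (metis coeff_pCons_0)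
  then obtain k u where u: "u \<in> ?E" "?q * u - c ^ k \<in> M" using c(3)[OF qE] by blast
  have 1: "1 \<in> ?E" using E(2) D(2) by blast
  \<comment> \<open>Modulo \<open>?q\<close> the product of \<open>y\<close> and \<open>c\<close> is
    -1, so its powers are 1 or -1: this turns a divisor of a power of \<open>c\<close> into a
    divisor of 1.\<close>
  have "\<exists>z \<in> ?E. (?q - 1) ^ k = ?q * z + (-1) ^ k" for k
  proof (induction k)
    case 0
    then show ?case using submod_zero[OF E(1)] by (intro bexI[of _ 0]) auto
  next
    case (Suc k)
    then obtain z where z: "z \<in> ?E" "(?q - 1) ^ k = ?q * z + (-1) ^ k" by blast
    have "(?q - 1) * z + (-1) ^ k \<in> ?E"
      using 1 E(3) c(1) z(1) submod_uminus[OF E(1) 1] submod_mult[OF E(1) E(3) c(1)]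
      by (intro submod_add[OF E(1)] submod_mult[OF E(1) _ z(1)] subring_power[OF E(1)]) auto
    moreover have "(?q - 1) ^ Suc k = ?q * ((?q - 1) * z + (-1) ^ k) + (-1) ^ Suc k"
      unfolding power_Suc z(2) by (simp add: algebra_simps)
    ultimately show ?case by blast
  qed
  then obtain z where z: "z \<in> ?E" "(y * c) ^ k = ?q * z + (-1) ^ k" by auto
  \<comment> \<open>The inverse of \<open>?q\<close> modulo \<open>M\<close>: in the congruence of
    \<open>?q * u\<close> and \<open>c ^ k\<close>, multiplied by \<open>y ^ k\<close>, the formula
    for \<open>(y * c) ^ k\<close> leaves only the sign \<open>(-1) ^ k\<close>.\<close>
  define w where "w = (-1) ^ k * (u * y ^ k - z)"
  have "w \<in> ?E"
    unfolding w_def using submod_uminus[OF E(1) 1] u(1) z(1) E(3) 1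
    by (intro submod_mult[OF E(1)] submod_diff[OF E(1)] subring_power[OF E(1)]) auto
  then obtain \<omega> where \<omega>: "coeffs_in \<omega> D" "w = poly \<omega> y" by (auto simp: adjoin_def)
  have "(-1) ^ k * y ^ k * (?q * u - c ^ k) \<in> M"
    using submod_uminus[OF R(1) R(2)] y
    by (intro submod_mult[OF M(1)] u(2) submod_mult[OF R(1)] subring_power[OF R]) auto
  also have "(-1) ^ k * y ^ k * (?q * u - c ^ k) = ?q * w + (-1) ^ k * (?q * z - (y * c) ^ k)"
    by (simp add: w_def algebra_simps power_mult_distrib)
  also have "\<dots> = ?q * w - 1"
    unfolding z(2) by (simp add: algebra_simps flip: power_mult_distrib)
  finally have qw: "?q * w - 1 \<in> M" .
  define g where "g = trim (pCons 1 \<gamma>)"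
  define h where "h = trim \<omega>"
  have gh: "coeffs_in g D" "coeffs_in h D" "?q - poly g y \<in> M" "w - poly h y \<in> M"
    using coeffs_in_trim[OF D(1)] q'(2) \<omega> poly_trim[OF y, of "pCons 1 \<gamma>"] poly_trim[OF y, of \<omega>]
    unfolding g_def h_def q'(1) by auto
  have "poly h y \<in> R" using poly_in_submod[OF R(1) _ y, of h] gh(2) D(3) by blast
  then have "(?q * w - 1) - ?q * (w - poly h y) - poly h y * (?q - poly g y) \<in> M"
    using qE ER by (intro submod_diff[OF M(1)] submod_mult[OF M(1)] qw gh) auto
  also have "(?q * w - 1) - ?q * (w - poly h y) - poly h y * (?q - poly g y) = poly (g * h - 1) y"
    by (simp add: algebra_simps)
  finally have "poly (g * h - 1) y \<in> M" .
  moreover have "coeffs_in 1 D"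
    using D(2) submod_zero[OF D(1)] by (simp add: coeff_1)
  then have "coeffs_in (g * h - 1) D"
    by (intro coeffs_in_diff[OF D(1)] coeffs_in_mult[OF D(1)] gh)
  ultimately have gh1: "coeffs_in (g * h - 1) M" by (intro nonalg)
  \<comment> \<open>Since \<open>c\<close> is nonzero modulo \<open>M\<close>, so is some
    coefficient of \<open>\<gamma>\<close>; hence \<open>g\<close> has positive degree and cannot be
    a unit among the polynomials over a domain.\<close>
  have "\<not> coeffs_in \<gamma> M" using c(2) \<gamma>(2) poly_in_submod[OF M(1) _ y] by blast
  then obtain i where "coeff \<gamma> i \<notin> M" by blast
  then have "coeff g (Suc i) \<noteq> 0"
    using submod_zero[OF M(1)] by (auto simp: g_def coeff_trim)
  then have g: "Suc i \<le> degree g" "g \<noteq> 0" by (auto intro: le_degree)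
  have "h \<noteq> 0"
  proof
    assume "h = 0"
    then have "coeff (g * h - 1) 0 = -1" by simp
    then have "-1 \<in> M" using gh1 by metis
    from submod_uminus[OF M(1) this] show False using M(3) by simp
  qed
  \<comment> \<open>The subtracted 1 does not reach this positive degree, so a product of two
    leading coefficients outside the prime \<open>M\<close> would lie in \<open>M\<close>.\<close>
  have "coeff (g * h - 1) (degree g + degree h) = lead_coeff g * lead_coeff h"
    using g by (simp add: coeff_mult_degree_sum)
  then have "lead_coeff g * lead_coeff h \<in> M" using gh1 by metis
  then have "lead_coeff g \<in> M \<or> lead_coeff h \<in> M" using gh D(3) by (intro prime) auto
  then show False
    using lead_coeff_trim \<open>g \<noteq> 0\<close> \<open>h \<noteq> 0\<close> unfolding g_def h_def by blast
qed


lemma power_cong_M: "a - b \<in> M \<Longrightarrow> a \<in> R \<Longrightarrow> b \<in> R \<Longrightarrow> a ^ k - b ^ k \<in> M"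
proof (induction k)
  case (Suc k)
  have "a * (a ^ k - b ^ k) + b ^ k * (a - b) \<in> M"
    using Suc by (intro submod_add[OF M(1)] submod_mult[OF M(1)] subring_power[OF R]) auto
  then show ?case by (simp add: algebra_simps)
qed (simp add: submod_zero[OF M(1)])

text \<open>
  Over the fraction field of \<open>D / M\<close> the element \<open>y\<close> has a minimal polynomial; let \<open>a\<close> be the leading
  coefficient of a multiple \<open>g\<close> of it over \<open>D\<close>. If \<open>D[y][1/c]\<close> is a field, then \<open>c\<close> has a nonzero multiple \<open>e\<close> in \<open>D\<close>
  (a multiple of least degree in \<open>y\<close>, by pseudo-division of \<open>g\<close>), and comparing constant coefficients
  modulo \<open>g\<close> shows that \<open>D[1/(a e)]\<close> is a field.
\<close>
lemma loc_field_of_adjoin: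
  assumes D: "submod D D" "1 \<in> D" "D \<subseteq> R" and y: "y \<in> R" and loc: "loc_field (adjoin D y)"
  shows "loc_field D"
proof -
  let ?E = "adjoin D y"
  note E = submod_adjoin[OF D(1,2), of y]
  have polyR: "poly f y \<in> R" if "coeffs_in f D" for f
    using poly_in_submod[OF R(1), of f y] D(3) y that by blast
  have polyE: "poly f y \<in> ?E" if "coeffs_in f D" for f
    using that unfolding adjoin_def by blast
  have ER: "?E \<subseteq> R" using polyR by (auto simp: adjoin_def)
  have MD: "submod D M" using M(1) D(3) by (rule submod_subset)
  let ?P = "\<lambda>n. \<exists>g. coeffs_in g D \<and> poly g y \<in> M \<and> lead_coeff g \<notin> M \<and> degree g = n"
  \<comment> \<open>The degree of the minimal polynomial of \<open>y\<close>; by \<open>min\<close>,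
    polynomials of smaller degree are determined modulo \<open>M\<close> by their values at
    \<open>y\<close> modulo \<open>M\<close>.\<close>
  define n where "n = (LEAST n. ?P n)"
  have "\<exists>n. ?P n"
    using loc_field_adjoin_imp_algebraic[OF D y loc] by (auto simp: algebraic_mod_def)
  then have "?P n" unfolding n_def by (rule LeastI_ex)
  then obtain g where g: "coeffs_in g D" "poly g y \<in> M" "lead_coeff g \<notin> M" "degree g = n" by blast
  have min: "coeffs_in f M" if f: "coeffs_in f D" "poly f y \<in> M" "degree f < n" for f
  proof (rule ccontr)
    assume "\<not> coeffs_in f M"
    then obtain i where "coeff f i \<notin> M" by blast
    from algebraic_modI[OF D(1) y f(1,2) this] obtain h where
      "coeffs_in h D" "poly h y \<in> M" "lead_coeff h \<notin> M" "degree h \<le> degree f" .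
    then have "?P (degree h)" by blast
    then have "n \<le> degree h" unfolding n_def by (rule Least_le)
    then show False using f(3) \<open>degree h \<le> degree f\<close> by simp
  qed
  have n: "0 < n"
  proof (rule ccontr)
    assume "\<not> 0 < n"
    then have "degree g = 0" using g(4) by simp
    then have "poly g y = lead_coeff g" by (metis degree_eq_zeroE poly_pCons mult_zero_right add.right_neutral
          poly_0 coeff_pCons_0)
    then show False using g by simp
  qed
  define a where "a = lead_coeff g"
  have a: "a \<in> D" "a \<notin> M" using g by (auto simp: a_def)
  have red: "\<exists>k r. coeffs_in r D \<and> degree r < n \<and> a ^ k * v - poly r y \<in> M" if "v \<in> ?E" for v
  proof -
    from that obtain f where f: "v = poly f y" "coeffs_in f D" by (auto simp: adjoin_def)
    from pseudo_division_in[OF D(1,2) g(1) _ f(2)] n g(4)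
    obtain k q r where q: "coeffs_in q D" "coeffs_in r D" "smult (a ^ k) f = q * g + r" "degree r < n"
      unfolding a_def by auto
    have "a ^ k * v = poly q y * poly g y + poly r y"
      using arg_cong[OF q(3), of "\<lambda>f. poly f y"] by (simp add: f)
    then have "a ^ k * v - poly r y = poly q y * poly g y" by simp
    also have "\<dots> \<in> M" by (rule submod_mult[OF M(1) polyR[OF q(1)] g(2)])
    finally show ?thesis using q by blast
  qed
  obtain c where c: "c \<in> ?E" "c \<notin> M" "\<And>p. p \<in> ?E \<Longrightarrow> p \<notin> M \<Longrightarrow> \<exists>k. \<exists>u \<in> ?E. p * u - c ^ k \<in> M"
    using loc by (auto simp: loc_field_def)
  \<comment> \<open>The degrees of polynomials representing multiples of \<open>c\<close> that are
    nonzero modulo \<open>M\<close>. As for the generator of an ideal in a Euclidean ring, the least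
    one, \<open>s\<close>, is examined by division with remainder.\<close>
  let ?Q = "\<lambda>s. \<exists>r u. coeffs_in r D \<and> u \<in> ?E \<and> poly r y - c * u \<in> M \<and> poly r y \<notin> M
    \<and> lead_coeff r \<notin> M \<and> degree r = s"
  have Q_trim: "\<exists>s \<le> degree r. ?Q s"
    if r: "coeffs_in r D" "u \<in> ?E" "poly r y - c * u \<in> M" "poly r y \<notin> M" for r u
  proof -
    note t = poly_trim[OF y, of r]
    have "(poly r y - c * u) - (poly r y - poly (trim r) y) \<in> M"
      by (rule submod_diff[OF M(1) r(3) t])
    then have 1: "poly (trim r) y - c * u \<in> M" by (simp add: algebra_simps)
    have 2: "poly (trim r) y \<notin> M"
      using submod_add[OF M(1) t, of "poly (trim r) y"] r(4) by auto
    then have "trim r \<noteq> 0" using submod_zero[OF M(1)] by auto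
    then have "?Q (degree (trim r))"
      using 1 2 coeffs_in_trim[OF D(1) r(1)] r(2) lead_coeff_trim by blast
    then show ?thesis using degree_trim by blast
  qed
  define s where "s = (LEAST s. ?Q s)"
  have "s < n \<and> ?Q s"
  proof -
    obtain k r where r: "coeffs_in r D" "degree r < n" "a ^ k * c - poly r y \<in> M"
      using red[OF c(1)] by blast
    have "poly r y \<notin> M"
    proof
      assume "poly r y \<in> M"
      then have "a ^ k * c \<in> M" using submod_add[OF M(1) r(3), of "poly r y"] by simp
      then show False
        using prime[of "a ^ k" c] power_notin[of a k] a c D(3) ER subring_power[OF R] by blast
    qed
    moreover have "poly r y - c * a ^ k \<in> M"
      using submod_uminus[OF M(1) r(3)] by (simp add: algebra_simps)
    moreover have "a ^ k \<in> ?E" using a(1) E(2) subring_power[OF D(1,2)] by blast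
    ultimately obtain s' where s': "s' \<le> degree r" "?Q s'" using Q_trim[OF r(1)] by blast
    have "s \<le> s'" unfolding s_def using s'(2) by (rule Least_le)
    moreover have "?Q s" unfolding s_def using s'(2) by (rule LeastI)
    ultimately show ?thesis using s'(1) r(2) by simp
  qed
  then obtain r u where s: "s < n" and r: "coeffs_in r D" "u \<in> ?E" "poly r y - c * u \<in> M"
    "poly r y \<notin> M" "lead_coeff r \<notin> M" "degree r = s" by blast
  \<comment> \<open>Otherwise pseudo-division of \<open>g\<close> by \<open>r\<close> leaves a
    remainder whose value is again a multiple of \<open>c\<close> modulo \<open>M\<close>, of degree
    below \<open>s\<close>, so that this value lies in \<open>M\<close>. Then the quotient vanishes
    at \<open>y\<close> modulo \<open>M\<close>, has degree below \<open>n\<close>, and so has all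
    its coefficients in \<open>M\<close>; the coefficient \<open>l ^ k * a\<close> in degree
    \<open>n\<close> would lie in \<open>M\<close> too.\<close>
  have "s = 0"
  proof (rule ccontr)
    assume "s \<noteq> 0"
    define l where "l = lead_coeff r"
    have l: "l \<in> D" "l \<notin> M" using r by (auto simp: l_def)
    from pseudo_division_in[OF D(1,2) r(1) _ g(1)] \<open>s \<noteq> 0\<close> r(6) g(4)
    obtain k q t where q: "coeffs_in q D" "coeffs_in t D" "smult (l ^ k) g = q * r + t"
      "degree t < s" "degree q \<le> n - s" unfolding l_def by auto
    have lk: "l ^ k \<in> R" using l(1) D(3) subring_power[OF R] by blast
    have t: "poly t y = l ^ k * poly g y - poly q y * poly r y"
      using arg_cong[OF q(3), of "\<lambda>f. poly f y"] by simp
    have "poly t y \<in> M"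
    proof (rule ccontr)
      assume nM: "poly t y \<notin> M"
      have "l ^ k * poly g y - poly q y * (poly r y - c * u) \<in> M"
        by (intro submod_diff[OF M(1)] submod_mult[OF M(1)] lk g polyR q r)
      then have "poly t y - c * (- (poly q y * u)) \<in> M"
        unfolding t by (simp add: algebra_simps)
      moreover have "- (poly q y * u) \<in> ?E"
        by (intro submod_uminus[OF E(1)] submod_mult[OF E(1)] polyE q r)
      ultimately obtain s' where s': "s' \<le> degree t" "?Q s'" using Q_trim[OF q(2)] nM by blast
      have "s \<le> s'" unfolding s_def using s'(2) by (rule Least_le)
      then show False using q(4) s'(1) by simp
    qed
    then have "l ^ k * poly g y - poly t y \<in> M"
      by (intro submod_diff[OF M(1)] submod_mult[OF M(1)] lk g)
    then have "poly q y * poly r y \<in> M" unfolding t by simp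
    then have "poly q y \<in> M" using prime polyR q(1) r(1,4) by blast
    then have "coeffs_in q M" using q(1,5) s \<open>s \<noteq> 0\<close> by (intro min) auto
    then have "coeffs_in (r * q) M" by (rule coeffs_in_mult[OF MD r(1)])
    then have "coeff (r * q) n \<in> M" ..
    also have "coeff (r * q) n = coeff (smult (l ^ k) g) n"
      unfolding q(3) using q(4) s by (simp add: coeff_eq_0 mult.commute)
    also have "\<dots> = l ^ k * a" using g(4) by (simp add: a_def)
    finally show False
      using prime[of "l ^ k" a] power_notin[of l k] a l D(3) lk by blast
  qed
  define e where "e = lead_coeff r"
  have e: "e \<in> D" "e \<notin> M" using r by (auto simp: e_def)
  have "degree r = 0" using \<open>s = 0\<close> r(6) by simp
  then have "poly r y = e" unfolding e_def
    by (metis degree_eq_zeroE poly_pCons mult_zero_right add.right_neutral poly_0 coeff_pCons_0)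
  then have ecu: "c * u - e \<in> M" using submod_uminus[OF M(1) r(3)] by simp
  have eR: "e \<in> R" "a \<in> R" "c * u \<in> R"
    using e a D(3) c(1) r(2) ER submod_mult[OF R(1)] by blast+
  \<comment> \<open>An inverse \<open>v\<close> of \<open>p\<close> up to \<open>c ^ k\<close>
    becomes one up to \<open>e ^ k\<close> after multiplication by \<open>u ^ k\<close>, and one up
    to \<open>a ^ j * e ^ k\<close> after reduction to degree below \<open>n\<close>. Comparing
    constant coefficients replaces it by \<open>coeff t 0\<close>, an element of
    \<open>D\<close>.\<close>
  have "\<exists>k. \<exists>u \<in> D. p * u - (a * e) ^ k \<in> M" if p: "p \<in> D" "p \<notin> M" for p
  proof -
    have "p \<in> ?E" using p E(2) by blast
    then obtain k v where v: "v \<in> ?E" "p * v - c ^ k \<in> M" using c(3) p(2) by blast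
    have uk: "u ^ k \<in> ?E" using E D(2) r(2) subring_power[OF E(1)] by blast
    then have "u ^ k * (p * v - c ^ k) + ((c * u) ^ k - e ^ k) \<in> M"
      using ER by (intro submod_add[OF M(1)] submod_mult[OF M(1)] v power_cong_M ecu eR) auto
    then have 1: "p * (v * u ^ k) - e ^ k \<in> M"
      by (simp add: algebra_simps power_mult_distrib)
    have "v * u ^ k \<in> ?E" by (intro submod_mult[OF E(1)] v uk)
    then obtain j t where t: "coeffs_in t D" "degree t < n" "a ^ j * (v * u ^ k) - poly t y \<in> M"
      using red by blast
    let ?f = "smult p t - [:a ^ j * e ^ k:]"
    have aj: "a ^ i \<in> D" "e ^ i \<in> D" for i using subring_power[OF D(1,2)] a e by auto
    have "a ^ j * (p * (v * u ^ k) - e ^ k) - p * (a ^ j * (v * u ^ k) - poly t y) \<in> M"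
      using aj p D(3) by (intro submod_diff[OF M(1)] submod_mult[OF M(1)] 1 t) auto
    then have "poly ?f y \<in> M" by (simp add: algebra_simps)
    moreover have "coeffs_in ?f D"
    proof (rule coeffs_in_diff[OF D(1)])
      show "coeffs_in (smult p t) D" using t(1) p submod_mult[OF D(1)] by simp
      show "coeffs_in [:a ^ j * e ^ k:] D"
        by (rule coeffs_in_pCons) (auto intro: submod_mult[OF D(1)] aj submod_zero[OF D(1)])
    qed
    moreover have "degree ?f < n"
      using n t(2) degree_smult_le[of p t] by (intro degree_diff_less) auto
    ultimately have "coeff ?f 0 \<in> M" using min by blast
    \<comment> \<open>The factor balances the two exponents, since \<open>loc_field\<close> asks for
      powers of a single element.\<close>
    then have "a ^ k * e ^ j * (p * coeff t 0 - a ^ j * e ^ k) \<in> M"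
      using aj D(3) by (intro submod_mult[OF M(1)] submod_mult[OF R(1)]) auto
    then have "p * (a ^ k * e ^ j * coeff t 0) - (a * e) ^ (j + k) \<in> M"
      by (simp add: algebra_simps power_mult_distrib power_add)
    moreover have "a ^ k * e ^ j * coeff t 0 \<in> D"
      using t(1) by (intro submod_mult[OF D(1)] aj) auto
    ultimately show ?thesis by blast
  qed
  moreover have "a * e \<in> D" "a * e \<notin> M"
    using a e submod_mult[OF D(1)] prime eR by blast+
  ultimately show ?thesis unfolding loc_field_def by blast
qed

end

section \<open>Residue fields of finitely generated rings\<close>

lemma submod_ring: "submod (mspan X {1}) (mspan X {1})"
  by (rule submodI) (auto intro: mspan.zero mspan.diff submod_ring_mult[OF submod_mspan])

lemma mspan_int: "mspan {} {1} = (\<int> :: 'r::comm_ring_1 set)"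
proof
  show "mspan {} {1} \<subseteq> (\<int> :: 'r set)" by (rule mspan_least) (auto simp: submod_def)
  show "(\<int> :: 'r set) \<subseteq> mspan {} {1}"
  proof
    fix a :: 'r assume "a \<in> \<int>"
    then obtain k where "a = of_int k * 1" by (auto elim: Ints_cases)
    then show "a \<in> mspan {} {1}"
      by (simp only:) (intro submod_of_int[OF submod_mspan] mspan.base, simp)
  qed
qed

locale maximal_in_fg_ring =
  fixes X M :: "'r::comm_ring_1 set"
  assumes fin: "finite X"
    and M: "submod X M" "M \<subseteq> mspan X {1}" "1 \<notin> M"
    and max: "\<And>r. r \<in> mspan X {1} \<Longrightarrow> r \<notin> M \<Longrightarrow> \<exists>s \<in> mspan X {1}. r * s - 1 \<in> M"
begin

lemma M_ring: "submod (mspan X {1}) M"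
  using M(1) by (auto simp: submod_def[of "mspan X {1}"] intro: submod_zero submod_diff submod_ring_mult)

sublocale prime_in_subring "mspan X {1}" M
proof
  fix r s assume rs: "r \<in> mspan X {1}" "s \<in> mspan X {1}" "r * s \<in> M"
  show "r \<in> M \<or> s \<in> M"
  proof (rule ccontr)
    assume *: "\<not> (r \<in> M \<or> s \<in> M)"
    then obtain t where t: "t \<in> mspan X {1}" "r * t - 1 \<in> M" using max rs by blast
    have "t * (r * s) - s * (r * t - 1) \<in> M"
      by (intro submod_diff[OF M_ring] submod_mult[OF M_ring] t rs)
    then show False using * by (simp add: algebra_simps)
  qed
qed (use submod_ring M_ring M mspan.base[of 1 "{1}"] in auto)

text \<open>The whole ring is a field modulo \<open>M\<close>, so \<open>d = 1\<close> serves for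
  \<open>Y = X\<close>; from there the generators are removed one by one. Below,
  \<open>Y = {}\<close> yields a positive integer in \<open>M\<close> and \<open>Y = {t}\<close> the
  algebraicity of \<open>t\<close> over the integers.\<close>

lemma loc_field_sub: 
  assumes "Y \<subseteq> X" "X - Y = Z"
  shows "loc_field (mspan Y {1})"
proof -
  have "finite Z" using assms fin by auto
  then show ?thesis using assms
  proof (induction Z arbitrary: Y)
    case empty
    then have "Y = X" by blast
    have "\<exists>k. \<exists>u \<in> mspan X {1}. p * u - 1 ^ k \<in> M" if "p \<in> mspan X {1} - M" for p
      using max that by simp
    then show ?case
      unfolding loc_field_def \<open>Y = X\<close> using R(2) M(3) by (intro bexI[of _ 1] ballI) auto
  next
    case (insert y Z)
    then have "loc_field (mspan (insert y Y) {1})" by (intro insert.IH) auto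
    then have "loc_field (adjoin (mspan Y {1}) y)" unfolding mspan_insert .
    moreover have "y \<in> X" using insert.prems by auto
    from mspan.mult[OF this R(2)] have "y \<in> mspan X {1}" by simp
    moreover have "1 \<in> mspan Y {1}" by (rule mspan.base) simp
    moreover have "mspan Y {1} \<subseteq> mspan X {1}" using insert.prems(1) by (rule mspan_mono) simp
    ultimately show ?case using loc_field_of_adjoin[OF submod_ring] by blast
  qed
qed

lemma of_int_in: "of_int k \<in> mspan X {1}"
  using submod_of_int[OF submod_mspan R(2)] by simp

lemma of_int_mem_imp: "of_int a \<in> M \<Longrightarrow> of_int (b * a) \<in> M"
  using submod_of_int[OF M(1)] by simp

text \<open>If no nonzero integer lay in \<open>M\<close>, inverting a single integer
  \<open>\<delta>\<close> would turn the integers into a field; but \<open>1 + 3 * \<delta>\<close>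
  is a nonunit coprime to \<open>\<delta>\<close> and divides no power of it.\<close>

lemma ex_positive_int_mem: "\<exists>q > 0. of_int q \<in> M"
proof -
  have "loc_field (mspan {} {1})" by (rule loc_field_sub) auto
  then have "\<exists>d \<in> \<int> - M. \<forall>p \<in> \<int> - M. \<exists>k. \<exists>u \<in> \<int>. p * u - d ^ k \<in> M"
    unfolding loc_field_def mspan_int .
  then obtain d where d: "d \<in> \<int>" "d \<notin> M" "\<forall>p \<in> \<int> - M. \<exists>k. \<exists>u \<in> \<int>. p * u - d ^ k \<in> M"
    by (elim bexE DiffE)
  obtain \<delta> where \<delta>: "d = of_int \<delta>" using d(1) by (auto elim: Ints_cases)
  then have "\<delta> \<noteq> 0" using d(2) submod_zero[OF M(1)] by auto
  \<comment> \<open>The factor 3 ensures that this is neither 0 nor a unit for any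
    \<open>\<delta> \<noteq> 0\<close>; with 1 or 2 in its place, \<open>\<delta> = -1\<close> would
    fail.\<close>
  let ?p = "1 + 3 * \<delta>"
  have "\<exists>z. z \<noteq> 0 \<and> of_int z \<in> M"
  proof (cases "of_int ?p \<in> M")
    case True
    moreover have "?p \<noteq> 0" by presburger
    ultimately show ?thesis by blast
  next
    case False
    then have "of_int ?p \<in> \<int> - M" by (intro DiffI Ints_of_int)
    from d(3)[rule_format, OF this]
    obtain k u where u: "u \<in> \<int>" "of_int ?p * u - d ^ k \<in> M" by blast
    then obtain w where w: "u = of_int w" by (auto elim: Ints_cases)
    have "of_int (?p * w - \<delta> ^ k) \<in> M" using u(2) by (simp add: w \<delta>)
    moreover have "?p * w - \<delta> ^ k \<noteq> 0"
    proof
      assume "?p * w - \<delta> ^ k = 0"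
      then have "?p dvd \<delta> ^ k" by (metis dvd_triv_left eq_iff_diff_eq_0)
      moreover have "coprime ?p \<delta>"
        by (rule coprimeI) (metis dvd_add_left_iff dvd_mult)
      then have "coprime ?p (\<delta> ^ k)" by simp
      ultimately have "is_unit ?p" by (metis coprime_common_divisor dvd_refl)
      then show False using \<open>\<delta> \<noteq> 0\<close> by (auto simp: zdvd1_eq)
    qed
    ultimately show ?thesis by blast
  qed
  then obtain z where "z \<noteq> 0" "of_int z \<in> M" by blast
  then show ?thesis
    using submod_uminus[OF M(1), of "of_int z"] by (intro exI[of _ "\<bar>z\<bar>"]) (auto simp: abs_if)
qed

text \<open>Let \<open>q\<close> be the least positive integer in \<open>M\<close>. As
  \<open>M\<close> is prime, it contains the gcd of \<open>a\<close> and \<open>q\<close> or the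
  cofactor \<open>q'\<close>; the former would put \<open>a\<close> into \<open>M\<close>, the
  latter forces the gcd to be 1 by minimality. Bezout gives the inverse.\<close>

lemma int_inverse_mod:
  assumes "of_int a \<notin> M"
  shows "\<exists>b. of_int (b * a) - 1 \<in> M"
proof -
  let ?P = "\<lambda>n::nat. 0 < n \<and> of_int (int n) \<in> M"
  define q where "q = (LEAST n. ?P n)"
  obtain z :: int where "0 < z" "of_int z \<in> M" using ex_positive_int_mem by blast
  then have "?P (nat z)" by (cases z) auto
  then have "?P q" unfolding q_def by (rule LeastI)
  then have q: "0 < q" "of_int (int q) \<in> M" by blast+
  let ?g = "gcd a (int q)"
  have "?g dvd int q" by simp
  then obtain q' where q': "int q = ?g * q'" by blast
  have "?g > 0" using q(1) by simp
  moreover have "0 < ?g * q'" unfolding q'[symmetric] using q(1) by simp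
  ultimately have "q' > 0" by (blast intro: zero_less_mult_pos)
  have "of_int (?g * q') \<in> M" using q(2) unfolding q'[symmetric] .
  then have "of_int ?g * of_int q' \<in> M" by (simp only: of_int_mult)
  then have "of_int ?g \<in> M \<or> of_int q' \<in> M" by (intro prime of_int_in)
  moreover have "of_int ?g \<notin> M"
  proof
    assume "of_int ?g \<in> M"
    then have "of_int (a div ?g * ?g) \<in> M" by (rule of_int_mem_imp)
    then show False using assms by simp
  qed
  ultimately have "of_int q' \<in> M" by blast
  then have "?P (nat q')" using \<open>q' > 0\<close> by (simp only: nat_0_le) simp
  then have "q \<le> nat q'" unfolding q_def by (rule Least_le)
  then have "int q \<le> q'" using \<open>q' > 0\<close> by simp
  then have "?g * q' \<le> 1 * q'" using q' by linarith
  then have "?g \<le> 1" using \<open>q' > 0\<close> by (rule mult_right_le_imp_le)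
  then have "?g = 1" using \<open>?g > 0\<close> by linarith
  then obtain u v where uv: "u * a + v * int q = 1" using bezout_int[of a "int q"] by auto
  have "of_int (u * a) - 1 = (of_int (- v * int q) :: 'r)"
    using arg_cong[OF uv, of "of_int :: int \<Rightarrow> 'r"] by (simp add: algebra_simps)
  then show ?thesis using of_int_mem_imp[OF q(2), of "- v"] by (intro exI[of _ u]) simp
qed

text \<open>Algebraicity over the integers modulo \<open>M\<close> improves to integrality because
  an integer outside \<open>M\<close> is invertible modulo \<open>M\<close>.\<close>

lemma integral_mod:
  assumes "t \<in> X"
  shows "\<exists>f. coeffs_in f \<int> \<and> lead_coeff f = 1 \<and> 0 < degree f \<and> poly f t \<in> M"
proof -
  let ?D = "mspan {} {1} :: 'r set"
  have tR: "t \<in> mspan X {1}" using mspan.mult[OF assms R(2)] by simp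
  have DR: "?D \<subseteq> mspan X {1}" by (rule mspan_mono) auto
  have "loc_field (mspan {t} {1})" using assms by (intro loc_field_sub) auto
  then have "algebraic_mod ?D t"
    unfolding mspan_insert
    by (rule loc_field_adjoin_imp_algebraic[OF submod_ring mspan.base DR tR, rotated]) simp
  then obtain f where f: "coeffs_in f \<int>" "poly f t \<in> M" "lead_coeff f \<notin> M"
    by (auto simp: algebraic_mod_def mspan_int)
  obtain a where a: "lead_coeff f = of_int a" using f(1) by (auto elim: Ints_cases)
  obtain b where b: "of_int (b * a) - 1 \<in> M" using int_inverse_mod f(3) a by metis
  \<comment> \<open>Scaling by \<open>b\<close> makes the leading coefficient 1 only modulo
    \<open>M\<close>; the added monomial, whose coefficient lies in \<open>M\<close>, makes it equal
    to 1.\<close>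
  let ?g = "smult (of_int b) f + monom (1 - of_int (b * a)) (degree f)"
  have lc: "coeff ?g (degree f) = 1" using a by simp
  have "degree ?g \<le> degree f"
    by (intro degree_add_le degree_smult_le degree_monom_le)
  moreover have "degree f \<le> degree ?g" using lc by (intro le_degree) auto
  ultimately have deg: "degree ?g = degree f" by simp
  have cg: "coeffs_in ?g \<int>"
    using f(1) by (auto simp: coeff_monom intro!: Ints_mult Ints_add Ints_diff)
  have "t ^ degree f \<in> mspan X {1}" by (rule subring_power[OF R tR])
  then have "t ^ degree f * (of_int (b * a) - 1) \<in> M" by (rule submod_mult[OF M_ring _ b])
  then have "of_int b * poly f t - t ^ degree f * (of_int (b * a) - 1) \<in> M"
    by (intro submod_diff[OF M_ring] submod_of_int[OF M_ring] f)
  then have pg: "poly ?g t \<in> M" by (simp add: poly_monom algebra_simps)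
  have "0 < degree f"
  proof (rule ccontr)
    assume "\<not> 0 < degree f"
    then have "poly f t = lead_coeff f"
      by (metis degree_eq_zeroE gr0I poly_pCons mult_zero_right add.right_neutral poly_0 coeff_pCons_0)
    then show False using f by simp
  qed
  then show ?thesis using deg cg pg lc by (intro exI[of _ ?g]) auto
qed

end

section \<open>Residual finiteness of finitely generated modules\<close>

lemma submod_plus:
  assumes N: "submod X N" and W: "submod X W"
  shows "submod X {n + w | n w. n \<in> N \<and> w \<in> W}"
proof (rule submodI)
  show "0 \<in> {n + w | n w. n \<in> N \<and> w \<in> W}"
    using submod_zero[OF N] submod_zero[OF W] by (auto intro!: exI[of _ 0])
next
  fix a b assume "a \<in> {n + w | n w. n \<in> N \<and> w \<in> W}" "b \<in> {n + w | n w. n \<in> N \<and> w \<in> W}"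
  then obtain n w n' w' where *: "a = n + w" "b = n' + w'" "n \<in> N" "w \<in> W" "n' \<in> N" "w' \<in> W"
    by auto
  then have "a - b = (n - n') + (w - w')" by simp
  then show "a - b \<in> {n + w | n w. n \<in> N \<and> w \<in> W}"
    using submod_diff[OF N *(3,5)] submod_diff[OF W *(4,6)] by blast
next
  fix x a assume x: "x \<in> X" and "a \<in> {n + w | n w. n \<in> N \<and> w \<in> W}"
  then obtain n w where *: "a = n + w" "n \<in> N" "w \<in> W" by auto
  then have "x * a = x * n + x * w" by (simp add: distrib_left)
  then show "x * a \<in> {n + w | n w. n \<in> N \<and> w \<in> W}"
    using submod_mult[OF N x *(2)] submod_mult[OF W x *(3)] by blast
qed

lemma submod_image_mult:
  assumes W: "submod X W"
  shows "submod X ((\<lambda>w. r * w) ` W)"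
proof (rule submodI)
  show "0 \<in> (\<lambda>w. r * w) ` W" using submod_zero[OF W] by (auto intro!: image_eqI[of _ _ 0])
next
  fix a b assume "a \<in> (\<lambda>w. r * w) ` W" "b \<in> (\<lambda>w. r * w) ` W"
  then obtain v w where "a = r * v" "b = r * w" "v \<in> W" "w \<in> W" by auto
  then show "a - b \<in> (\<lambda>w. r * w) ` W"
    using submod_diff[OF W] by (auto simp: algebra_simps intro!: image_eqI[of _ _ "v - w"])
next
  fix x a assume "x \<in> X" "a \<in> (\<lambda>w. r * w) ` W"
  then obtain v where "a = r * v" "v \<in> W" by auto
  then show "x * a \<in> (\<lambda>w. r * w) ` W"
    using submod_mult[OF W \<open>x \<in> X\<close>] by (auto simp: algebra_simps intro!: image_eqI[of _ _ "x * v"])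
qed

text \<open>Degrees need not add in a ring with zero divisors; here they do because the product of
  the leading coefficients is 1.\<close>

lemma monic_power:
  fixes f :: "'r::comm_ring_1 poly"
  assumes "lead_coeff f = 1"
  shows "degree (f ^ k) = k * degree f \<and> lead_coeff (f ^ k) = 1"
proof (induction k)
  case (Suc k)
  then have "coeff (f * f ^ k) (degree f + degree (f ^ k)) = 1"
    unfolding coeff_mult_degree_sum using assms by (metis mult_1)
  moreover from this have "degree f + degree (f ^ k) \<le> degree (f * f ^ k)"
    by (intro le_degree) simp
  then have "degree (f * f ^ k) = degree f + degree (f ^ k)"
    using degree_mult_le[of f "f ^ k"] by simp
  ultimately show ?case using Suc by simp
qed simp

lemma submod_Union_chain:
  assumes "\<C> \<noteq> {}" "\<And>U. U \<in> \<C> \<Longrightarrow> submod X U"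
    and chain: "\<And>U U'. U \<in> \<C> \<Longrightarrow> U' \<in> \<C> \<Longrightarrow> U \<subseteq> U' \<or> U' \<subseteq> U"
  shows "submod X (\<Union>\<C>)"
proof (rule submodI)
  show "0 \<in> \<Union>\<C>" using assms(1,2) submod_zero by (metis UnionI equals0I)
next
  fix a b assume "a \<in> \<Union>\<C>" "b \<in> \<Union>\<C>"
  then obtain U U' where *: "U \<in> \<C>" "U' \<in> \<C>" "a \<in> U" "b \<in> U'" by auto
  have "\<exists>W \<in> \<C>. a \<in> W \<and> b \<in> W"
    using chain[OF *(1,2)] * by (elim disjE) blast+
  then obtain W where "W \<in> \<C>" "a \<in> W" "b \<in> W" by blast
  then show "a - b \<in> \<Union>\<C>" using submod_diff[OF assms(2)] by blast
next
  fix x a assume "x \<in> X" "a \<in> \<Union>\<C>"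
  then show "x * a \<in> \<Union>\<C>" using submod_mult[OF assms(2)] by blast
qed

text \<open>P. Hall's theorem; the finite \<open>T\<close> says that \<open>N'\<close> has finite
  index. Nilpotency transfers to the whole quotient what the residue field gives for
  \<open>b\<close>: a positive integer and monic integer polynomials in the operators that
  annihilate.\<close>

theorem fg_module_residually_finite:
  fixes X F :: "'r::comm_ring_1 set"
  assumes fin: "finite X" "finite F" and N: "submod X N" "N \<subseteq> mspan X F"
    and b: "b \<in> mspan X F" "b \<notin> N"
  shows "\<exists>N'. submod X N' \<and> N \<subseteq> N' \<and> N' \<subseteq> mspan X F \<and> b \<notin> N'
    \<and> (\<exists>T. finite T \<and> (\<forall>v \<in> mspan X F. \<exists>t \<in> T. v - t \<in> N'))"
proof -
  define V where "V = mspan X F"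
  have V: "submod X V" unfolding V_def by (rule submod_mspan)
  define \<A> where "\<A> = {U. submod X U \<and> N \<subseteq> U \<and> U \<subseteq> V \<and> b \<notin> U}"
  have "\<exists>N' \<in> \<A>. \<forall>U \<in> \<A>. N' \<subseteq> U \<longrightarrow> U = N'"
  proof (rule subset_Zorn_nonempty)
    show "\<A> \<noteq> {}" using N b by (auto simp: \<A>_def V_def)
    fix \<C> assume "\<C> \<noteq> {}" "subset.chain \<A> \<C>"
    then have "\<C> \<subseteq> \<A>" "\<And>U U'. U \<in> \<C> \<Longrightarrow> U' \<in> \<C> \<Longrightarrow> U \<subseteq> U' \<or> U' \<subseteq> U"
      by (auto simp: subset_chain_def)
    then show "\<Union>\<C> \<in> \<A>"
      using submod_Union_chain[OF \<open>\<C> \<noteq> {}\<close>, of X] \<open>\<C> \<noteq> {}\<close> unfolding \<A>_def by blast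
  qed
  then obtain K where K: "submod X K" "N \<subseteq> K" "K \<subseteq> V" "b \<notin> K"
    and max: "\<And>U. U \<in> \<A> \<Longrightarrow> K \<subseteq> U \<Longrightarrow> U = K" by (auto simp: \<A>_def)
  have mono: "b \<in> {n + w | n w. n \<in> K \<and> w \<in> W}"
    if W: "submod X W" "W \<subseteq> V" "w \<in> W" "w \<notin> K" for W w
  proof (rule ccontr)
    let ?U = "{n + w | n w. n \<in> K \<and> w \<in> W}"
    assume "b \<notin> ?U"
    moreover have KU: "K \<subseteq> ?U"
    proof
      fix a assume "a \<in> K"
      moreover have "a = a + 0" by simp
      ultimately show "a \<in> ?U" using submod_zero[OF W(1)] by blast
    qed
    moreover have "?U \<subseteq> V" using K(3) W(2) submod_add[OF V] by blast
    ultimately have "?U \<in> \<A>" using K(2) submod_plus[OF K(1) W(1)] by (auto simp: \<A>_def)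
    then have "?U = K" using KU by (rule max)
    moreover have "w = 0 + w" by simp
    then have "w \<in> ?U" using W(3) submod_zero[OF K(1)] by blast
    ultimately show False using W(4) by blast
  qed
  have bV: "b \<in> V" using b by (simp add: V_def)
  let ?R = "mspan X {1}"
  define M where "M = {r \<in> ?R. r * b \<in> K}"
  interpret quot: maximal_in_fg_ring X M
  proof
    show "submod X M"
      using submod_zero[OF K(1)] submod_diff[OF K(1)] submod_mult[OF K(1)]
      by (intro submodI) (auto simp: M_def left_diff_distrib mult.assoc intro: mspan.intros)
    fix r assume r: "r \<in> ?R" "r \<notin> M"
    let ?W = "(\<lambda>s. r * b * s) ` ?R"
    have "b \<in> {n + w | n w. n \<in> K \<and> w \<in> ?W}"
    proof (rule mono)
      show "submod X ?W" by (rule submod_image_mult[OF submod_mspan])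
      show "?W \<subseteq> V"
      proof
        fix a assume "a \<in> ?W"
        then obtain s where s: "s \<in> ?R" "a = s * (r * b)" by (auto simp: mult.commute)
        show "a \<in> V" unfolding s(2) by (intro submod_ring_mult[OF V] s r bV)
      qed
      have "1 \<in> ?R" by (rule mspan.base) simp
      then show "r * b \<in> ?W" by (intro image_eqI[of _ _ 1]) auto
      show "r * b \<notin> K" using r by (simp add: M_def)
    qed
    then obtain n s where s: "n \<in> K" "s \<in> ?R" "b = n + r * b * s" by auto
    have "(r * s - 1) * b = - n" using s(3) by (simp add: algebra_simps)
    then have "(r * s - 1) * b \<in> K" using submod_uminus[OF K(1) s(1)] by simp
    moreover have "r * s - 1 \<in> ?R"
      by (intro mspan.diff submod_ring_mult[OF submod_mspan] r s mspan.base) simp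
    ultimately show "\<exists>s \<in> ?R. r * s - 1 \<in> M" using s(2) by (auto simp: M_def)
  qed (use fin K b in \<open>auto simp: M_def\<close>)
  \<comment> \<open>Fitting's argument: the kernels \<open>L i\<close> of the powers of
    \<open>r\<close> modulo \<open>K\<close> stabilise, so the image of \<open>r ^ m\<close> meets
    the kernel of \<open>r\<close> trivially modulo \<open>K\<close>. A nonzero image would contain
    \<open>b\<close> modulo \<open>K\<close>, which \<open>r\<close> kills.\<close>
  have nilp: "\<exists>k. \<forall>v \<in> V. r ^ k * v \<in> K" if "r \<in> M" for r
  proof -
    have r: "r \<in> ?R" "r * b \<in> K" using that by (auto simp: M_def)
    define L where "L i = {v \<in> V. r ^ i * v \<in> K}" for i
    have LS: "submod X (L i)" for i
      unfolding L_def
      using submod_zero[OF K(1)] submod_diff[OF K(1)] submod_mult[OF K(1)]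
        submod_zero[OF V] submod_diff[OF V] submod_mult[OF V]
      by (intro submodI) (auto simp: right_diff_distrib mult.left_commute)
    have LV: "L i \<subseteq> V" for i by (auto simp: L_def)
    have Lmono: "L i \<subseteq> L (Suc i)" for i
      unfolding L_def using submod_ring_mult[OF K(1) r(1)] by (auto simp: mult.assoc)
    have noeth: "\<exists>G. finite G \<and> U = mspan X G" if "submod X U" "U \<subseteq> V" for U
      using submod_finitely_generated[OF fin that(1)] that(2) by (simp add: V_def)
    from noeth LS LV Lmono have "\<exists>m. \<forall>i. L i \<subseteq> L m"
      by (rule chain_of_submods_stabilises)
    then obtain m where "\<forall>i. L i \<subseteq> L m" ..
    note m = this[rule_format]
    let ?W = "(\<lambda>v. r ^ m * v) ` V"
    have rV: "r ^ i * v \<in> V" if "v \<in> V" for i v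
      using submod_ring_mult[OF V subring_power[OF submod_ring mspan.base r(1)] that] by simp
    have "r ^ m * v \<in> K" if v: "v \<in> V" for v
    proof (rule ccontr)
      assume "r ^ m * v \<notin> K"
      then have "b \<in> {n + w | n w. n \<in> K \<and> w \<in> ?W}"
        using v rV by (intro mono[of ?W "r ^ m * v"] submod_image_mult V) auto
      then obtain n u where u: "n \<in> K" "u \<in> V" "b = n + r ^ m * u" by auto
      have "r * b - r * n \<in> K"
        by (intro submod_diff[OF K(1)] r submod_ring_mult[OF K(1)] u)
      then have "u \<in> L (Suc m)" using u by (simp add: L_def algebra_simps)
      then have "u \<in> L m" using m[of "Suc m"] by (rule rev_subsetD)
      then have "r ^ m * u \<in> K" by (simp add: L_def)
      then show False using submod_add[OF K(1) u(1)] u(3) K(4) by simp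
    qed
    then show ?thesis by blast
  qed
  obtain q :: int where q: "0 < q" "of_int q \<in> M" using quot.ex_positive_int_mem by blast
  obtain k where k: "\<And>v. v \<in> V \<Longrightarrow> of_int (q ^ k) * v \<in> K" using nilp[OF q(2)] by auto
  have int: "\<exists>g. coeffs_in g \<int> \<and> lead_coeff g = 1 \<and> 0 < degree g \<and> (\<forall>v\<in>V. poly g x * v \<in> K)"
    if x: "x \<in> X" for x
  proof -
    obtain f where f: "coeffs_in f \<int>" "lead_coeff f = 1" "0 < degree f" "poly f x \<in> M"
      using quot.integral_mod[OF x] by blast
    obtain j where j: "\<And>v. v \<in> V \<Longrightarrow> poly f x ^ j * v \<in> K" using nilp[OF f(4)] by blast
    have Z: "submod \<int> (\<int> :: 'r set)" by (rule submodI) auto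
    have "coeffs_in (f ^ i) \<int>" for i
    proof (induction i)
      case (Suc i)
      then show ?case using coeffs_in_mult[OF Z f(1)] by simp
    qed (simp add: coeff_1)
    \<comment> \<open>The exponent is \<open>Suc j\<close> because \<open>j\<close> may be 0 and the
      polynomial must have positive degree.\<close>
    moreover have "poly (f ^ Suc j) x * v \<in> K" if "v \<in> V" for v
    proof -
      have "poly f x \<in> ?R" using f(4) by (simp add: M_def)
      from submod_ring_mult[OF K(1) this j[OF that]] show ?thesis by (simp add: mult.assoc)
    qed
    ultimately show ?thesis
      using monic_power[OF f(2), of "Suc j"] f(3)
      by (intro exI[of _ "f ^ Suc j"]) (auto simp del: power_Suc)
  qed
  have "0 < q ^ k" using q(1) by simp
  from finite_transversal_integral[OF fin K(1) this V_def k int]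
  show ?thesis using K by (auto simp: V_def)
qed

section \<open>Virtual retracts of abelian groups\<close>

lemma (in comm_group) generate_insert:
  assumes "Z \<subseteq> carrier G" "x \<in> carrier G"
  shows "generate G (insert x Z) = {h \<otimes> x [^] (i::int) | h i. h \<in> generate G Z}" (is "_ = ?U")
proof -
  have Z: "subgroup (generate G Z) G" by (rule generate_is_subgroup[OF assms(1)])
  have ZG: "h \<in> carrier G" if "h \<in> generate G Z" for h
    using subgroup.mem_carrier[OF Z that] .
  have "subgroup ?U G"
  proof (rule subgroupI)
    show "?U \<subseteq> carrier G" using ZG assms(2) by auto
    show "?U \<noteq> {}" using generate.one[of G Z] by blast
  next
    fix a assume "a \<in> ?U"
    then obtain h i where *: "a = h \<otimes> x [^] (i::int)" "h \<in> generate G Z" by auto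
    then have "inv a = inv h \<otimes> x [^] (-i)"
      using assms(2) ZG by (simp add: inv_mult int_pow_neg)
    then show "inv a \<in> ?U" using subgroup.m_inv_closed[OF Z *(2)] by blast
  next
    fix a b assume "a \<in> ?U" "b \<in> ?U"
    then obtain h i k j where *: "a = h \<otimes> x [^] (i::int)" "h \<in> generate G Z"
      "b = k \<otimes> x [^] (j::int)" "k \<in> generate G Z" by auto
    then have "a \<otimes> b = (h \<otimes> k) \<otimes> x [^] (i + j)"
      using assms(2) ZG by (simp add: int_pow_mult m_ac)
    then show "a \<otimes> b \<in> ?U" using subgroup.m_closed[OF Z *(2,4)] by blast
  qed
  moreover have "insert x Z \<subseteq> ?U"
  proof
    fix a assume "a \<in> insert x Z"
    moreover have "x = \<one> \<otimes> x [^] (1::int)" "a \<in> Z \<Longrightarrow> a = a \<otimes> x [^] (0::int)"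
      using assms by (auto simp: int_pow_1)
    ultimately show "a \<in> ?U" using generate.one[of G Z] generate.incl[of _ Z G] by blast
  qed
  ultimately have "generate G (insert x Z) \<subseteq> ?U" by (rule generate_subgroup_incl[rotated])
  moreover have "?U \<subseteq> generate G (insert x Z)"
  proof
    have I: "subgroup (generate G (insert x Z)) G" using assms by (intro generate_is_subgroup) auto
    fix a assume "a \<in> ?U"
    then obtain h i where *: "a = h \<otimes> x [^] (i::int)" "h \<in> generate G Z" by auto
    have "h \<in> generate G (insert x Z)" using *(2) mono_generate[of Z "insert x Z"] by blast
    moreover have "x [^] i \<in> generate G (insert x Z)"
      by (rule subgroup_int_pow_closed[OF I]) (simp add: generate.incl)
    ultimately show "a \<in> generate G (insert x Z)" using *(1) subgroup.m_closed[OF I] by blast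
  qed
  ultimately show ?thesis by blast
qed

text \<open>The subgroup \<open>L\<close> is built by adding the elements of \<open>Y\<close> one at a time: an \<open>x\<close> of finite order
  modulo the previous group is left out, otherwise a large power of \<open>x\<close> is added and killed
  by the retraction \<open>\<rho>\<close>.\<close>
lemma (in comm_group) virtual_retract:
  assumes P: "subgroup P G" and \<Delta>: "finite \<Delta>" "\<Delta> \<inter> P = {}" and Y: "finite Y" "Y \<subseteq> carrier G"
  shows "\<exists>L \<rho> T. subgroup L G \<and> P \<subseteq> L \<and> L \<subseteq> generate G (P \<union> Y) \<and> L \<inter> \<Delta> = {}
    \<and> (\<forall>l \<in> L. \<rho> l \<in> P) \<and> (\<forall>l \<in> L. \<forall>k \<in> L. \<rho> (l \<otimes> k) = \<rho> l \<otimes> \<rho> k) \<and> (\<forall>p \<in> P. \<rho> p = p)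
    \<and> finite T \<and> T \<subseteq> carrier G \<and> (\<forall>g \<in> generate G (P \<union> Y). \<exists>l \<in> L. \<exists>t \<in> T. g = l \<otimes> t)"
  using Y
proof (induction Y)
  case empty
  have "generate G P = P" using generateI[OF P] by blast
  then show ?case
    using P \<Delta> subgroup.mem_carrier[OF P]
    by (intro exI[of _ P] exI[of _ id] exI[of _ "{\<one>}"]) auto
next
  case (insert x Y)
  let ?H = "generate G (P \<union> Y)"
  have PY: "P \<union> Y \<subseteq> carrier G" using insert.prems subgroup.subset[OF P] by auto
  have x: "x \<in> carrier G" using insert.prems by auto
  have H: "subgroup ?H G" using PY by (rule generate_is_subgroup)
  have HG: "h \<in> carrier G" if "h \<in> ?H" for h
    using subgroup.mem_carrier[OF H that] .
  have H': "generate G (P \<union> insert x Y) = {h \<otimes> x [^] (i::int) | h i. h \<in> ?H}"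
    using generate_insert[OF PY x] by simp
  have "Y \<subseteq> carrier G" using insert.prems by simp
  from insert.IH[OF this] obtain L \<rho> T where
    L: "subgroup L G" "P \<subseteq> L" "L \<subseteq> ?H" "L \<inter> \<Delta> = {}"
    and \<rho>0: "\<forall>l \<in> L. \<rho> l \<in> P" "\<forall>l \<in> L. \<forall>k \<in> L. \<rho> (l \<otimes> k) = \<rho> l \<otimes> \<rho> k"
      "\<forall>p \<in> P. \<rho> p = p"
    and T0: "finite T" "T \<subseteq> carrier G" "\<forall>g \<in> ?H. \<exists>l \<in> L. \<exists>t \<in> T. g = l \<otimes> t"
    by (elim exE conjE) (rule that)
  note \<rho> = \<rho>0[rule_format] and T = T0(1,2) T0(3)[rule_format]
  have LG: "l \<in> carrier G" if "l \<in> L" for l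
    using subgroup.mem_carrier[OF L(1) that] .
  \<comment> \<open>Exponents of \<open>x\<close> are divided by \<open>m\<close> with remainder;
    the quotient part is absorbed by \<open>?H\<close> in the first case below and by
    \<open>L'\<close> in the second.\<close>
  define TT where "TT m = (\<lambda>(t, i). t \<otimes> x [^] (i::int)) ` (T \<times> {0..<m})" for m
  have TT: "finite (TT m)" "TT m \<subseteq> carrier G" for m
    using T(1,2) x by (auto simp: TT_def)
  have xmod: "x [^] (i::int) = (x [^] m) [^] (i div m) \<otimes> x [^] (i mod m)" for i m
    using x by (simp add: int_pow_pow flip: int_pow_mult)
  show ?case
  proof (cases "\<exists>m::int > 0. x [^] m \<in> ?H")
    case True
    then obtain m :: int where m: "m > 0" "x [^] m \<in> ?H" by blast
    have TTm: "\<exists>l \<in> L. \<exists>t \<in> TT m. g = l \<otimes> t" if "g \<in> generate G (P \<union> insert x Y)" for g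
    proof -
      from that obtain h i where g: "g = h \<otimes> x [^] (i::int)" "h \<in> ?H" unfolding H' by blast
      have "h \<otimes> (x [^] m) [^] (i div m) \<in> ?H"
        by (intro subgroup.m_closed[OF H] g subgroup_int_pow_closed[OF H] m)
      then obtain l t where lt: "l \<in> L" "t \<in> T" "h \<otimes> (x [^] m) [^] (i div m) = l \<otimes> t"
        using T(3) by blast
      have "g = (h \<otimes> (x [^] m) [^] (i div m)) \<otimes> x [^] (i mod m)"
        unfolding g(1) xmod[of i m] using x HG[OF g(2)] by (simp add: m_assoc)
      also have "\<dots> = l \<otimes> (t \<otimes> x [^] (i mod m))"
        unfolding lt(3) using lt LG T(2) x by (intro m_assoc) auto
      finally show ?thesis using lt m(1) by (force simp: TT_def)
    qed
    have "?H \<subseteq> generate G (P \<union> insert x Y)" by (rule mono_generate) blast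
    with L(3) have "L \<subseteq> generate G (P \<union> insert x Y)" by (rule order_trans)
    then show ?thesis
      by (intro exI[of _ L] exI[of _ \<rho>] exI[of _ "TT m"] conjI ballI L(1,2,4) \<rho>0 TT TTm)
  next
    case False
    have pow0: "i = 0" if "x [^] (i::int) \<in> ?H" for i
    proof (rule ccontr)
      assume "i \<noteq> 0"
      moreover have "x [^] (- i) \<in> ?H"
        using subgroup.m_inv_closed[OF H that] x by (simp add: int_pow_neg)
      ultimately show False using False that by (metis linorder_neqE neg_0_less_iff_less)
    qed
    have uniq: "i = j \<and> h = k" if "h \<otimes> x [^] (i::int) = k \<otimes> x [^] (j::int)" "h \<in> ?H" "k \<in> ?H" for h k i j
    proof -
      have "x [^] (i - j) = inv h \<otimes> (h \<otimes> x [^] i) \<otimes> inv (x [^] j)"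
        using x HG[OF that(2)] by (simp add: int_pow_diff m_assoc[symmetric])
      also have "\<dots> = inv h \<otimes> k"
        unfolding that(1) using x HG[OF that(2)] HG[OF that(3)] by (simp add: m_assoc)
      also have "\<dots> \<in> ?H" by (intro subgroup.m_closed[OF H] subgroup.m_inv_closed[OF H] that)
      finally have "i = j" using pow0 by force
      moreover from this have "h = k"
        using that(1) right_cancel[OF int_pow_closed[OF x] HG[OF that(2)] HG[OF that(3)]] by simp
      ultimately show ?thesis by blast
    qed
    \<comment> \<open>The exponents of \<open>x\<close> at which \<open>\<Delta>\<close> meets
      cosets of \<open>?H\<close>. Exponents are unique by \<open>uniq\<close>, so each element of
      \<open>\<Delta>\<close> contributes at most one.\<close>
    define E where "E = {i::int. \<exists>d \<in> \<Delta>. \<exists>h \<in> ?H. d = h \<otimes> x [^] i}"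
    define e where "e d = (SOME i::int. \<exists>h \<in> ?H. d = h \<otimes> x [^] i)" for d
    have "E \<subseteq> e ` \<Delta>"
    proof
      fix i assume "i \<in> E"
      then obtain d h where d: "d \<in> \<Delta>" "h \<in> ?H" "d = h \<otimes> x [^] i" by (auto simp: E_def)
      then have "\<exists>k \<in> ?H. d = k \<otimes> x [^] e d"
        unfolding e_def by (intro someI_ex[of "\<lambda>i. \<exists>h \<in> ?H. d = h \<otimes> x [^] (i::int)"]) blast
      then obtain k where "k \<in> ?H" "d = k \<otimes> x [^] e d" by blast
      then have "i = e d" using uniq[of h i k "e d", OF trans[OF d(3)[symmetric]]] d(2) by blast
      then show "i \<in> e ` \<Delta>" using d(1) by blast
    qed
    then have "finite E" using \<Delta>(1) by (meson finite_imageI finite_subset)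
    \<comment> \<open>Larger than the absolute value of every element of \<open>E\<close>, so 0 is
      the only multiple of \<open>m\<close> that can occur there, and no element of
      \<open>L'\<close> with nonzero exponent lies in \<open>\<Delta>\<close>. The 1 keeps
      \<open>m\<close> positive if the sum vanishes.\<close>
    define m where "m = 1 + (\<Sum>i\<in>E. \<bar>i\<bar>)"
    have m: "m > 0" unfolding m_def by (simp add: sum_nonneg add_pos_nonneg)
    have Em: "i = 0" if "i \<in> E" "m dvd i" for i
    proof (rule ccontr)
      assume "i \<noteq> 0"
      then have "m \<le> \<bar>i\<bar>" using dvd_imp_le_int[OF _ that(2)] m by simp
      moreover have "\<bar>i\<bar> \<le> (\<Sum>i\<in>E. \<bar>i\<bar>)"
        using \<open>finite E\<close> that(1) by (intro member_le_sum) auto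
      ultimately show False by (simp add: m_def)
    qed
    let ?y = "x [^] m"
    have y: "?y \<in> carrier G" using x by simp
    define L' where "L' = generate G (insert ?y L)"
    have L'_eq: "L' = {l \<otimes> ?y [^] (i::int) | l i. l \<in> L}"
    proof -
      have "generate G L = L" using generateI[OF L(1)] by blast
      then show ?thesis
        using generate_insert[OF subgroup.subset[OF L(1)] y] by (simp add: L'_def)
    qed
    have L': "subgroup L' G"
      unfolding L'_def using subgroup.subset[OF L(1)] y by (intro generate_is_subgroup) auto
    have yu: "i = j \<and> l = k" if "l \<otimes> ?y [^] (i::int) = k \<otimes> ?y [^] (j::int)" "l \<in> L" "k \<in> L" for l k i j
      using uniq[of l "m * i" k "m * j"] that L(3) x m by (auto simp: int_pow_pow)
    define \<rho>' where "\<rho>' g = \<rho> (SOME l. l \<in> L \<and> (\<exists>i::int. g = l \<otimes> ?y [^] i))" for g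
    have \<rho>': "\<rho>' (l \<otimes> ?y [^] (i::int)) = \<rho> l" if "l \<in> L" for l i
    proof -
      have "(SOME k. k \<in> L \<and> (\<exists>j::int. l \<otimes> ?y [^] i = k \<otimes> ?y [^] j)) = l"
        using that yu by (intro some_equality) blast+
      then show ?thesis by (simp add: \<rho>'_def)
    qed
    have L'I: "l \<in> L'" if "l \<in> L" for l
      unfolding L'_def using that by (simp add: generate.incl)
    show ?thesis
    proof (intro exI conjI ballI)
      show "subgroup L' G" by fact
      show "P \<subseteq> L'" using L(2) L'I by blast
      show "L' \<subseteq> generate G (P \<union> insert x Y)"
      proof
        fix g assume "g \<in> L'"
        then obtain l i where "g = l \<otimes> ?y [^] (i::int)" "l \<in> L" unfolding L'_eq by blast
        then have "g = l \<otimes> x [^] (m * i)" "l \<in> ?H" using L(3) x by (auto simp: int_pow_pow)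
        then show "g \<in> generate G (P \<union> insert x Y)" unfolding H' by blast
      qed
      show "L' \<inter> \<Delta> = {}"
      proof (rule ccontr)
        assume "L' \<inter> \<Delta> \<noteq> {}"
        then obtain l i where d: "l \<otimes> ?y [^] (i::int) \<in> \<Delta>" "l \<in> L" unfolding L'_eq by blast
        then have "m * i \<in> E" using L(3) x by (auto simp: E_def int_pow_pow)
        then have "i = 0" using Em[of "m * i"] m by simp
        then show False using d L(4) LG by auto
      qed
      show "\<rho>' l \<in> P" if "l \<in> L'" for l using that \<rho>' \<rho>(1) unfolding L'_eq by auto
      show "\<rho>' (l \<otimes> k) = \<rho>' l \<otimes> \<rho>' k" if lk: "l \<in> L'" "k \<in> L'" for l k
      proof -
        from lk obtain l' i k' j where *: "l = l' \<otimes> ?y [^] (i::int)" "k = k' \<otimes> ?y [^] (j::int)"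
          "l' \<in> L" "k' \<in> L" unfolding L'_eq by blast
        then have "l \<otimes> k = (l' \<otimes> k') \<otimes> ?y [^] (i + j)"
          using y LG int_pow_mult[OF y, of i j] by (simp add: m_ac)
        then show ?thesis using * \<rho>' \<rho>(2) subgroup.m_closed[OF L(1)] by simp
      qed
      show "\<rho>' p = p" if "p \<in> P" for p
        using \<rho>'[of p 0] that L(2) \<rho>(3) LG by auto
      show "finite (TT m)" "TT m \<subseteq> carrier G" by (rule TT)+
      fix g assume "g \<in> generate G (P \<union> insert x Y)"
      then obtain h i where g: "g = h \<otimes> x [^] (i::int)" "h \<in> ?H" unfolding H' by blast
      obtain l t where lt: "l \<in> L" "t \<in> T" "h = l \<otimes> t" using T(3)[OF g(2)] by blast
      have "g = (l \<otimes> ?y [^] (i div m)) \<otimes> (t \<otimes> x [^] (i mod m))"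
        unfolding g(1) xmod[of i m] lt(3) using lt LG T(2) x y
        by (simp add: m_ac subsetD[OF T(2)])
      moreover have "l \<otimes> ?y [^] (i div m) \<in> L'" unfolding L'_eq using lt(1) by blast
      moreover have "t \<otimes> x [^] (i mod m) \<in> TT m" using lt(2) m by (force simp: TT_def)
      ultimately show "\<exists>l \<in> L'. \<exists>t \<in> TT m. g = l \<otimes> t" by blast
    qed
  qed
qed

section \<open>Wreath products of abelian groups\<close>

lemma (in group) hom_generate_in:
  assumes "group H" "h \<in> hom G H" "X \<subseteq> carrier G" "generate G X = carrier G"
    and "subgroup S H" "h ` X \<subseteq> S" "g \<in> carrier G"
  shows "h g \<in> S"
proof -
  interpret H: group H by fact
  interpret h: group_hom G H h by unfold_locales fact
  have "h ` carrier G = generate H (h ` X)"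
    using h.generate_img[OF assms(3)] assms(4) by simp
  also have "\<dots> \<subseteq> S" by (rule H.generate_subgroup_incl[OF assms(6,5)])
  finally show ?thesis using assms(7) by blast
qed

lemma (in group) finite_index_subgroupI:
  assumes S: "subgroup S G" and T: "finite T" "T \<subseteq> carrier G"
    and cover: "\<And>g. g \<in> carrier G \<Longrightarrow> \<exists>s \<in> S. \<exists>t \<in> T. g = s \<otimes> t"
  shows "finite_index_subgroup S G"
proof -
  have "rcosets S \<subseteq> (\<lambda>t. S #> t) ` T"
  proof
    fix U assume "U \<in> rcosets S"
    then obtain g where g: "g \<in> carrier G" "U = S #> g" by (auto simp: RCOSETS_def)
    obtain s t where st: "s \<in> S" "t \<in> T" "g = s \<otimes> t" using cover[OF g(1)] by blast
    then have "U = S #> t"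
      unfolding g(2) st(3) using S T(2) subgroup.mem_carrier[OF S st(1)]
      by (metis coset_mult_assoc subgroup.rcos_const subgroup.subset subsetD is_group)
    then show "U \<in> (\<lambda>t. S #> t) ` T" using st(2) by blast
  qed
  then have "finite (rcosets S)" using T(1) by (meson finite_imageI finite_subset)
  then show ?thesis using S by (simp add: finite_index_subgroup_def)
qed

lemma (in group) separable_subgroupI:
  assumes S: "subgroup S G"
    and "\<And>x. x \<in> carrier G \<Longrightarrow> x \<notin> S \<Longrightarrow> \<exists>H. finite_index_subgroup H G \<and> S \<subseteq> H \<and> x \<notin> H"
  shows "separable_subgroup S G"
  unfolding separable_subgroup_iff
proof (intro conjI ballI)
  fix x assume "x \<in> carrier G - S"
  then have x: "x \<in> carrier G" "x \<notin> S" by auto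
  then obtain H where H: "finite_index_subgroup H G" "S \<subseteq> H" "x \<notin> H" using assms(2) by blast
  then have HG: "subgroup H G" by (simp add: finite_index_subgroup_def)
  have "(x <# H) \<inter> S = {}"
  proof (rule ccontr)
    assume "(x <# H) \<inter> S \<noteq> {}"
    then obtain h where h: "h \<in> H" "x \<otimes> h \<in> H" using H(2) unfolding l_coset_def by blast
    then have "x \<otimes> h \<otimes> inv h \<in> H"
      using HG by (meson subgroup.m_closed subgroup.m_inv_closed)
    then show False using H(3) x(1) subgroup.mem_carrier[OF HG h(1)] by (simp add: m_assoc)
  qed
  moreover have "x \<in> x <# H"
    using x(1) subgroup.one_closed[OF HG] by (force simp: l_coset_def)
  ultimately show "\<exists>U. finite_index_coset G U \<and> x \<in> U \<and> U \<inter> S = {}"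
    using x(1) H(1) by (intro exI[of _ "x <# H"]) (auto simp: finite_index_coset_def)
qed (rule S)

section \<open>Coordinates, translations and generators of the wreath product\<close>

locale abelian_wreath = A: comm_group A + Q: comm_group Q
  for A :: "('a, 'm) monoid_scheme" and Q :: "('b, 'n) monoid_scheme"
begin

abbreviation B where "B \<equiv> sum_group (carrier Q) (\<lambda>_. A)"
abbreviation W where "W \<equiv> wreath_product A Q"

sublocale W: group W
  by (rule group_wreath_product) (rule A.is_group Q.is_group)+

lemma B_iff: "f \<in> carrier B \<longleftrightarrow> f \<in> carrier Q \<rightarrow>\<^sub>E carrier A \<and> finite {p \<in> carrier Q. f p \<noteq> \<one>\<^bsub>A\<^esub>}"
  by (rule carrier_sum_group_iff) (rule A.is_group)

lemma B_val: "f \<in> carrier B \<Longrightarrow> p \<in> carrier Q \<Longrightarrow> f p \<in> carrier A"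
  by (auto simp: B_iff)

lemma B_eqI:
  "f \<in> carrier B \<Longrightarrow> g \<in> carrier B \<Longrightarrow> (\<And>p. p \<in> carrier Q \<Longrightarrow> f p = g p) \<Longrightarrow> f = g"
  by (auto simp: B_iff intro: PiE_ext)

sublocale B: comm_group B
proof (rule group.group_comm_groupI)
  show "group B" using A.is_group by simp
  fix f g assume "f \<in> carrier B" "g \<in> carrier B"
  then show "f \<otimes>\<^bsub>B\<^esub> g = g \<otimes>\<^bsub>B\<^esub> f"
    using B_val by (auto simp: A.m_comm restrict_def fun_eq_iff)
qed

lemma B_mult_val: "p \<in> carrier Q \<Longrightarrow> (f \<otimes>\<^bsub>B\<^esub> g) p = f p \<otimes>\<^bsub>A\<^esub> g p"
  by simp

lemma B_inv_val: "f \<in> carrier B \<Longrightarrow> p \<in> carrier Q \<Longrightarrow> (inv\<^bsub>B\<^esub> f) p = inv\<^bsub>A\<^esub> (f p)"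
  using A.is_group by simp

lemma B_one_val: "p \<in> carrier Q \<Longrightarrow> \<one>\<^bsub>B\<^esub> p = \<one>\<^bsub>A\<^esub>"
  by simp

lemma W_carrier: "carrier W = carrier B \<times> carrier Q"
  and W_mult: "(f, q) \<otimes>\<^bsub>W\<^esub> (g, r) = (f \<otimes>\<^bsub>B\<^esub> translate Q q g, q \<otimes>\<^bsub>Q\<^esub> r)"
  and W_one: "\<one>\<^bsub>W\<^esub> = (\<one>\<^bsub>B\<^esub>, \<one>\<^bsub>Q\<^esub>)"
  by (simp_all add: wreath_product_def semidirect_product_def)

declare mult_sum_group [simp del] one_sum_group [simp del] inv_sum_group [simp del]

lemma translate_val: "p \<in> carrier Q \<Longrightarrow> translate Q q f p = f (inv\<^bsub>Q\<^esub> q \<otimes>\<^bsub>Q\<^esub> p)"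
  by (simp add: translate_def)

lemma translate_closed [simp]:
  assumes "q \<in> carrier Q" "f \<in> carrier B"
  shows "translate Q q f \<in> carrier B"
proof -
  \<comment> \<open>Finiteness of the translated support is not proved anew but read off from the
    closure of \<open>W\<close> under multiplication.\<close>
  have "(\<one>\<^bsub>B\<^esub>, q) \<otimes>\<^bsub>W\<^esub> (f, \<one>\<^bsub>Q\<^esub>) \<in> carrier W"
    using assms by (intro W.m_closed) (auto simp: W_carrier)
  then have *: "\<one>\<^bsub>B\<^esub> \<otimes>\<^bsub>B\<^esub> translate Q q f \<in> carrier B" by (simp add: W_mult W_carrier)
  have "f (inv\<^bsub>Q\<^esub> q \<otimes>\<^bsub>Q\<^esub> p) \<in> carrier A" if "p \<in> carrier Q" for p
    using assms that by (intro B_val) auto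
  then have "\<one>\<^bsub>B\<^esub> \<otimes>\<^bsub>B\<^esub> translate Q q f = translate Q q f"
    by (auto simp: translate_def fun_eq_iff mult_sum_group one_sum_group)
  with * show ?thesis by simp
qed

lemma translate_mult:
  "q \<in> carrier Q \<Longrightarrow> f \<in> carrier B \<Longrightarrow> g \<in> carrier B \<Longrightarrow>
    translate Q q (f \<otimes>\<^bsub>B\<^esub> g) = translate Q q f \<otimes>\<^bsub>B\<^esub> translate Q q g"
  by (rule B_eqI) (auto simp: translate_val B_mult_val)

lemma translate_translate:
  "q \<in> carrier Q \<Longrightarrow> r \<in> carrier Q \<Longrightarrow> f \<in> carrier B \<Longrightarrow>
    translate Q q (translate Q r f) = translate Q (q \<otimes>\<^bsub>Q\<^esub> r) f"
  by (rule B_eqI) (auto simp: translate_val Q.inv_mult Q.m_ac)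

lemma translate_one: "f \<in> carrier B \<Longrightarrow> translate Q \<one>\<^bsub>Q\<^esub> f = f"
  by (rule B_eqI) (auto simp: translate_val)

lemma translate_hom: "q \<in> carrier Q \<Longrightarrow> group_hom B B (translate Q q)"
  by unfold_locales (auto simp: hom_def translate_mult)

definition delta :: "'b \<Rightarrow> 'a \<Rightarrow> 'b \<Rightarrow> 'a" where
  "delta q a = (\<lambda>p \<in> carrier Q. if p = q then a else \<one>\<^bsub>A\<^esub>)"

lemma delta_val: "p \<in> carrier Q \<Longrightarrow> delta q a p = (if p = q then a else \<one>\<^bsub>A\<^esub>)"
  by (simp add: delta_def)

lemma delta_closed [simp]: "a \<in> carrier A \<Longrightarrow> delta q a \<in> carrier B"
  unfolding B_iff by (auto simp: delta_def intro: rev_finite_subset[of "{q}"])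

lemma delta_hom: "delta q \<in> hom A B"
  by (auto simp: hom_def delta_val B_mult_val intro: B_eqI)

lemma translate_delta:
  assumes "q \<in> carrier Q" "r \<in> carrier Q" "a \<in> carrier A"
  shows "translate Q r (delta q a) = delta (r \<otimes>\<^bsub>Q\<^esub> q) a"
proof (rule B_eqI)
  fix p assume p: "p \<in> carrier Q"
  have "inv\<^bsub>Q\<^esub> r \<otimes>\<^bsub>Q\<^esub> p = q \<longleftrightarrow> p = r \<otimes>\<^bsub>Q\<^esub> q"
    using assms p by (metis Q.inv_solve_left')
  then show "translate Q r (delta q a) p = delta (r \<otimes>\<^bsub>Q\<^esub> q) a p"
    using assms p by (simp add: translate_val delta_val)
qed (use assms in auto)

text \<open>Dividing off the value at one coordinate shrinks the finite support. This reduces later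
  statements about homomorphisms and subgroups of \<open>B\<close> to single coordinates.\<close>

lemma B_generated_by_deltas:
  assumes H: "subgroup H B" and K: "\<And>q a. q \<in> K \<Longrightarrow> a \<in> carrier A \<Longrightarrow> delta q a \<in> H"
    and f: "f \<in> carrier B" "\<And>p. p \<in> carrier Q \<Longrightarrow> p \<notin> K \<Longrightarrow> f p = \<one>\<^bsub>A\<^esub>"
  shows "f \<in> H"
proof -
  have main: "f \<in> H" if "finite S" "f \<in> carrier B" "\<And>p. p \<in> carrier Q \<Longrightarrow> p \<notin> S \<inter> K \<Longrightarrow> f p = \<one>\<^bsub>A\<^esub>" for S f
    using that
  proof (induction S arbitrary: f)
    case empty
    then have "f = \<one>\<^bsub>B\<^esub>" by (intro B_eqI) (auto simp: B_one_val)
    then show ?case using subgroup.one_closed[OF H] by simp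
  next
    case (insert s S)
    show ?case
    proof (cases "s \<in> K \<and> s \<in> carrier Q")
      case False
      then show ?thesis using insert.prems by (intro insert.IH) auto
    next
      case True
      let ?d = "delta s (f s)"
      have fs: "f s \<in> carrier A" using B_val insert.prems True by blast
      have d: "?d \<in> H" using K True fs by blast
      have "f \<otimes>\<^bsub>B\<^esub> inv\<^bsub>B\<^esub> ?d \<in> H"
      proof (rule insert.IH)
        show "f \<otimes>\<^bsub>B\<^esub> inv\<^bsub>B\<^esub> ?d \<in> carrier B" using insert.prems fs by simp
        fix p assume "p \<in> carrier Q" "p \<notin> S \<inter> K"
        then show "(f \<otimes>\<^bsub>B\<^esub> inv\<^bsub>B\<^esub> ?d) p = \<one>\<^bsub>A\<^esub>"
          using insert.prems(2)[of p] True fs by (auto simp: B_mult_val B_inv_val delta_val)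
      qed
      then have "(f \<otimes>\<^bsub>B\<^esub> inv\<^bsub>B\<^esub> ?d) \<otimes>\<^bsub>B\<^esub> ?d \<in> H" using d by (rule subgroup.m_closed[OF H])
      then show ?thesis using insert.prems fs by (simp add: B.m_assoc)
    qed
  qed
  have "finite {p \<in> carrier Q. f p \<noteq> \<one>\<^bsub>A\<^esub>}" using f(1) by (simp add: B_iff)
  then show ?thesis using f by (intro main[of "{p \<in> carrier Q. f p \<noteq> \<one>\<^bsub>A\<^esub>}"]) auto
qed

lemma W_inv:
  assumes "f \<in> carrier B" "q \<in> carrier Q"
  shows "inv\<^bsub>W\<^esub> (f, q) = (translate Q (inv\<^bsub>Q\<^esub> q) (inv\<^bsub>B\<^esub> f), inv\<^bsub>Q\<^esub> q)"
proof (rule W.inv_equality)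
  interpret t: group_hom B B "translate Q (inv\<^bsub>Q\<^esub> q)" using assms by (intro translate_hom) simp
  show "(translate Q (inv\<^bsub>Q\<^esub> q) (inv\<^bsub>B\<^esub> f), inv\<^bsub>Q\<^esub> q) \<otimes>\<^bsub>W\<^esub> (f, q) = \<one>\<^bsub>W\<^esub>"
    using assms by (simp add: W_mult W_one)
qed (use assms in \<open>auto simp: W_carrier\<close>)

lemma base_hom: "(\<lambda>f. (f, \<one>\<^bsub>Q\<^esub>)) \<in> hom B W"
  by (auto simp: hom_def W_carrier W_mult translate_one)

lemma top_hom: "(\<lambda>q. (\<one>\<^bsub>B\<^esub>, q)) \<in> hom Q W"
proof -
  have "translate Q q \<one>\<^bsub>B\<^esub> = \<one>\<^bsub>B\<^esub>" if "q \<in> carrier Q" for q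
    using group_hom.hom_one[OF translate_hom[OF that]] .
  then show ?thesis by (auto simp: hom_def W_carrier W_mult)
qed

text \<open>Generators of \<open>A\<close> placed at the identity coordinate and generators of
  \<open>Q\<close> suffice: conjugation by \<open>q\<close> moves the identity coordinate to
  \<open>q\<close>.\<close>

lemma finitely_generated_W:
  assumes "finitely_generated A" "finitely_generated Q"
  shows "finitely_generated W"
proof -
  obtain X where X: "X \<subseteq> carrier A" "finite X" "generate A X = carrier A"
    using assms(1) by (auto simp: finitely_generated_def)
  obtain Y where Y: "Y \<subseteq> carrier Q" "finite Y" "generate Q Y = carrier Q"
    using assms(2) by (auto simp: finitely_generated_def)
  let ?Z = "(\<lambda>a. (delta \<one>\<^bsub>Q\<^esub> a, \<one>\<^bsub>Q\<^esub>)) ` X \<union> (\<lambda>q. (\<one>\<^bsub>B\<^esub>, q)) ` Y"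
  have Z: "?Z \<subseteq> carrier W" using X Y by (auto simp: W_carrier)
  let ?H = "generate W ?Z"
  have H: "subgroup ?H W" by (rule W.generate_is_subgroup[OF Z])
  have top: "(\<one>\<^bsub>B\<^esub>, q) \<in> ?H" if "q \<in> carrier Q" for q
    using that by (intro Q.hom_generate_in[OF W.is_group top_hom Y(1,3) H]) (auto intro: generate.incl)
  have d: "(\<lambda>a. (delta \<one>\<^bsub>Q\<^esub> a, \<one>\<^bsub>Q\<^esub>)) \<in> hom A W"
    using hom_compose[OF delta_hom base_hom] by (simp add: comp_def)
  have d1: "(delta \<one>\<^bsub>Q\<^esub> a, \<one>\<^bsub>Q\<^esub>) \<in> ?H" if "a \<in> carrier A" for a
    using that by (intro A.hom_generate_in[OF W.is_group d X(1,3) H]) (auto intro: generate.incl)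
  have dq: "(delta q a, \<one>\<^bsub>Q\<^esub>) \<in> ?H" if "q \<in> carrier Q" "a \<in> carrier A" for q a
  proof -
    have "(\<one>\<^bsub>B\<^esub>, q) \<otimes>\<^bsub>W\<^esub> (delta \<one>\<^bsub>Q\<^esub> a, \<one>\<^bsub>Q\<^esub>) \<otimes>\<^bsub>W\<^esub> (\<one>\<^bsub>B\<^esub>, inv\<^bsub>Q\<^esub> q) \<in> ?H"
      using that by (intro subgroup.m_closed[OF H] top d1) auto
    also have "(\<one>\<^bsub>B\<^esub>, q) \<otimes>\<^bsub>W\<^esub> (delta \<one>\<^bsub>Q\<^esub> a, \<one>\<^bsub>Q\<^esub>) \<otimes>\<^bsub>W\<^esub> (\<one>\<^bsub>B\<^esub>, inv\<^bsub>Q\<^esub> q) = (delta q a, \<one>\<^bsub>Q\<^esub>)"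
      using that group_hom.hom_one[OF translate_hom[OF that(1)]] by (simp add: W_mult translate_delta)
    finally show ?thesis .
  qed
  have base: "(f, \<one>\<^bsub>Q\<^esub>) \<in> ?H" if "f \<in> carrier B" for f
  proof -
    have "subgroup {f \<in> carrier B. (f, \<one>\<^bsub>Q\<^esub>) \<in> ?H} B"
    proof (rule B.subgroupI)
      show "{f \<in> carrier B. (f, \<one>\<^bsub>Q\<^esub>) \<in> ?H} \<noteq> {}" using top[of "\<one>\<^bsub>Q\<^esub>"] by auto
      fix f assume "f \<in> {f \<in> carrier B. (f, \<one>\<^bsub>Q\<^esub>) \<in> ?H}"
      then show "inv\<^bsub>B\<^esub> f \<in> {f \<in> carrier B. (f, \<one>\<^bsub>Q\<^esub>) \<in> ?H}"
        using subgroup.m_inv_closed[OF H, of "(f, \<one>\<^bsub>Q\<^esub>)"] by (auto simp: W_inv translate_one)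
    next
      fix f g assume "f \<in> {f \<in> carrier B. (f, \<one>\<^bsub>Q\<^esub>) \<in> ?H}" "g \<in> {f \<in> carrier B. (f, \<one>\<^bsub>Q\<^esub>) \<in> ?H}"
      then show "f \<otimes>\<^bsub>B\<^esub> g \<in> {f \<in> carrier B. (f, \<one>\<^bsub>Q\<^esub>) \<in> ?H}"
        using subgroup.m_closed[OF H, of "(f, \<one>\<^bsub>Q\<^esub>)" "(g, \<one>\<^bsub>Q\<^esub>)"] by (auto simp: W_mult translate_one)
    qed auto
    from B_generated_by_deltas[OF this, of "carrier Q" f] dq that show ?thesis by auto
  qed
  have "x \<in> ?H" if xW: "x \<in> carrier W" for x
  proof -
    obtain f q where x: "x = (f, q)" "f \<in> carrier B" "q \<in> carrier Q" using xW by (auto simp: W_carrier)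
    have "(f, \<one>\<^bsub>Q\<^esub>) \<otimes>\<^bsub>W\<^esub> (\<one>\<^bsub>B\<^esub>, q) \<in> ?H" using x by (intro subgroup.m_closed[OF H] base top)
    then show ?thesis using x by (simp add: W_mult translate_one)
  qed
  then have "?H = carrier W" using subgroup.subset[OF H] by blast
  then show ?thesis unfolding finitely_generated_def using Z X(2) Y(2) by (intro exI[of _ ?Z]) auto
qed

end

section \<open>Residual finiteness of the base group\<close>

text \<open>Multisets form a commutative monoid as a type and can therefore index a ring type, which
  a group on a carrier cannot; this product leads back from them to the group.\<close>

definition (in comm_group) mset_prod :: "'a multiset \<Rightarrow> 'a" where
  "mset_prod M = finprod G (\<lambda>x. x [^] count M x) (set_mset M)"

lemma (in comm_group) mset_prod_eq:
  assumes "finite U" "set_mset M \<subseteq> U" "U \<subseteq> carrier G"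
  shows "mset_prod M = finprod G (\<lambda>x. x [^] count M x) U"
  unfolding mset_prod_def using assms
  by (intro finprod_mono_neutral_cong_left) (auto simp: not_in_iff)

lemma (in comm_group) mset_prod_closed [simp]: "set_mset M \<subseteq> carrier G \<Longrightarrow> mset_prod M \<in> carrier G"
  unfolding mset_prod_def by (intro finprod_closed) auto

lemma (in comm_group) mset_prod_empty [simp]: "mset_prod {#} = \<one>"
  by (simp add: mset_prod_def)

lemma (in comm_group) mset_prod_add:
  assumes "q \<in> carrier G" "set_mset M \<subseteq> carrier G"
  shows "mset_prod (add_mset q M) = q \<otimes> mset_prod M"
proof -
  let ?U = "insert q (set_mset M)"
  have U: "finite ?U" "?U \<subseteq> carrier G" using assms by auto
  have "mset_prod (add_mset q M) = finprod G (\<lambda>x. x [^] count (add_mset q M) x) ?U"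
    using U by (intro mset_prod_eq) auto
  also have "\<dots> = finprod G (\<lambda>x. (if q = x then x else \<one>) \<otimes> x [^] count M x) ?U"
  proof (rule finprod_cong')
    fix x assume "x \<in> ?U"
    then have "x \<in> carrier G" using U by blast
    then show "x [^] count (add_mset q M) x = (if q = x then x else \<one>) \<otimes> x [^] count M x"
      by (cases "q = x") (simp_all add: m_comm)
  qed (use U in auto)
  also have "\<dots> = finprod G (\<lambda>x. if q = x then x else \<one>) ?U \<otimes> finprod G (\<lambda>x. x [^] count M x) ?U"
    using U by (intro finprod_multf) auto
  also have "finprod G (\<lambda>x. if q = x then x else \<one>) ?U = q"
    using finprod_singleton[of q ?U "\<lambda>x. x"] U by auto
  also have "finprod G (\<lambda>x. x [^] count M x) ?U = mset_prod M"
    using U by (intro mset_prod_eq[symmetric]) auto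
  finally show ?thesis .
qed

section \<open>The base group as the image of a module over a monoid ring\<close>

context abelian_wreath
begin

text \<open>The monomial \<open>(m, M)\<close> with \<open>m = {#a#}\<close> stands for the element \<open>a\<close> at the coordinate
  \<open>\<Prod>M\<close>, so that multiplication by the monomial \<open>({#}, {#q#})\<close> becomes the translation by \<open>q\<close>.\<close>

abbreviation monomials :: "('a multiset \<times> 'b multiset) set" where
  "monomials \<equiv> {({#a#}, M) | a M. a \<in> carrier A \<and> set_mset M \<subseteq> carrier Q}"

abbreviation shift :: "'b \<Rightarrow> ('a multiset \<times> 'b multiset) \<Rightarrow>\<^sub>0 int" where
  "shift q \<equiv> frag_of ({#}, {#q#})"

lemma shift_monomial: "shift q * frag_of (m, M) = frag_of (m, add_mset q M)"
  by (simp add: mult_single)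

lemma keys_shift_mult:
  assumes "q \<in> carrier Q" "Poly_Mapping.keys v \<subseteq> monomials"
  shows "Poly_Mapping.keys (shift q * v) \<subseteq> monomials"
proof -
  have "Poly_Mapping.keys (shift q * v) \<subseteq> {k + l | k l. k \<in> Poly_Mapping.keys (shift q) \<and> l \<in> Poly_Mapping.keys v}"
    by (rule keys_mult)
  also have "\<dots> \<subseteq> monomials"
    using assms by fastforce
  finally show ?thesis .
qed

text \<open>The universal property of the free abelian group prescribes \<open>h\<close> on
  monomials; both sides of the equivariance law are additive, so monomials suffice there too. The
  relations of \<open>A\<close> and \<open>Q\<close> go into the kernel.\<close>

lemma ex_evaluation:
  obtains h where "h \<in> hom (free_Abelian_group monomials) B"
    and "\<And>a M. a \<in> carrier A \<Longrightarrow> set_mset M \<subseteq> carrier Q \<Longrightarrow> h (frag_of ({#a#}, M)) = delta (Q.mset_prod M) a"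
    and "\<And>q v. q \<in> carrier Q \<Longrightarrow> Poly_Mapping.keys v \<subseteq> monomials \<Longrightarrow> h (shift q * v) = translate Q q (h v)"
proof -
  let ?\<phi> = "\<lambda>(m, M). delta (Q.mset_prod M) (the_elem (set_mset m))"
  have "?\<phi> ` monomials \<subseteq> carrier B" by auto
  from B.free_Abelian_group_universal[OF this]
  obtain h where h: "h \<in> hom (free_Abelian_group monomials) B"
    "\<And>x. x \<in> monomials \<Longrightarrow> h (frag_of x) = ?\<phi> x"
    by blast
  interpret h: group_hom "free_Abelian_group monomials" B h
    by (rule group_hom.intro[OF group_free_Abelian_group B.is_group group_hom_axioms.intro[OF h(1)]])
  have hm: "h (frag_of ({#a#}, M)) = delta (Q.mset_prod M) a"
    if "a \<in> carrier A" "set_mset M \<subseteq> carrier Q" for a M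
    using h(2)[of "({#a#}, M)"] that by auto
  have hdiff: "h (u - v) = h u \<otimes>\<^bsub>B\<^esub> inv\<^bsub>B\<^esub> h v" if "Poly_Mapping.keys u \<subseteq> monomials" "Poly_Mapping.keys v \<subseteq> monomials" for u v
    using h.hom_mult[of u "- v"] h.hom_inv[of v] that by (simp add: keys_minus)
  have hc: "h v \<in> carrier B" if "Poly_Mapping.keys v \<subseteq> monomials" for v
    using h.hom_closed[of v] that by simp
  have equiv: "h (shift q * v) = translate Q q (h v)" if q: "q \<in> carrier Q" and v: "Poly_Mapping.keys v \<subseteq> monomials" for q v
    using v
  proof (rule free_Abelian_group_induct)
    interpret t: group_hom B B "translate Q q" using q by (rule translate_hom)
    show "h (shift q * 0) = translate Q q (h 0)" using h.hom_one by simp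
    show "h (shift q * (x - y)) = translate Q q (h (x - y))"
      if "Poly_Mapping.keys x \<subseteq> monomials" "Poly_Mapping.keys y \<subseteq> monomials"
        "h (shift q * x) = translate Q q (h x)" "h (shift q * y) = translate Q q (h y)" for x y
      using that hdiff[OF that(1,2)] hdiff[OF keys_shift_mult[OF q that(1)] keys_shift_mult[OF q that(2)]]
        hc by (simp add: right_diff_distrib)
    show "h (shift q * frag_of x) = translate Q q (h (frag_of x))" if "x \<in> monomials" for x
    proof -
      from that obtain a M where x: "x = ({#a#}, M)" "a \<in> carrier A" "set_mset M \<subseteq> carrier Q" by auto
      have "h (shift q * frag_of x) = delta (Q.mset_prod (add_mset q M)) a"
        unfolding x(1) shift_monomial using x q by (intro hm) auto
      then show ?thesis using x q by (simp add: hm Q.mset_prod_add translate_delta)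
    qed
  qed
  show ?thesis by (rule that[OF h(1) hm equiv])
qed

lemma translate_generate:
  assumes Y: "Y \<subseteq> carrier Q" and H: "H \<subseteq> carrier B"
    and closed: "\<And>y f. y \<in> Y \<union> m_inv Q ` Y \<Longrightarrow> f \<in> H \<Longrightarrow> translate Q y f \<in> H"
    and "p \<in> generate Q Y" "f \<in> H"
  shows "translate Q p f \<in> H"
  using assms(4,5)
proof (induction arbitrary: f)
  case one
  then show ?case using translate_one H by auto
next
  case (eng p q)
  have "p \<in> carrier Q" "q \<in> carrier Q"
    using eng.hyps Q.generate_incl[OF Y] by auto
  then have "translate Q (p \<otimes>\<^bsub>Q\<^esub> q) f = translate Q p (translate Q q f)"
    using eng.prems H by (simp add: subsetD translate_translate)
  then show ?case using eng by simp
qed (use closed in auto)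

definition supported :: "'b set \<Rightarrow> ('b \<Rightarrow> 'a) set" where
  "supported K = {f \<in> carrier B. \<forall>p \<in> carrier Q. p \<notin> K \<longrightarrow> f p = \<one>\<^bsub>A\<^esub>}"

lemma supported_subgroup: "subgroup (supported K) B"
  by (rule B.subgroupI) (auto simp: supported_def B_mult_val B_inv_val B_one_val intro!: exI[of _ "\<one>\<^bsub>B\<^esub>"])

lemma supported_translate:
  assumes "subgroup P Q" "p \<in> P" "\<And>k. k \<in> K \<Longrightarrow> p \<otimes>\<^bsub>Q\<^esub> k \<in> K" "f \<in> supported K"
  shows "translate Q p f \<in> supported K"
proof -
  have p: "p \<in> carrier Q" using subgroup.mem_carrier[OF assms(1,2)] .
  have "translate Q p f q = \<one>\<^bsub>A\<^esub>" if "q \<in> carrier Q" "q \<notin> K" for q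
  proof -
    have "p \<otimes>\<^bsub>Q\<^esub> (inv\<^bsub>Q\<^esub> p \<otimes>\<^bsub>Q\<^esub> q) = q" using that p by (simp flip: Q.m_assoc)
    then have "inv\<^bsub>Q\<^esub> p \<otimes>\<^bsub>Q\<^esub> q \<notin> K" using assms(3) that(2) by metis
    then show ?thesis using assms(4) that p by (simp add: translate_val supported_def)
  qed
  then show ?thesis using assms(4) p by (auto simp: supported_def)
qed

text \<open>Hall's theorem is transported along the evaluation \<open>h\<close>: \<open>N\<close> is
  lifted to a submodule of \<open>?V\<close>, separated there from a preimage of \<open>b\<close>,
  and the result is mapped back to \<open>B\<close>. Finiteness of \<open>\<Sigma>\<close> makes the
  module finitely generated.\<close>

theorem base_residually_finite:
  assumes X: "X \<subseteq> carrier A" "finite X" "generate A X = carrier A"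
    and P: "subgroup P Q" and Y: "Y \<subseteq> P" "finite Y" "generate Q Y = P"
    and \<Sigma>: "\<Sigma> \<subseteq> carrier Q" "finite \<Sigma>" and K: "K = {p \<otimes>\<^bsub>Q\<^esub> s | p s. p \<in> P \<and> s \<in> \<Sigma>}"
    and N: "subgroup N B" "\<forall>p \<in> P. \<forall>n \<in> N. translate Q p n \<in> N"
    and b: "b \<in> supported K" "b \<notin> N"
  shows "\<exists>N'. subgroup N' B \<and> (\<forall>p \<in> P. \<forall>n \<in> N'. translate Q p n \<in> N')
    \<and> N \<inter> supported K \<subseteq> N' \<and> b \<notin> N'
    \<and> (\<exists>T. finite T \<and> T \<subseteq> supported K \<and> (\<forall>f \<in> supported K. \<exists>t \<in> T. f \<otimes>\<^bsub>B\<^esub> inv\<^bsub>B\<^esub> t \<in> N'))"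
proof -
  have PQ: "p \<in> carrier Q" if "p \<in> P" for p using subgroup.mem_carrier[OF P that] .
  have YQ: "Y \<subseteq> carrier Q" using Y(1) PQ by blast
  have YP: "y \<in> P" if "y \<in> Y \<union> m_inv Q ` Y" for y
    using that Y(1) subgroup.m_inv_closed[OF P] by auto
  have PK: "p \<otimes>\<^bsub>Q\<^esub> k \<in> K" if "p \<in> P" "k \<in> K" for p k
  proof -
    from that obtain p' s where "p' \<in> P" "s \<in> \<Sigma>" "k = p' \<otimes>\<^bsub>Q\<^esub> s" unfolding K by blast
    moreover from this have "p \<otimes>\<^bsub>Q\<^esub> k = (p \<otimes>\<^bsub>Q\<^esub> p') \<otimes>\<^bsub>Q\<^esub> s"
      using that PQ \<Sigma> by (auto simp: Q.m_assoc)
    ultimately show ?thesis unfolding K using subgroup.m_closed[OF P that(1)] by blast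
  qed
  obtain h where h: "h \<in> hom (free_Abelian_group monomials) B"
    "\<And>a M. a \<in> carrier A \<Longrightarrow> set_mset M \<subseteq> carrier Q \<Longrightarrow> h (frag_of ({#a#}, M)) = delta (Q.mset_prod M) a"
    "\<And>q v. q \<in> carrier Q \<Longrightarrow> Poly_Mapping.keys v \<subseteq> monomials \<Longrightarrow> h (shift q * v) = translate Q q (h v)"
    by (rule ex_evaluation) (rule that)
  interpret h: group_hom "free_Abelian_group monomials" B h
    by (rule group_hom.intro[OF group_free_Abelian_group B.is_group group_hom_axioms.intro[OF h(1)]])
  have hdiff: "h (u - v) = h u \<otimes>\<^bsub>B\<^esub> inv\<^bsub>B\<^esub> h v" if "Poly_Mapping.keys u \<subseteq> monomials" "Poly_Mapping.keys v \<subseteq> monomials" for u v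
    using h.hom_mult[of u "- v"] h.hom_inv[of v] that by (simp add: keys_minus)
  have hzero: "h 0 = \<one>\<^bsub>B\<^esub>" using h.hom_one by simp
  \<comment> \<open>The shifts are not invertible in the monoid ring, so the inverses of the
    generators of \<open>P\<close> become operators of their own; only their effects under
    \<open>h\<close> are inverse to each other.\<close>
  define Z where "Z = shift ` (Y \<union> m_inv Q ` Y)"
  define F where "F = (\<lambda>(a, s). frag_of ({#a#}, {#s#})) ` (X \<times> \<Sigma>)"
  have fin: "finite Z" "finite F" using Y(2) X(2) \<Sigma>(2) by (auto simp: Z_def F_def)
  let ?V = "mspan Z F"
  have msub: "submod Z {v. Poly_Mapping.keys v \<subseteq> monomials \<and> h v \<in> H}"
    if H: "subgroup H B" and inv: "\<And>p f. p \<in> P \<Longrightarrow> f \<in> H \<Longrightarrow> translate Q p f \<in> H" for H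
  proof (rule submodI)
    show "0 \<in> {v. Poly_Mapping.keys v \<subseteq> monomials \<and> h v \<in> H}" using hzero subgroup.one_closed[OF H] by simp
  next
    fix u v assume "u \<in> {v. Poly_Mapping.keys v \<subseteq> monomials \<and> h v \<in> H}" "v \<in> {v. Poly_Mapping.keys v \<subseteq> monomials \<and> h v \<in> H}"
    then have uv: "Poly_Mapping.keys u \<subseteq> monomials" "Poly_Mapping.keys v \<subseteq> monomials" "h u \<in> H" "h v \<in> H" by blast+
    have "Poly_Mapping.keys (u - v) \<subseteq> monomials" using keys_diff[of u v] uv by blast
    then show "u - v \<in> {v. Poly_Mapping.keys v \<subseteq> monomials \<and> h v \<in> H}"
      using uv subgroup.m_closed[OF H] subgroup.m_inv_closed[OF H] by (simp add: hdiff)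
  next
    fix x v assume "x \<in> Z" and v: "v \<in> {v. Poly_Mapping.keys v \<subseteq> monomials \<and> h v \<in> H}"
    then obtain y where y: "x = shift y" "y \<in> P" using YP by (auto simp: Z_def)
    then show "x * v \<in> {v. Poly_Mapping.keys v \<subseteq> monomials \<and> h v \<in> H}"
      using v keys_shift_mult[OF PQ] h(3)[OF PQ] inv by simp
  qed
  have Vmon: "?V \<subseteq> {v. Poly_Mapping.keys v \<subseteq> monomials \<and> h v \<in> supported K}"
  proof (rule mspan_least[OF msub[OF supported_subgroup]])
    show "translate Q p f \<in> supported K" if "p \<in> P" "f \<in> supported K" for p f
      using P that PK by (intro supported_translate)
    show "F \<subseteq> {v. Poly_Mapping.keys v \<subseteq> monomials \<and> h v \<in> supported K}"
    proof
      fix v assume "v \<in> F"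
      then obtain a s where v: "v = frag_of ({#a#}, {#s#})" "a \<in> X" "s \<in> \<Sigma>" by (auto simp: F_def)
      have s: "s \<in> carrier Q" and a: "a \<in> carrier A" using v X(1) \<Sigma>(1) by auto
      have "s = \<one>\<^bsub>Q\<^esub> \<otimes>\<^bsub>Q\<^esub> s" using s by simp
      then have "s \<in> K" unfolding K using subgroup.one_closed[OF P] v(3) by blast
      moreover have "h v = delta s a"
        using h(2)[of a "{#s#}"] a s Q.mset_prod_add[of s "{#}"] by (simp add: v)
      ultimately have "h v \<in> supported K" using a by (auto simp: supported_def delta_val)
      moreover have "Poly_Mapping.keys v \<subseteq> monomials" using v(1) a s by simp
      ultimately show "v \<in> {v. Poly_Mapping.keys v \<subseteq> monomials \<and> h v \<in> supported K}" by blast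
    qed
  qed
  then have Vk: "Poly_Mapping.keys v \<subseteq> monomials" if "v \<in> ?V" for v using that by blast
  have image_subgroup: "subgroup (h ` U) B" if U: "submod Z U" "U \<subseteq> ?V" for U
  proof (rule B.subgroupI)
    have Uk: "Poly_Mapping.keys v \<subseteq> monomials" if "v \<in> U" for v using that U(2) Vk by blast
    then show "h ` U \<subseteq> carrier B" using h.hom_closed by auto
    show "h ` U \<noteq> {}" using submod_zero[OF U(1)] by blast
    fix f assume "f \<in> h ` U"
    then obtain v where v: "v \<in> U" "f = h v" by blast
    have "h (- v) = inv\<^bsub>B\<^esub> f" using hdiff[of 0 v] Uk[OF v(1)] h.hom_closed[of v] by (simp add: hzero v(2))
    then show "inv\<^bsub>B\<^esub> f \<in> h ` U" using submod_uminus[OF U(1) v(1)] by (metis imageI)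
    fix g assume "g \<in> h ` U"
    then obtain u where u: "u \<in> U" "g = h u" by blast
    have "h (v + u) = f \<otimes>\<^bsub>B\<^esub> g" using h.hom_mult[of v u] Uk[OF v(1)] Uk[OF u(1)] by (simp add: u v)
    then show "f \<otimes>\<^bsub>B\<^esub> g \<in> h ` U" using submod_add[OF U(1) v(1) u(1)] by (metis imageI)
  qed
  have image_translate: "translate Q p f \<in> h ` U" if U: "submod Z U" "U \<subseteq> ?V" and "p \<in> P" "f \<in> h ` U" for U p f
  proof (rule translate_generate[OF YQ subgroup.subset[OF image_subgroup[OF U]]])
    fix y g assume y: "y \<in> Y \<union> m_inv Q ` Y" and "g \<in> h ` U"
    then obtain u where u: "u \<in> U" "g = h u" by blast
    have "Poly_Mapping.keys u \<subseteq> monomials" using u U(2) Vk by blast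
    then have "translate Q y g = h (shift y * u)" using h(3) PQ[OF YP[OF y]] u(2) by simp
    moreover have "shift y * u \<in> U" using y by (intro submod_mult[OF U(1)] u) (auto simp: Z_def)
    ultimately show "translate Q y g \<in> h ` U" by blast
  qed (use that Y(3) in auto)
  have onto: "supported K \<subseteq> h ` ?V"
  proof
    fix f assume f: "f \<in> supported K"
    note HV = image_subgroup[OF submod_mspan order_refl]
    show "f \<in> h ` ?V"
    proof (rule B_generated_by_deltas[OF HV])
      fix q a assume "q \<in> K" and a: "a \<in> carrier A"
      then obtain p s where q: "q = p \<otimes>\<^bsub>Q\<^esub> s" "p \<in> P" "s \<in> \<Sigma>" unfolding K by blast
      have s: "s \<in> carrier Q" using q \<Sigma> by blast
      have "delta s x \<in> h ` ?V" if "x \<in> X" for x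
      proof -
        have "frag_of ({#x#}, {#s#}) \<in> ?V" using that q by (intro mspan.base) (auto simp: F_def)
        moreover have "h (frag_of ({#x#}, {#s#})) = delta s x"
          using h(2)[of x "{#s#}"] X(1) that s Q.mset_prod_add[of s "{#}"] by auto
        ultimately show ?thesis by (metis imageI)
      qed
      then have "delta s a \<in> h ` ?V"
        using a by (intro A.hom_generate_in[OF B.is_group delta_hom X(1,3) HV]) auto
      then have "translate Q p (delta s a) \<in> h ` ?V"
        by (rule image_translate[OF submod_mspan order_refl q(2)])
      then show "delta q a \<in> h ` ?V" using q s a PQ by (simp add: translate_delta)
    qed (use f in \<open>auto simp: supported_def\<close>)
  qed
  \<comment> \<open>The full preimage of \<open>N\<close> in \<open>?V\<close>. It contains the
    kernel of \<open>h\<close> on \<open>?V\<close>, hence so does \<open>N1\<close>, and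
    \<open>b\<close> cannot reappear in the image of \<open>N1\<close>.\<close>
  define N0 where "N0 = ?V \<inter> {v. Poly_Mapping.keys v \<subseteq> monomials \<and> h v \<in> N}"
  have N0: "submod Z N0"
    unfolding N0_def using submod_mspan[of Z F] msub[OF N(1) N(2)[rule_format]]
    by (auto simp: submod_def)
  obtain v0 where v0: "v0 \<in> ?V" "h v0 = b" using onto b(1) by blast
  have "v0 \<notin> N0" using v0 b(2) by (auto simp: N0_def)
  moreover have "N0 \<subseteq> ?V" by (auto simp: N0_def)
  ultimately obtain N1 T where N1: "submod Z N1" "N0 \<subseteq> N1" "N1 \<subseteq> ?V" "v0 \<notin> N1"
    and T: "finite T" "\<forall>v \<in> ?V. \<exists>t \<in> T. v - t \<in> N1"
    using fg_module_residually_finite[OF fin N0 _ v0(1)] by blast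
  have 1: "b \<notin> h ` N1"
  proof
    assume "b \<in> h ` N1"
    then obtain v where v: "v \<in> N1" "b = h v" by blast
    have vV: "v \<in> ?V" using v N1 by blast
    have "h (v0 - v) = \<one>\<^bsub>B\<^esub>"
      using hdiff[OF Vk[OF v0(1)] Vk[OF vV]] h.hom_closed[of v] Vk[OF vV] v0(2) v(2) by simp
    moreover have "v0 - v \<in> ?V" by (rule mspan.diff[OF v0(1) vV])
    ultimately have "v0 - v \<in> N0" using Vk subgroup.one_closed[OF N(1)] by (simp add: N0_def)
    then have "v0 - v \<in> N1" using N1(2) by blast
    from submod_add[OF N1(1) this v(1)] show False using N1(4) by simp
  qed
  have 2: "N \<inter> supported K \<subseteq> h ` N1"
  proof
    fix f assume "f \<in> N \<inter> supported K"
    then obtain v where "v \<in> ?V" "f = h v" "h v \<in> N" using onto by blast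
    then have "v \<in> N0" using Vk by (simp add: N0_def)
    then show "f \<in> h ` N1" using N1(2) \<open>f = h v\<close> by blast
  qed
  \<comment> \<open>Only the elements of \<open>T\<close> in \<open>?V\<close> are known to map into
    \<open>supported K\<close>. Nothing is lost: \<open>t\<close> differs from \<open>v\<close> by
    an element of \<open>N1\<close>, so it lies in \<open>?V\<close>.\<close>
  have 3: "\<exists>t \<in> h ` (T \<inter> ?V). f \<otimes>\<^bsub>B\<^esub> inv\<^bsub>B\<^esub> t \<in> h ` N1" if fK: "f \<in> supported K" for f
  proof -
    obtain v where v: "v \<in> ?V" "f = h v" using onto fK by blast
    obtain t where t: "t \<in> T" "v - t \<in> N1" using T(2) v(1) by blast
    have "v - (v - t) \<in> ?V" by (rule mspan.diff[OF v(1) subsetD[OF N1(3) t(2)]])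
    then have tV: "t \<in> ?V" by simp
    have "f \<otimes>\<^bsub>B\<^esub> inv\<^bsub>B\<^esub> h t = h (v - t)" using hdiff[OF Vk[OF v(1)] Vk[OF tV]] v(2) by simp
    then show ?thesis using t tV by (intro bexI[of _ "h t"]) auto
  qed
  have 4: "finite (h ` (T \<inter> ?V))" "h ` (T \<inter> ?V) \<subseteq> supported K" using T(1) Vmon by auto
  have 5: "subgroup (h ` N1) B" by (rule image_subgroup[OF N1(1,3)])
  note 6 = image_translate[OF N1(1,3)]
  show ?thesis
    by (intro exI[of _ "h ` N1"] conjI exI[of _ "h ` (T \<inter> ?V)"] ballI 1 2 3 4 5 6)
qed

end

section \<open>Separability\<close>

text \<open>With a representative \<open>s\<close> chosen in each coset of \<open>L\<close>, the map
  \<open>\<kappa>\<close> sends \<open>l \<otimes> s\<close> to \<open>\<rho> l \<otimes> s\<close>.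
  By the hypothesis on \<open>E\<close>, its elements in one coset of \<open>L\<close> already share
  a coset of \<open>P\<close>, so that \<open>\<kappa>\<close> can fix them all.\<close>

lemma (in comm_group) ex_collapse:
  assumes P: "subgroup P G" and L: "subgroup L G" "P \<subseteq> L"
    and \<rho>: "\<And>l. l \<in> L \<Longrightarrow> \<rho> l \<in> P" "\<And>l k. l \<in> L \<Longrightarrow> k \<in> L \<Longrightarrow> \<rho> (l \<otimes> k) = \<rho> l \<otimes> \<rho> k"
      "\<And>p. p \<in> P \<Longrightarrow> \<rho> p = p"
    and T: "finite T" "T \<subseteq> carrier G" "\<And>g. g \<in> carrier G \<Longrightarrow> \<exists>l \<in> L. \<exists>t \<in> T. g = l \<otimes> t"
    and E: "E \<subseteq> carrier G" "\<And>d e. d \<in> E \<Longrightarrow> e \<in> E \<Longrightarrow> inv d \<otimes> e \<in> L \<Longrightarrow> inv d \<otimes> e \<in> P"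
  obtains \<kappa> \<Sigma> where "finite \<Sigma>" "\<Sigma> \<subseteq> carrier G"
    "\<And>q. q \<in> carrier G \<Longrightarrow> \<exists>p \<in> P. \<exists>s \<in> \<Sigma>. \<kappa> q = p \<otimes> s"
    "\<And>l q. l \<in> L \<Longrightarrow> q \<in> carrier G \<Longrightarrow> \<kappa> (l \<otimes> q) = \<rho> l \<otimes> \<kappa> q"
    "\<And>s. s \<in> \<Sigma> \<union> E \<Longrightarrow> \<kappa> s = s"
proof -
  have LG: "l \<in> carrier G" if "l \<in> L" for l using subgroup.mem_carrier[OF L(1) that] .
  have PG: "p \<in> carrier G" if "p \<in> P" for p using subgroup.mem_carrier[OF P that] .
  define C where "C q = {s \<in> carrier G. inv s \<otimes> q \<in> L}" for q
  \<comment> \<open>Representatives come from \<open>E\<close> whenever the coset meets it; with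
    others, \<open>\<kappa>\<close> could move elements of \<open>E\<close>.\<close>
  define \<sigma> where "\<sigma> q = (SOME s. s \<in> C q \<and> (E \<inter> C q \<noteq> {} \<longrightarrow> s \<in> E))" for q
  have CL: "C (l \<otimes> q) = C q" if l: "l \<in> L" and q: "q \<in> carrier G" for l q
  proof -
    have "inv s \<otimes> (l \<otimes> q) \<in> L \<longleftrightarrow> inv s \<otimes> q \<in> L" if s: "s \<in> carrier G" for s
    proof
      assume "inv s \<otimes> q \<in> L"
      from subgroup.m_closed[OF L(1) l this] show "inv s \<otimes> (l \<otimes> q) \<in> L"
        using s q LG[OF l] by (simp add: m_ac)
    next
      assume "inv s \<otimes> (l \<otimes> q) \<in> L"
      from subgroup.m_closed[OF L(1) subgroup.m_inv_closed[OF L(1) l] this]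
      have "inv l \<otimes> (inv s \<otimes> (l \<otimes> q)) \<in> L" .
      also have "inv l \<otimes> (inv s \<otimes> (l \<otimes> q)) = inv l \<otimes> (l \<otimes> (inv s \<otimes> q))"
        using s q LG[OF l] by (simp add: m_ac)
      also have "\<dots> = inv s \<otimes> q"
        using s q LG[OF l] by (simp flip: m_assoc)
      finally show "inv s \<otimes> q \<in> L" .
    qed
    then show ?thesis by (auto simp: C_def)
  qed
  then have \<sigma>L: "\<sigma> (l \<otimes> q) = \<sigma> q" if "l \<in> L" "q \<in> carrier G" for l q
    using that by (simp add: \<sigma>_def)
  have Cq: "q \<in> C q" if "q \<in> carrier G" for q
    using that subgroup.one_closed[OF L(1)] by (simp add: C_def)
  have \<sigma>: "\<sigma> q \<in> C q \<and> (E \<inter> C q \<noteq> {} \<longrightarrow> \<sigma> q \<in> E)" if "q \<in> carrier G" for q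
    unfolding \<sigma>_def using Cq[OF that] by (intro someI_ex[of "\<lambda>s. s \<in> C q \<and> (E \<inter> C q \<noteq> {} \<longrightarrow> s \<in> E)"]) blast
  have \<sigma>G: "\<sigma> q \<in> carrier G" "inv (\<sigma> q) \<otimes> q \<in> L" if "q \<in> carrier G" for q
    using \<sigma>[OF that] by (auto simp: C_def)
  have split: "q = (inv (\<sigma> q) \<otimes> q) \<otimes> \<sigma> q" if "q \<in> carrier G" for q
  proof -
    have "(inv (\<sigma> q) \<otimes> q) \<otimes> \<sigma> q = inv (\<sigma> q) \<otimes> (\<sigma> q \<otimes> q)"
      using that \<sigma>G(1)[OF that] by (simp add: m_ac)
    also have "\<dots> = q" using that \<sigma>G(1)[OF that] by (simp flip: m_assoc)
    finally show ?thesis ..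
  qed
  have \<sigma>\<sigma>: "\<sigma> (\<sigma> q) = \<sigma> q" if "q \<in> carrier G" for q
    using \<sigma>L[OF \<sigma>G(2) \<sigma>G(1), OF that that] split[OF that] by simp
  define \<kappa> where "\<kappa> q = \<rho> (inv (\<sigma> q) \<otimes> q) \<otimes> \<sigma> q" for q
  have \<kappa>L: "\<kappa> (l \<otimes> q) = \<rho> l \<otimes> \<kappa> q" if "l \<in> L" "q \<in> carrier G" for l q
  proof -
    have "inv (\<sigma> q) \<otimes> (l \<otimes> q) = l \<otimes> (inv (\<sigma> q) \<otimes> q)"
      using that LG \<sigma>G(1)[OF that(2)] by (simp add: m_ac)
    then have "\<kappa> (l \<otimes> q) = (\<rho> l \<otimes> \<rho> (inv (\<sigma> q) \<otimes> q)) \<otimes> \<sigma> q"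
      using that \<rho>(2)[OF that(1) \<sigma>G(2)[OF that(2)]] by (simp add: \<kappa>_def \<sigma>L)
    then show ?thesis
      using PG \<rho>(1) \<sigma>G[OF that(2)] that(1) by (simp add: \<kappa>_def m_assoc)
  qed
  show ?thesis
  proof (rule that[of "\<sigma> ` T" \<kappa>])
    show "finite (\<sigma> ` T)" "\<sigma> ` T \<subseteq> carrier G" using T \<sigma>G(1) by auto
    show "\<kappa> (l \<otimes> q) = \<rho> l \<otimes> \<kappa> q" if "l \<in> L" "q \<in> carrier G" for l q using that by (rule \<kappa>L)
    show "\<exists>p \<in> P. \<exists>s \<in> \<sigma> ` T. \<kappa> q = p \<otimes> s" if q: "q \<in> carrier G" for q
    proof -
      obtain l t where "l \<in> L" "t \<in> T" "q = l \<otimes> t" using T(3)[OF q] by blast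
      then have "\<sigma> q \<in> \<sigma> ` T" using \<sigma>L[of l t] T(2) by auto
      then show ?thesis using \<rho>(1)[OF \<sigma>G(2)[OF q]] unfolding \<kappa>_def by blast
    qed
    show "\<kappa> s = s" if s: "s \<in> \<sigma> ` T \<union> E" for s
    proof -
      have sG: "s \<in> carrier G" using s E(1) T(2) \<sigma>G(1) by auto
      have "inv (\<sigma> s) \<otimes> s \<in> P"
      proof (cases "s \<in> E")
        case True
        then have "\<sigma> s \<in> E" using \<sigma>[OF sG] Cq[OF sG] by blast
        then show ?thesis using E(2) True \<sigma>G(2)[OF sG] by blast
      next
        case False
        then obtain t where "t \<in> T" "s = \<sigma> t" using s by blast
        then have "\<sigma> s = s" using \<sigma>\<sigma> T(2) by auto
        then show ?thesis using subgroup.one_closed[OF P] sG by simp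
      qed
      then show ?thesis using \<rho>(3) split[OF sG] by (simp add: \<kappa>_def)
    qed
  qed
qed

section \<open>Collapsing coordinates and the separating subgroup\<close>

context abelian_wreath
begin

lemma delta_one: "delta q \<one>\<^bsub>A\<^esub> = \<one>\<^bsub>B\<^esub>"
  by (rule B_eqI) (auto simp: delta_val B_one_val)

text \<open>The universal property of the direct sum: the copy of \<open>A\<close> at
  \<open>q\<close> goes to the copy at \<open>\<kappa> q\<close>, and values whose coordinates get
  the same image are multiplied together.\<close>

lemma ex_push:
  "\<exists>push \<in> hom B B. \<forall>q \<in> carrier Q. \<forall>a \<in> carrier A. push (delta q a) = delta (\<kappa> q) a"
proof (intro bexI ballI)
  let ?push = "\<lambda>f. gfinprod B (\<lambda>q. delta (\<kappa> q) (f q)) (carrier Q)"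
  show "?push \<in> hom B B"
    by (rule B.hom_group_sum[OF delta_hom A.is_group])
  show "?push (delta q a) = delta (\<kappa> q) a" if "q \<in> carrier Q" "a \<in> carrier A" for q a
  proof -
    have "?push (delta q a) = gfinprod B (\<lambda>r. delta (\<kappa> r) (delta q a r)) {q}"
      using that
      by (intro B.gfinprod_mono_neutral_cong_right) (auto simp: delta_val delta_one)
    then show ?thesis using that by (simp add: delta_val)
  qed
qed

lemma homs_eq_on_supported:
  assumes h: "h \<in> hom B B" "k \<in> hom B B"
    and K: "\<And>q a. q \<in> K \<Longrightarrow> a \<in> carrier A \<Longrightarrow> h (delta q a) = k (delta q a)"
    and f: "f \<in> supported K"
  shows "h f = k f"
proof -
  interpret h: group_hom B B h by unfold_locales (rule h)
  interpret k: group_hom B B k by unfold_locales (rule h)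
  have "subgroup {f \<in> carrier B. h f = k f} B"
    by (rule B.subgroupI) (auto intro!: exI[of _ "\<one>\<^bsub>B\<^esub>"])
  from B_generated_by_deltas[OF this, of K f] K f show ?thesis by (auto simp: supported_def)
qed

lemma snd_hom: "snd \<in> hom W Q"
  by (auto simp: hom_def W_carrier W_mult)

lemma finite_index_preimage:
  assumes L: "subgroup L Q" and T: "finite T" "T \<subseteq> carrier Q"
    and cover: "\<And>q. q \<in> carrier Q \<Longrightarrow> \<exists>l \<in> L. \<exists>t \<in> T. q = l \<otimes>\<^bsub>Q\<^esub> t"
  shows "finite_index_subgroup {x \<in> carrier W. snd x \<in> L} W"
proof (rule W.finite_index_subgroupI)
  interpret s: group_hom W Q snd by unfold_locales (rule snd_hom)
  show "subgroup {x \<in> carrier W. snd x \<in> L} W"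
  proof (rule W.subgroupI)
    have "\<one>\<^bsub>W\<^esub> \<in> {x \<in> carrier W. snd x \<in> L}" using subgroup.one_closed[OF L] by simp
    then show "{x \<in> carrier W. snd x \<in> L} \<noteq> {}" by blast
  qed (use subgroup.m_closed[OF L] subgroup.m_inv_closed[OF L] in auto)
  show "finite ((\<lambda>q. (\<one>\<^bsub>B\<^esub>, q)) ` T)" "(\<lambda>q. (\<one>\<^bsub>B\<^esub>, q)) ` T \<subseteq> carrier W"
    using T by (auto simp: W_carrier)
  fix x assume "x \<in> carrier W"
  then obtain f q where x: "x = (f, q)" "f \<in> carrier B" "q \<in> carrier Q" by (cases x) (auto simp: W_carrier)
  obtain l t where lt: "l \<in> L" "t \<in> T" "q = l \<otimes>\<^bsub>Q\<^esub> t" using cover[OF x(3)] by blast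
  have l: "l \<in> carrier Q" using subgroup.mem_carrier[OF L lt(1)] .
  have "x = (f, l) \<otimes>\<^bsub>W\<^esub> (\<one>\<^bsub>B\<^esub>, t)"
    using x lt group_hom.hom_one[OF translate_hom[OF l]] by (simp add: W_mult)
  moreover have "(f, l) \<in> {x \<in> carrier W. snd x \<in> L}" using x l lt(1) by (simp add: W_carrier)
  ultimately show "\<exists>s \<in> {x \<in> carrier W. snd x \<in> L}. \<exists>t \<in> (\<lambda>q. (\<one>\<^bsub>B\<^esub>, q)) ` T. x = s \<otimes>\<^bsub>W\<^esub> t"
    using lt(2) by blast
qed

lemma separate_base_element:
  assumes fgA: "finitely_generated A" and fgQ: "finitely_generated Q"
    and G: "G \<subseteq> carrier W" "finite G" and S: "S = generate W G"
    and b: "b \<in> carrier B" "(b, \<one>\<^bsub>Q\<^esub>) \<notin> S"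
  shows "\<exists>H. finite_index_subgroup H W \<and> S \<subseteq> H \<and> (b, \<one>\<^bsub>Q\<^esub>) \<notin> H"
proof -
  interpret snd: group_hom W Q snd by unfold_locales (rule snd_hom)
  have SW: "subgroup S W" unfolding S by (rule W.generate_is_subgroup[OF G(1)])
  define P where "P = snd ` S"
  have P: "subgroup P Q" unfolding P_def by (rule snd.subgroup_img_is_subgroup[OF SW])
  have PG: "generate Q (snd ` G) = P" unfolding P_def S by (rule snd.generate_img[OF G(1)])
  have GP: "snd ` G \<subseteq> P" unfolding P_def S by (auto intro: generate.incl)
  have PQ: "p \<in> carrier Q" if "p \<in> P" for p using subgroup.mem_carrier[OF P that] .
  have SD: "f \<in> carrier B" "p \<in> P" "p \<in> carrier Q" if "(f, p) \<in> S" for f p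
    using that subgroup.mem_carrier[OF SW that] by (force simp: W_carrier P_def)+
  obtain X where X: "X \<subseteq> carrier A" "finite X" "generate A X = carrier A"
    using fgA by (auto simp: finitely_generated_def)
  obtain Y where Y: "Y \<subseteq> carrier Q" "finite Y" "generate Q Y = carrier Q"
    using fgQ by (auto simp: finitely_generated_def)
  define E where "E = (\<Union>f \<in> insert b (fst ` G). {p \<in> carrier Q. f p \<noteq> \<one>\<^bsub>A\<^esub>})"
  have E: "finite E" "E \<subseteq> carrier Q"
    using G b(1) by (auto simp: E_def W_carrier B_iff)
  \<comment> \<open>If \<open>L\<close> avoids these differences, elements of \<open>E\<close> in
    different cosets of \<open>P\<close> stay in different cosets of \<open>L\<close> and are not
    merged by the collapse.\<close>
  define \<Delta> where "\<Delta> = (\<lambda>(d, e). inv\<^bsub>Q\<^esub> d \<otimes>\<^bsub>Q\<^esub> e) ` (E \<times> E) - P"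
  have "finite \<Delta>" "\<Delta> \<inter> P = {}" using E(1) by (auto simp: \<Delta>_def)
  have "carrier Q \<subseteq> generate Q (P \<union> Y)"
    using Q.mono_generate[of Y "P \<union> Y"] Y(3) by blast
  moreover obtain L \<rho> T where L: "subgroup L Q" "P \<subseteq> L" "L \<inter> \<Delta> = {}"
    and \<rho>: "\<forall>l \<in> L. \<rho> l \<in> P" "\<forall>l \<in> L. \<forall>k \<in> L. \<rho> (l \<otimes>\<^bsub>Q\<^esub> k) = \<rho> l \<otimes>\<^bsub>Q\<^esub> \<rho> k" "\<forall>p \<in> P. \<rho> p = p"
    and T: "finite T" "T \<subseteq> carrier Q" "\<forall>g \<in> generate Q (P \<union> Y). \<exists>l \<in> L. \<exists>t \<in> T. g = l \<otimes>\<^bsub>Q\<^esub> t"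
    using Q.virtual_retract[OF P \<open>finite \<Delta>\<close> \<open>\<Delta> \<inter> P = {}\<close> Y(2,1)]
    by (elim exE conjE) (rule that)
  ultimately have cover: "\<exists>l \<in> L. \<exists>t \<in> T. g = l \<otimes>\<^bsub>Q\<^esub> t" if "g \<in> carrier Q" for g
    using that by blast
  note \<rho> = \<rho>[rule_format]
  have LQ: "l \<in> carrier Q" if "l \<in> L" for l using subgroup.mem_carrier[OF L(1) that] .
  have EL: "inv\<^bsub>Q\<^esub> d \<otimes>\<^bsub>Q\<^esub> e \<in> P" if "d \<in> E" "e \<in> E" "inv\<^bsub>Q\<^esub> d \<otimes>\<^bsub>Q\<^esub> e \<in> L" for d e
    using that L(3) by (auto simp: \<Delta>_def)
  obtain \<kappa> \<Sigma> where \<Sigma>: "finite \<Sigma>" "\<Sigma> \<subseteq> carrier Q"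
    and \<kappa>: "\<And>q. q \<in> carrier Q \<Longrightarrow> \<exists>p \<in> P. \<exists>s \<in> \<Sigma>. \<kappa> q = p \<otimes>\<^bsub>Q\<^esub> s"
      "\<And>l q. l \<in> L \<Longrightarrow> q \<in> carrier Q \<Longrightarrow> \<kappa> (l \<otimes>\<^bsub>Q\<^esub> q) = \<rho> l \<otimes>\<^bsub>Q\<^esub> \<kappa> q"
      "\<And>s. s \<in> \<Sigma> \<union> E \<Longrightarrow> \<kappa> s = s"
    by (rule Q.ex_collapse[OF P L(1,2) \<rho> T(1,2) cover E(2) EL])
      (assumption | (rule that, assumption+))+
  define K where "K = {p \<otimes>\<^bsub>Q\<^esub> s | p s. p \<in> P \<and> s \<in> \<Sigma>}"
  have \<kappa>K: "\<kappa> q \<in> K" if "q \<in> carrier Q" for q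
    using \<kappa>(1)[OF that] unfolding K_def by blast
  have K\<kappa>: "q \<in> carrier Q" "\<kappa> q = q" if qK: "q \<in> K" for q
  proof -
    obtain p s where q: "q = p \<otimes>\<^bsub>Q\<^esub> s" "p \<in> P" "s \<in> \<Sigma>" using qK unfolding K_def by blast
    then show "q \<in> carrier Q" using PQ \<Sigma>(2) by auto
    show "\<kappa> q = q" using q \<kappa>(2)[of p s] \<kappa>(3)[of s] L(2) \<rho>(3) \<Sigma>(2) by auto
  qed
  have PK: "p \<otimes>\<^bsub>Q\<^esub> k \<in> K" if "p \<in> P" "k \<in> K" for p k
  proof -
    have "\<kappa> (p \<otimes>\<^bsub>Q\<^esub> k) = p \<otimes>\<^bsub>Q\<^esub> k"
      using \<kappa>(2)[of p k] that L(2) \<rho>(3) K\<kappa> by auto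
    then show ?thesis using \<kappa>K[of "p \<otimes>\<^bsub>Q\<^esub> k"] that PQ K\<kappa> by simp
  qed
  have suppT: "translate Q p f \<in> supported K" if "p \<in> P" "f \<in> supported K" for p f
    using P that PK by (intro supported_translate)
  have EK: "E \<subseteq> K" using \<kappa>K \<kappa>(3) E(2) by (metis UnCI subsetD subsetI)
  have bK: "b \<in> supported K" using b(1) EK by (auto simp: supported_def E_def)
  obtain push where push: "push \<in> hom B B"
    and "\<forall>q \<in> carrier Q. \<forall>a \<in> carrier A. push (delta q a) = delta (\<kappa> q) a"
    using ex_push[of \<kappa>] by (elim bexE)
  note push_delta = this(2)[rule_format]
  interpret push: group_hom B B push by unfold_locales (rule push)
  have push_id: "push f = f" if "f \<in> supported K" for f
    using homs_eq_on_supported[OF push, of "\<lambda>f. f" K f] that K\<kappa> push_delta by (auto simp: hom_def)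
  \<comment> \<open>This is what makes the map from \<open>(f, l)\<close> to
    \<open>(push f, \<rho> l)\<close> a homomorphism for \<open>l\<close> in \<open>L\<close>. Both
    sides are homomorphisms in \<open>f\<close>, so single coordinates suffice.\<close>
  have push_translate: "push (translate Q l f) = translate Q (\<rho> l) (push f)"
    if l: "l \<in> L" and f: "f \<in> carrier B" for l f
  proof -
    have rl: "\<rho> l \<in> carrier Q" using \<rho>(1)[OF l] PQ by blast
    interpret t: group_hom B B "translate Q l" using LQ[OF l] by (rule translate_hom)
    interpret t': group_hom B B "translate Q (\<rho> l)" using rl by (rule translate_hom)
    have "(push \<circ> translate Q l) f = (translate Q (\<rho> l) \<circ> push) f"
    proof (rule homs_eq_on_supported[where K = "carrier Q" and f = f])
      show "push \<circ> translate Q l \<in> hom B B" by (rule hom_compose[OF t.homh push])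
      show "translate Q (\<rho> l) \<circ> push \<in> hom B B" by (rule hom_compose[OF push t'.homh])
      show "f \<in> supported (carrier Q)" using f by (simp add: supported_def)
      fix q a assume q: "q \<in> carrier Q" and a: "a \<in> carrier A"
      have "\<kappa> q \<in> carrier Q" using \<kappa>K[OF q] K\<kappa>(1) by blast
      then show "(push \<circ> translate Q l) (delta q a) = (translate Q (\<rho> l) \<circ> push) (delta q a)"
        using q a l LQ[OF l] rl \<kappa>(2)[OF l q] by (simp add: translate_delta push_delta)
    qed
    then show ?thesis by simp
  qed
  have push_supported: "push f \<in> supported K" if f: "f \<in> carrier B" for f
  proof -
    have "subgroup {f \<in> carrier B. push f \<in> supported K} B"
      using subgroup.one_closed[OF supported_subgroup] subgroup.m_closed[OF supported_subgroup]
        subgroup.m_inv_closed[OF supported_subgroup]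
      by (intro B.subgroupI) (auto intro!: exI[of _ "\<one>\<^bsub>B\<^esub>"])
    moreover have "delta q a \<in> {f \<in> carrier B. push f \<in> supported K}"
      if "q \<in> carrier Q" "a \<in> carrier A" for q a
      using that \<kappa>K[OF that(1)] by (auto simp: push_delta supported_def delta_val)
    ultimately show ?thesis
      using B_generated_by_deltas[of "{f \<in> carrier B. push f \<in> supported K}" "carrier Q" f] f by blast
  qed
  have S_supp: "f \<in> supported K" if "(f, p) \<in> S" for f p
  proof -
    let ?U = "supported K \<times> P"
    have supB: "f \<in> carrier B" if "f \<in> supported K" for f using that by (simp add: supported_def)
    have "subgroup ?U W"
    proof (rule W.subgroupI)
      show "?U \<subseteq> carrier W" using supB PQ by (auto simp: W_carrier)
      show "?U \<noteq> {}" using subgroup.one_closed[OF supported_subgroup] subgroup.one_closed[OF P] by blast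
      fix x assume "x \<in> ?U"
      then obtain f p where x: "x = (f, p)" "f \<in> supported K" "p \<in> P" by blast
      show "inv\<^bsub>W\<^esub> x \<in> ?U"
        unfolding x(1) W_inv[OF supB[OF x(2)] PQ[OF x(3)]]
        using x suppT subgroup.m_inv_closed[OF P] subgroup.m_inv_closed[OF supported_subgroup] by auto
      fix y assume "y \<in> ?U"
      then obtain g r where y: "y = (g, r)" "g \<in> supported K" "r \<in> P" by blast
      show "x \<otimes>\<^bsub>W\<^esub> y \<in> ?U"
        unfolding x(1) y(1) W_mult
        using x y suppT subgroup.m_closed[OF P] subgroup.m_closed[OF supported_subgroup] by auto
    qed
    moreover have "G \<subseteq> ?U"
    proof
      fix x assume x: "x \<in> G"
      have "fst x \<in> supported K" using x G(1) EK by (auto simp: supported_def E_def W_carrier)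
      moreover have "snd x \<in> P" using x GP by blast
      ultimately show "x \<in> ?U" by (simp add: mem_Times_iff)
    qed
    ultimately have "S \<subseteq> ?U" unfolding S by (rule W.generate_subgroup_incl[rotated])
    then show ?thesis using that by blast
  qed
  define N where "N = {f \<in> carrier B. (f, \<one>\<^bsub>Q\<^esub>) \<in> S}"
  have N: "subgroup N B"
  proof (rule B.subgroupI)
    show "N \<noteq> {}" using subgroup.one_closed[OF SW] by (auto simp: N_def W_one)
    fix f assume "f \<in> N"
    then show "inv\<^bsub>B\<^esub> f \<in> N"
      using subgroup.m_inv_closed[OF SW, of "(f, \<one>\<^bsub>Q\<^esub>)"] by (auto simp: N_def W_inv translate_one)
    fix g assume "g \<in> N"
    with \<open>f \<in> N\<close> show "f \<otimes>\<^bsub>B\<^esub> g \<in> N"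
      using subgroup.m_closed[OF SW, of "(f, \<one>\<^bsub>Q\<^esub>)" "(g, \<one>\<^bsub>Q\<^esub>)"] by (auto simp: N_def W_mult translate_one)
  qed (auto simp: N_def)
  \<comment> \<open>Conjugation by an element of \<open>S\<close> over \<open>p\<close> acts on
    \<open>B\<close> as translation by \<open>p\<close>; its base part has no effect since
    \<open>B\<close> is commutative.\<close>
  have "translate Q p n \<in> N" if p: "p \<in> P" and n: "n \<in> N" for p n
  proof -
    obtain \<beta> where \<beta>: "(\<beta>, p) \<in> S" using p by (auto simp: P_def)
    have nS: "n \<in> carrier B" "(n, \<one>\<^bsub>Q\<^esub>) \<in> S" using n by (auto simp: N_def)
    have "(\<beta>, p) \<otimes>\<^bsub>W\<^esub> (n, \<one>\<^bsub>Q\<^esub>) = (translate Q p n, \<one>\<^bsub>Q\<^esub>) \<otimes>\<^bsub>W\<^esub> (\<beta>, p)"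
      using SD[OF \<beta>] nS(1) by (simp add: W_mult translate_one B.m_comm)
    moreover have "(translate Q p n, \<one>\<^bsub>Q\<^esub>) \<in> carrier W" "(\<beta>, p) \<in> carrier W"
      using SD[OF \<beta>] nS(1) by (auto simp: W_carrier)
    ultimately have "(translate Q p n, \<one>\<^bsub>Q\<^esub>) = (\<beta>, p) \<otimes>\<^bsub>W\<^esub> (n, \<one>\<^bsub>Q\<^esub>) \<otimes>\<^bsub>W\<^esub> inv\<^bsub>W\<^esub> (\<beta>, p)"
      by (simp add: W.m_assoc)
    also have "\<dots> \<in> S"
      by (intro subgroup.m_closed[OF SW] subgroup.m_inv_closed[OF SW] \<beta> nS)
    finally show ?thesis using nS(1) PQ[OF p] by (simp add: N_def)
  qed
  then have NT: "\<forall>p \<in> P. \<forall>n \<in> N. translate Q p n \<in> N" by blast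
  have bN: "b \<notin> N" using b by (simp add: N_def)
  obtain N' T' where N': "subgroup N' B" "\<forall>p \<in> P. \<forall>n \<in> N'. translate Q p n \<in> N'"
      "N \<inter> supported K \<subseteq> N'" "b \<notin> N'"
    and T': "finite T'" "T' \<subseteq> supported K" "\<forall>f \<in> supported K. \<exists>t \<in> T'. f \<otimes>\<^bsub>B\<^esub> inv\<^bsub>B\<^esub> t \<in> N'"
    using base_residually_finite[OF X P GP finite_imageI[OF G(2)] PG \<Sigma>(2,1) K_def N NT bK bN]
    by (elim exE conjE) (rule that)
  note N'T = N'(2)[rule_format]
  \<comment> \<open>The preimage of \<open>N' S\<close> under this homomorphism:
    \<open>\<beta>\<close> witnesses the factorisation of \<open>(push f, \<rho> l)\<close> into
    \<open>(push f \<otimes> inv \<beta>, \<one>)\<close> and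
    \<open>(\<beta>, \<rho> l)\<close>.\<close>
  define H where "H = {(f, l). f \<in> carrier B \<and> l \<in> L \<and> (\<exists>\<beta>. (\<beta>, \<rho> l) \<in> S \<and> push f \<otimes>\<^bsub>B\<^esub> inv\<^bsub>B\<^esub> \<beta> \<in> N')}"
  have HI: "(f, l) \<in> H" if "f \<in> carrier B" "l \<in> L" "(\<beta>, \<rho> l) \<in> S" "push f \<otimes>\<^bsub>B\<^esub> inv\<^bsub>B\<^esub> \<beta> \<in> N'" for f l \<beta>
    using that unfolding H_def by blast
  have SH: "S \<subseteq> H"
  proof
    fix x assume "x \<in> S"
    then obtain f p where x: "x = (f, p)" "(f, p) \<in> S" by (cases x) auto
    note fp = SD[OF x(2)]
    show "x \<in> H" unfolding x(1)
      using fp L(2) \<rho>(3) x(2) push_id[OF S_supp[OF x(2)]] subgroup.one_closed[OF N'(1)]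
      by (intro HI[of f p f]) auto
  qed
  have Hsub: "subgroup H W"
  proof (rule W.subgroupI)
    show "H \<subseteq> carrier W" using LQ by (auto simp: H_def W_carrier)
    show "H \<noteq> {}" using SH subgroup.one_closed[OF SW] by blast
    fix x assume "x \<in> H"
    then obtain f l \<beta> where x: "x = (f, l)" "f \<in> carrier B" "l \<in> L" "(\<beta>, \<rho> l) \<in> S"
      "push f \<otimes>\<^bsub>B\<^esub> inv\<^bsub>B\<^esub> \<beta> \<in> N'" by (auto simp: H_def)
    note rl = SD[OF x(4)] and l = LQ[OF x(3)]
    interpret t: group_hom B B "translate Q (\<rho> l)" using rl(3) by (rule translate_hom)
    show "inv\<^bsub>W\<^esub> x \<in> H" unfolding x(1) W_inv[OF x(2) l]
    proof (rule HI)
      have ri: "\<rho> (inv\<^bsub>Q\<^esub> l) = inv\<^bsub>Q\<^esub> (\<rho> l)"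
      proof (rule Q.inv_equality[symmetric])
        have "\<rho> (inv\<^bsub>Q\<^esub> l) \<otimes>\<^bsub>Q\<^esub> \<rho> l = \<rho> \<one>\<^bsub>Q\<^esub>"
          using \<rho>(2)[OF subgroup.m_inv_closed[OF L(1) x(3)] x(3)] l by simp
        then show "\<rho> (inv\<^bsub>Q\<^esub> l) \<otimes>\<^bsub>Q\<^esub> \<rho> l = \<one>\<^bsub>Q\<^esub>"
          using \<rho>(3)[OF subgroup.one_closed[OF P]] by simp
        show "\<rho> l \<in> carrier Q" by (rule rl)
        show "\<rho> (inv\<^bsub>Q\<^esub> l) \<in> carrier Q"
          using \<rho>(1)[OF subgroup.m_inv_closed[OF L(1) x(3)]] PQ by blast
      qed
      interpret i: group_hom B B "translate Q (inv\<^bsub>Q\<^esub> \<rho> l)" using rl(3) by (intro translate_hom) simp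
      show "translate Q (inv\<^bsub>Q\<^esub> l) (inv\<^bsub>B\<^esub> f) \<in> carrier B" using x(2) l by simp
      show il: "inv\<^bsub>Q\<^esub> l \<in> L" by (rule subgroup.m_inv_closed[OF L(1) x(3)])
      show "(translate Q (inv\<^bsub>Q\<^esub> \<rho> l) (inv\<^bsub>B\<^esub> \<beta>), \<rho> (inv\<^bsub>Q\<^esub> l)) \<in> S"
        using subgroup.m_inv_closed[OF SW x(4)] W_inv[OF rl(1,3)] ri by simp
      have "translate Q (inv\<^bsub>Q\<^esub> \<rho> l) (inv\<^bsub>B\<^esub> (push f \<otimes>\<^bsub>B\<^esub> inv\<^bsub>B\<^esub> \<beta>)) \<in> N'"
        by (intro N'T subgroup.m_inv_closed[OF P] rl subgroup.m_inv_closed[OF N'(1)] x)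
      also have "translate Q (inv\<^bsub>Q\<^esub> \<rho> l) (inv\<^bsub>B\<^esub> (push f \<otimes>\<^bsub>B\<^esub> inv\<^bsub>B\<^esub> \<beta>))
          = push (translate Q (inv\<^bsub>Q\<^esub> l) (inv\<^bsub>B\<^esub> f)) \<otimes>\<^bsub>B\<^esub> inv\<^bsub>B\<^esub> (translate Q (inv\<^bsub>Q\<^esub> \<rho> l) (inv\<^bsub>B\<^esub> \<beta>))"
        using push_translate[OF il] x(2) rl(1) by (simp add: ri B.inv_mult)
      finally show "push (translate Q (inv\<^bsub>Q\<^esub> l) (inv\<^bsub>B\<^esub> f)) \<otimes>\<^bsub>B\<^esub> inv\<^bsub>B\<^esub> (translate Q (inv\<^bsub>Q\<^esub> \<rho> l) (inv\<^bsub>B\<^esub> \<beta>)) \<in> N'" .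
    qed
    fix y assume "y \<in> H"
    then obtain g k \<gamma> where y: "y = (g, k)" "g \<in> carrier B" "k \<in> L" "(\<gamma>, \<rho> k) \<in> S"
      "push g \<otimes>\<^bsub>B\<^esub> inv\<^bsub>B\<^esub> \<gamma> \<in> N'" by (auto simp: H_def)
    note rk = SD[OF y(4)]
    show "x \<otimes>\<^bsub>W\<^esub> y \<in> H" unfolding x(1) y(1) W_mult
    proof (rule HI)
      show "f \<otimes>\<^bsub>B\<^esub> translate Q l g \<in> carrier B" using x(2) y(2) l by simp
      show "l \<otimes>\<^bsub>Q\<^esub> k \<in> L" by (rule subgroup.m_closed[OF L(1) x(3) y(3)])
      show "(\<beta> \<otimes>\<^bsub>B\<^esub> translate Q (\<rho> l) \<gamma>, \<rho> (l \<otimes>\<^bsub>Q\<^esub> k)) \<in> S"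
        using subgroup.m_closed[OF SW x(4) y(4)] \<rho>(2)[OF x(3) y(3)] by (simp add: W_mult)
      have "(push f \<otimes>\<^bsub>B\<^esub> inv\<^bsub>B\<^esub> \<beta>) \<otimes>\<^bsub>B\<^esub> translate Q (\<rho> l) (push g \<otimes>\<^bsub>B\<^esub> inv\<^bsub>B\<^esub> \<gamma>) \<in> N'"
        by (intro subgroup.m_closed[OF N'(1)] N'T rl x y)
      also have "(push f \<otimes>\<^bsub>B\<^esub> inv\<^bsub>B\<^esub> \<beta>) \<otimes>\<^bsub>B\<^esub> translate Q (\<rho> l) (push g \<otimes>\<^bsub>B\<^esub> inv\<^bsub>B\<^esub> \<gamma>)
          = push (f \<otimes>\<^bsub>B\<^esub> translate Q l g) \<otimes>\<^bsub>B\<^esub> inv\<^bsub>B\<^esub> (\<beta> \<otimes>\<^bsub>B\<^esub> translate Q (\<rho> l) \<gamma>)"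
        using push_translate[OF x(3) y(2)] x(2) y(2) l rl rk by (simp add: B.inv_mult B.m_ac)
      finally show "push (f \<otimes>\<^bsub>B\<^esub> translate Q l g) \<otimes>\<^bsub>B\<^esub> inv\<^bsub>B\<^esub> (\<beta> \<otimes>\<^bsub>B\<^esub> translate Q (\<rho> l) \<gamma>) \<in> N'" .
    qed
  qed
  have "(b, \<one>\<^bsub>Q\<^esub>) \<notin> H"
  proof
    assume "(b, \<one>\<^bsub>Q\<^esub>) \<in> H"
    then obtain \<beta> where \<beta>: "(\<beta>, \<rho> \<one>\<^bsub>Q\<^esub>) \<in> S" "push b \<otimes>\<^bsub>B\<^esub> inv\<^bsub>B\<^esub> \<beta> \<in> N'" by (auto simp: H_def)
    then have "(\<beta>, \<one>\<^bsub>Q\<^esub>) \<in> S" using \<rho>(3)[OF subgroup.one_closed[OF P]] by simp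
    then have "\<beta> \<in> N'" using N'(3) S_supp SD by (auto simp: N_def)
    from subgroup.m_closed[OF N'(1) \<beta>(2) this] have "b \<in> N'"
      using push_id[OF bK] b(1) SD(1)[OF \<beta>(1)] by (simp add: B.m_assoc)
    then show False using N'(4) by simp
  qed
  moreover have "finite_index_subgroup H W"
  proof (rule W.finite_index_subgroupI[OF Hsub])
    have T'B: "t \<in> carrier B" if "t \<in> T'" for t using that T'(2) by (auto simp: supported_def)
    show "finite (T' \<times> T)" "T' \<times> T \<subseteq> carrier W" using T T' T'B by (auto simp: W_carrier)
    fix x assume "x \<in> carrier W"
    then obtain f q where x: "x = (f, q)" "f \<in> carrier B" "q \<in> carrier Q" by (cases x) (auto simp: W_carrier)
    obtain l t where lt: "l \<in> L" "t \<in> T" "q = l \<otimes>\<^bsub>Q\<^esub> t" using cover[OF x(3)] by blast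
    obtain \<beta> where \<beta>: "(\<beta>, \<rho> l) \<in> S" using \<rho>(1)[OF lt(1)] by (auto simp: P_def)
    note rl = SD[OF \<beta>] and l = LQ[OF lt(1)]
    \<comment> \<open>In the product of \<open>(?g, l)\<close> and \<open>(t', t)\<close> the factor
      \<open>t'\<close> is translated by \<open>l\<close>, which \<open>push\<close> turns into
      translation by \<open>\<rho> l\<close>; this is undone before \<open>t'\<close> is
      chosen.\<close>
    let ?w = "translate Q (inv\<^bsub>Q\<^esub> \<rho> l) (push f \<otimes>\<^bsub>B\<^esub> inv\<^bsub>B\<^esub> \<beta>)"
    have "?w \<in> supported K"
      using push_supported[OF x(2)] S_supp[OF \<beta>] subgroup.m_inv_closed[OF P rl(2)]
      by (intro suppT subgroup.m_closed[OF supported_subgroup] subgroup.m_inv_closed[OF supported_subgroup]) 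
    then obtain t' where t': "t' \<in> T'" "?w \<otimes>\<^bsub>B\<^esub> inv\<^bsub>B\<^esub> t' \<in> N'" using T'(3) by blast
    have t'B: "t' \<in> carrier B" by (rule T'B[OF t'(1)])
    interpret t: group_hom B B "translate Q (\<rho> l)" using rl(3) by (rule translate_hom)
    interpret tl: group_hom B B "translate Q l" using l by (rule translate_hom)
    have pt': "push t' = t'" using t'(1) T'(2) push_id by blast
    let ?g = "f \<otimes>\<^bsub>B\<^esub> inv\<^bsub>B\<^esub> (translate Q l t')"
    have "translate Q (\<rho> l) (?w \<otimes>\<^bsub>B\<^esub> inv\<^bsub>B\<^esub> t') \<in> N'"
      by (rule N'T[OF rl(2) t'(2)])
    also have "translate Q (\<rho> l) (?w \<otimes>\<^bsub>B\<^esub> inv\<^bsub>B\<^esub> t')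
        = (push f \<otimes>\<^bsub>B\<^esub> inv\<^bsub>B\<^esub> \<beta>) \<otimes>\<^bsub>B\<^esub> inv\<^bsub>B\<^esub> (translate Q (\<rho> l) t')"
      using t'B x(2) rl by (simp add: translate_translate translate_one)
    also have "\<dots> = push ?g \<otimes>\<^bsub>B\<^esub> inv\<^bsub>B\<^esub> \<beta>"
      using t'B x(2) rl l push_translate[OF lt(1) t'B] pt' by (simp add: B.m_ac)
    finally have "(?g, l) \<in> H" using x(2) l t'B lt(1) \<beta> by (intro HI[of ?g l \<beta>]) auto
    moreover have "x = (?g, l) \<otimes>\<^bsub>W\<^esub> (t', t)"
      using x t'B l lt(3) by (simp add: W_mult B.m_assoc)
    ultimately show "\<exists>s \<in> H. \<exists>t \<in> T' \<times> T. x = s \<otimes>\<^bsub>W\<^esub> t" using t'(1) lt(2) by blast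
  qed
  ultimately show ?thesis using SH by blast
qed

lemma separable_finitely_generated:
  assumes fgA: "finitely_generated A" and fgQ: "finitely_generated Q"
    and S: "subgroup S W" and fgS: "finitely_generated (W\<lparr>carrier := S\<rparr>)"
  shows "separable_subgroup S W"
proof (rule W.separable_subgroupI[OF S])
  obtain G where G: "G \<subseteq> S" "finite G" "generate W G = S"
    using fgS W.generate_consistent[OF _ S] by (auto simp: finitely_generated_def)
  have GW: "G \<subseteq> carrier W" using G(1) subgroup.subset[OF S] by blast
  interpret snd: group_hom W Q snd by unfold_locales (rule snd_hom)
  have P: "subgroup (snd ` S) Q" by (rule snd.subgroup_img_is_subgroup[OF S])
  fix x assume x: "x \<in> carrier W" "x \<notin> S"
  obtain b q where bq: "x = (b, q)" "b \<in> carrier B" "q \<in> carrier Q" using x(1) by (cases x) (auto simp: W_carrier)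
  show "\<exists>H. finite_index_subgroup H W \<and> S \<subseteq> H \<and> x \<notin> H"
  proof (cases "q \<in> snd ` S")
    case False
    obtain Y where Y: "Y \<subseteq> carrier Q" "finite Y" "generate Q Y = carrier Q"
      using fgQ by (auto simp: finitely_generated_def)
    have gen: "carrier Q \<subseteq> generate Q (snd ` S \<union> Y)"
      using Q.mono_generate[of Y "snd ` S \<union> Y"] Y(3) by blast
    have "finite {q}" "{q} \<inter> snd ` S = {}" using False by auto
    from Q.virtual_retract[OF P this Y(2,1)]
    obtain L T where L: "subgroup L Q" "snd ` S \<subseteq> L" "L \<inter> {q} = {}"
      and T: "finite T" "T \<subseteq> carrier Q" "\<forall>g \<in> generate Q (snd ` S \<union> Y). \<exists>l \<in> L. \<exists>t \<in> T. g = l \<otimes>\<^bsub>Q\<^esub> t"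
      by (elim exE conjE) (rule that)
    have "finite_index_subgroup {x \<in> carrier W. snd x \<in> L} W"
      using T(3) gen by (intro finite_index_preimage[OF L(1) T(1,2)]) blast
    moreover have "S \<subseteq> {x \<in> carrier W. snd x \<in> L}" using L(2) subgroup.subset[OF S] by blast
    moreover have "x \<notin> {x \<in> carrier W. snd x \<in> L}" using L(3) bq(1) by auto
    ultimately show ?thesis by blast
  next
    case True
    then obtain c where c: "(c, q) \<in> S" by auto
    have cW: "(c, q) \<in> carrier W" using subgroup.mem_carrier[OF S c] .
    then have cB: "c \<in> carrier B" by (simp add: W_carrier)
    \<comment> \<open>Dividing by an element of \<open>S\<close> with the same image in
      \<open>Q\<close> leaves membership in any subgroup containing \<open>S\<close>
      unchanged.\<close>
    let ?b = "b \<otimes>\<^bsub>B\<^esub> inv\<^bsub>B\<^esub> c"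
    have bB: "?b \<in> carrier B" using bq(2) cB by simp
    then have bW: "(?b, \<one>\<^bsub>Q\<^esub>) \<in> carrier W" by (simp add: W_carrier)
    have prod: "(?b, \<one>\<^bsub>Q\<^esub>) \<otimes>\<^bsub>W\<^esub> (c, q) = x"
      using bq cB by (simp add: W_mult translate_one B.m_assoc)
    have "(?b, \<one>\<^bsub>Q\<^esub>) \<notin> S" using subgroup.m_closed[OF S _ c] prod x(2) by metis
    from separate_base_element[OF fgA fgQ GW G(2) G(3)[symmetric] bB this]
    obtain H where H: "finite_index_subgroup H W" "S \<subseteq> H" "(?b, \<one>\<^bsub>Q\<^esub>) \<notin> H" by blast
    have HW: "subgroup H W" using H(1) by (simp add: finite_index_subgroup_def)
    have "x \<notin> H"
    proof
      assume "x \<in> H"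
      moreover have "(c, q) \<in> H" using c H(2) by blast
      ultimately have "x \<otimes>\<^bsub>W\<^esub> inv\<^bsub>W\<^esub> (c, q) \<in> H"
        using HW by (simp add: subgroup.m_closed subgroup.m_inv_closed)
      also have "x \<otimes>\<^bsub>W\<^esub> inv\<^bsub>W\<^esub> (c, q) = (?b, \<one>\<^bsub>Q\<^esub>)"
        unfolding prod[symmetric] using cW bW by (simp add: W.m_assoc)
      finally show False using H(3) by simp
    qed
    then show ?thesis using H by blast
  qed
qed

end

theorem theorem3:
  fixes A :: "('a, 'm) monoid_scheme" and Q :: "('b, 'n) monoid_scheme"
  assumes "comm_group A" and "finitely_generated A"
    and "comm_group Q" and "finitely_generated Q"
  shows "LERF (wreath_product A Q)"
proof -
  interpret abelian_wreath A Q using assms by (intro abelian_wreath.intro)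
  show ?thesis
    unfolding LERF_def
    using W.is_group finitely_generated_W[OF assms(2,4)] separable_finitely_generated[OF assms(2,4)]
    by blast
qed

end
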